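(* Let $G$ be a connected compact simple Lie group of dimension greater than $3$ with Lie algebra $\mathfrak{g}$ and let $h=-B$ be the biinvariant metric on $G$ determined by the negative of the Killing form $B$ of $\mathfrak{g}$. Suppose $k\geq3$ and let $\omega_{i_1\dots i_k}\in S^k(\mathfrak{g}^* )$ be the extension as a left-invariant tensor of the complete polarization of a $\Delta_h$-harmonic homogeneous $G$-invariant polynomial $P$ of degree $k$ on $\mathfrak{g}$. Then the pair $(h,\omega)$ solves the coupled Einstein equations on $G$; that is, for every $c\in\mathbb{R}$ there is a constant $\kappa\in\mathbb{R}$ such that $(h,\omega)$ solves the coupled Einstein equations with constants $c$ and $\kappa$.
   Context: $G$-invariant means invariant under the adjoint action of $G$ on $\mathfrak{g}$, and $\Delta_h$ is the Laplacian of the flat Euclidean metric $h$ on $\mathfrak{g}$. The complete polarization of $P$ is the symmetric $k$-linear form (up to a fixed constant factor) whose restriction to the diagonal is $P$; harmonicity of $P$ is equivalent to it being trace-free. For a metric $h$ on an $n$-manifold with Levi-Civita connection $D$, $\mathrm{Ric}$ and $\mathrm{scal}$ are the Ricci and scalar curvatures (positive for round spheres). For an $h$-trace-free completely symmetric $k$-tensor $\omega$, $k\geq2$, let $\rho(\omega\circledast\omega)_{ij}=\omega_{ia_1\dots a_{k-1}}\omega_j{}^{a_1\dots a_{k-1}}$ and $|\omega|^2=\omega^{i_1\dots i_k}\omega_{i_1\dots i_k}$. The pair $(h,\omega)$ solves the coupled Einstein equations with constants $c,\kappa$ if $\omega$ is trace-free and Codazzi, $D_i\omega_{ji_1\dots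 i_{k-1}}=D_j\omega_{ii_1\dots i_{k-1}}$ (hence also divergence free), and $$\mathrm{Ric}-\tfrac12\mathrm{scal}\,h+\tfrac{n-2}{2n}\kappa h=c\left(\rho(\omega\circledast\omega)-\tfrac12|\omega|^2h\right).$$ *)

theory Defs
  imports "HOL-Analysis.Analysis" "HOL-Algebra.Group"
begin

section \<open>Smooth manifolds\<close>

text \<open>\<open>f\<close> is of class \<open>C\<^sup>n\<close> on the open set \<open>S\<close>; differentiating in every fixed direction
  amounts to taking partial derivatives.\<close>

primrec Ck_on :: "nat \<Rightarrow> 'a::real_normed_vector set \<Rightarrow> ('a \<Rightarrow> 'b::real_normed_vector) \<Rightarrow> bool" where
  "Ck_on 0 S f \<longleftrightarrow> continuous_on S f"
| "Ck_on (Suc n) S f \<longleftrightarrow>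
     (\<forall>x\<in>S. f differentiable (at x)) \<and> (\<forall>v. Ck_on n S (\<lambda>x. frechet_derivative f (at x) v))"

definition smooth_on :: "'a::real_normed_vector set \<Rightarrow> ('a \<Rightarrow> 'b::real_normed_vector) \<Rightarrow> bool" where
  "smooth_on S f \<longleftrightarrow> (\<forall>n. Ck_on n S f)"

text \<open>A chart is a pair \<open>(U, \<phi>)\<close>; the values of \<open>\<phi>\<close> outside \<open>U\<close> are irrelevant, and the inverse
  of \<open>\<phi>\<close> on its image is \<open>inv_into U \<phi>\<close>.  The manifold is the whole type \<open>'a\<close>, of
  dimension \<open>DIM('e)\<close>.\<close>

type_synonym ('a, 'e) chart = "'a set \<times> ('a \<Rightarrow> 'e)"

definition smooth_atlas ::
  "('a::{t2_space, second_countable_topology}, 'e::euclidean_space) chart set \<Rightarrow> bool" where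
  "smooth_atlas A \<longleftrightarrow>
     (\<forall>(U, \<phi>)\<in>A. open U \<and> open (\<phi> ` U) \<and> homeomorphism U (\<phi> ` U) \<phi> (inv_into U \<phi>)) \<and>
     (\<Union>(U, \<phi>)\<in>A. U) = UNIV \<and>
     (\<forall>(U, \<phi>)\<in>A. \<forall>(V, \<psi>)\<in>A. smooth_on (\<phi> ` (U \<inter> V)) (\<psi> \<circ> inv_into U \<phi>))"

definition std_atlas :: "('e, 'e) chart set" where
  "std_atlas = {(UNIV, \<lambda>x. x)}"

definition prod_atlas ::
  "('a, 'e) chart set \<Rightarrow> ('b, 'f) chart set \<Rightarrow> ('a \<times> 'b, 'e \<times> 'f) chart set" where
  "prod_atlas A B = {(U \<times> V, map_prod \<phi> \<psi>) | U \<phi> V \<psi>. (U, \<phi>) \<in> A \<and> (V, \<psi>) \<in> B}"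

definition smooth_map ::
  "('a::topological_space, 'e::euclidean_space) chart set \<Rightarrow>
   ('b::topological_space, 'f::euclidean_space) chart set \<Rightarrow> ('a \<Rightarrow> 'b) \<Rightarrow> bool" where
  "smooth_map A B F \<longleftrightarrow> continuous_on UNIV F \<and>
     (\<forall>(U, \<phi>)\<in>A. \<forall>(V, \<psi>)\<in>B. smooth_on (\<phi> ` (U \<inter> F -` V)) (\<psi> \<circ> F \<circ> inv_into U \<phi>))"

abbreviation smooth_fun ::
  "('a::topological_space, 'e::euclidean_space) chart set \<Rightarrow> ('a \<Rightarrow> real) \<Rightarrow> bool" where
  "smooth_fun A \<equiv> smooth_map A std_atlas"

text \<open>A chart around each point is fixed once and for all.  The tangent space at \<open>p\<close> is represented
  by the model space \<open>'e\<close>: the vector \<open>v\<close> stands for the tangent vector whose components in the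
  chart \<open>chart_at A p\<close> are those of \<open>v\<close>.  Thus vector fields have type \<open>'a \<Rightarrow> 'e\<close>, and the
  differential of a map is computed in the chosen charts at the point and at its image.\<close>

definition chart_at :: "('a, 'e) chart set \<Rightarrow> 'a \<Rightarrow> ('a, 'e) chart" where
  "chart_at A p = (SOME c. c \<in> A \<and> p \<in> fst c)"

definition tangent_map ::
  "('a, 'e::euclidean_space) chart set \<Rightarrow> ('b, 'f::euclidean_space) chart set \<Rightarrow>
   ('a \<Rightarrow> 'b) \<Rightarrow> 'a \<Rightarrow> 'e \<Rightarrow> 'f" where
  "tangent_map A B F p =
     (let (U, \<phi>) = chart_at A p; (V, \<psi>) = chart_at B (F p)
      in frechet_derivative (\<psi> \<circ> F \<circ> inv_into U \<phi>) (at (\<phi> p)))"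

abbreviation dir_deriv ::
  "('a, 'e::euclidean_space) chart set \<Rightarrow> ('a \<Rightarrow> 'b::euclidean_space) \<Rightarrow> 'a \<Rightarrow> 'e \<Rightarrow> 'b" where
  "dir_deriv A \<equiv> tangent_map A std_atlas"

text \<open>The components of a vector field in an arbitrary chart, as a function on the chart image.\<close>

definition vf_in_chart ::
  "('a, 'e::euclidean_space) chart set \<Rightarrow> ('a, 'e) chart \<Rightarrow> ('a \<Rightarrow> 'e) \<Rightarrow> 'e \<Rightarrow> 'e" where
  "vf_in_chart A c X u =
     (let (U, \<phi>) = c; p = inv_into U \<phi> u in dir_deriv A \<phi> p (X p))"

definition smooth_vf ::
  "('a, 'e::euclidean_space) chart set \<Rightarrow> ('a \<Rightarrow> 'e) \<Rightarrow> bool" where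
  "smooth_vf A X \<longleftrightarrow> (\<forall>(U, \<phi>)\<in>A. smooth_on (\<phi> ` U) (vf_in_chart A (U, \<phi>) X))"

text \<open>In coordinates, \<open>[X, Y]\<^sup>i = X\<^sup>j \<partial>\<^sub>j Y\<^sup>i - Y\<^sup>j \<partial>\<^sub>j X\<^sup>i\<close>.\<close>

definition lie_bracket ::
  "('a, 'e::euclidean_space) chart set \<Rightarrow> ('a \<Rightarrow> 'e) \<Rightarrow> ('a \<Rightarrow> 'e) \<Rightarrow> 'a \<Rightarrow> 'e" where
  "lie_bracket A X Y p =
     (let c = chart_at A p; u = snd c p
      in frechet_derivative (vf_in_chart A c Y) (at u) (X p)
       - frechet_derivative (vf_in_chart A c X) (at u) (Y p))"


section \<open>Multilinear forms and contractions\<close>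

text \<open>A \<open>k\<close>-linear form takes a list of \<open>k\<close> vectors; its values on lists of other lengths are
  irrelevant.\<close>

definition multilinear_form :: "nat \<Rightarrow> ('e::real_vector list \<Rightarrow> real) \<Rightarrow> bool" where
  "multilinear_form k T \<longleftrightarrow>
     (\<forall>xs ys. length xs + length ys + 1 = k \<longrightarrow> linear (\<lambda>v. T (xs @ v # ys)))"

definition symmetric_form :: "nat \<Rightarrow> ('e list \<Rightarrow> real) \<Rightarrow> bool" where
  "symmetric_form k T \<longleftrightarrow> (\<forall>xs ys. length xs = k \<and> mset xs = mset ys \<longrightarrow> T xs = T ys)"

definition linear_trace :: "('e::euclidean_space \<Rightarrow> 'e) \<Rightarrow> real" where
  "linear_trace f = (\<Sum>b\<in>Basis. f b \<bullet> b)"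

text \<open>For a nondegenerate symmetric bilinear form \<open>g\<close>, \<open>raise g b\<close> is the vector metrically dual to
  the \<open>b\<close>-coordinate, i.e.\ \<open>\<Sum>\<^sub>j g\<^sup>b\<^sup>j e\<^sub>j\<close> with \<open>g\<^sup>i\<^sup>j\<close> the inverse of the matrix of \<open>g\<close> in the
  basis \<open>Basis\<close>.  The inner product of \<open>'e\<close> is used here only to read off coordinates.  Upper
  indices are contracted by inserting \<open>raise g b\<close> and summing over \<open>b\<close>.\<close>

definition raise :: "('e::euclidean_space \<Rightarrow> 'e \<Rightarrow> real) \<Rightarrow> 'e \<Rightarrow> 'e" where
  "raise g b = (THE w. \<forall>v. g w v = b \<bullet> v)"

definition metric_trace ::
  "('e::euclidean_space \<Rightarrow> 'e \<Rightarrow> real) \<Rightarrow> ('e \<Rightarrow> 'e \<Rightarrow> real) \<Rightarrow> real" where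
  "metric_trace g S = (\<Sum>b\<in>Basis. S b (raise g b))"

text \<open>\<open>\<omega>\<^sub>i\<^sub>a\<^sub>\<dots>\<^sub>b \<omega>\<^sub>j\<^sup>a\<^sup>\<dots>\<^sup>b\<close>\<close>

definition rho_form ::
  "nat \<Rightarrow> ('e::euclidean_space \<Rightarrow> 'e \<Rightarrow> real) \<Rightarrow> ('e list \<Rightarrow> real) \<Rightarrow> 'e \<Rightarrow> 'e \<Rightarrow> real" where
  "rho_form k g T v w =
     (\<Sum>bs | set bs \<subseteq> Basis \<and> length bs = k - 1. T (v # bs) * T (w # map (raise g) bs))"

definition norm_sq_form ::
  "nat \<Rightarrow> ('e::euclidean_space \<Rightarrow> 'e \<Rightarrow> real) \<Rightarrow> ('e list \<Rightarrow> real) \<Rightarrow> real" where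
  "norm_sq_form k g T =
     (\<Sum>bs | set bs \<subseteq> Basis \<and> length bs = k. T bs * T (map (raise g) bs))"

definition trace_free_form ::
  "nat \<Rightarrow> ('e::euclidean_space \<Rightarrow> 'e \<Rightarrow> real) \<Rightarrow> ('e list \<Rightarrow> real) \<Rightarrow> bool" where
  "trace_free_form k g T \<longleftrightarrow>
     (\<forall>vs. length vs + 2 = k \<longrightarrow> metric_trace g (\<lambda>v w. T (v # w # vs)) = 0)"


section \<open>Riemannian geometry\<close>

definition riemannian_metric ::
  "('a::topological_space, 'e::euclidean_space) chart set \<Rightarrow> ('a \<Rightarrow> 'e \<Rightarrow> 'e \<Rightarrow> real) \<Rightarrow> bool" where
  "riemannian_metric A h \<longleftrightarrow>
     (\<forall>p. bilinear (h p) \<and> (\<forall>v w. h p v w = h p w v) \<and> (\<forall>v. v \<noteq> 0 \<longrightarrow> h p v v > 0)) \<and>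
     (\<forall>X Y. smooth_vf A X \<and> smooth_vf A Y \<longrightarrow> smooth_fun A (\<lambda>p. h p (X p) (Y p)))"

definition symmetric_tensor_field ::
  "('a::topological_space, 'e::euclidean_space) chart set \<Rightarrow> nat \<Rightarrow> ('a \<Rightarrow> 'e list \<Rightarrow> real) \<Rightarrow> bool"
  where
  "symmetric_tensor_field A k \<omega> \<longleftrightarrow>
     (\<forall>p. multilinear_form k (\<omega> p) \<and> symmetric_form k (\<omega> p)) \<and>
     (\<forall>Xs. length Xs = k \<and> (\<forall>X\<in>set Xs. smooth_vf A X) \<longrightarrow>
        smooth_fun A (\<lambda>p. \<omega> p (map (\<lambda>X. X p) Xs)))"

definition affine_connection ::
  "('a::topological_space, 'e::euclidean_space) chart set \<Rightarrow>
   (('a \<Rightarrow> 'e) \<Rightarrow> ('a \<Rightarrow> 'e) \<Rightarrow> 'a \<Rightarrow> 'e) \<Rightarrow> bool" where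
  "affine_connection A D \<longleftrightarrow>
     (\<forall>X Y. smooth_vf A X \<and> smooth_vf A Y \<longrightarrow> smooth_vf A (D X Y)) \<and>
     (\<forall>X X' Y p. smooth_vf A X \<and> smooth_vf A X' \<and> smooth_vf A Y \<longrightarrow>
        D (\<lambda>q. X q + X' q) Y p = D X Y p + D X' Y p) \<and>
     (\<forall>f X Y p. smooth_fun A f \<and> smooth_vf A X \<and> smooth_vf A Y \<longrightarrow>
        D (\<lambda>q. f q *\<^sub>R X q) Y p = f p *\<^sub>R D X Y p) \<and>
     (\<forall>X Y Y' p. smooth_vf A X \<and> smooth_vf A Y \<and> smooth_vf A Y' \<longrightarrow>
        D X (\<lambda>q. Y q + Y' q) p = D X Y p + D X Y' p) \<and>
     (\<forall>f X Y p. smooth_fun A f \<and> smooth_vf A X \<and> smooth_vf A Y \<longrightarrow>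
        D X (\<lambda>q. f q *\<^sub>R Y q) p = f p *\<^sub>R D X Y p + dir_deriv A f p (X p) *\<^sub>R Y p)"

definition levi_civita ::
  "('a::topological_space, 'e::euclidean_space) chart set \<Rightarrow> ('a \<Rightarrow> 'e \<Rightarrow> 'e \<Rightarrow> real) \<Rightarrow>
   (('a \<Rightarrow> 'e) \<Rightarrow> ('a \<Rightarrow> 'e) \<Rightarrow> 'a \<Rightarrow> 'e) \<Rightarrow> bool" where
  "levi_civita A h D \<longleftrightarrow> affine_connection A D \<and>
     (\<forall>X Y p. smooth_vf A X \<and> smooth_vf A Y \<longrightarrow> D X Y p - D Y X p = lie_bracket A X Y p) \<and>
     (\<forall>X Y Z p. smooth_vf A X \<and> smooth_vf A Y \<and> smooth_vf A Z \<longrightarrow>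
        dir_deriv A (\<lambda>q. h q (Y q) (Z q)) p (X p) = h p (D X Y p) (Z p) + h p (Y p) (D X Z p))"

text \<open>\<open>R(x, y) z\<close> at \<open>p\<close>: the value at \<open>p\<close> of
  \<open>D\<^sub>X D\<^sub>Y Z - D\<^sub>Y D\<^sub>X Z - D\<^bsub>[X,Y]\<^esub> Z\<close>, which does not depend on the smooth extensions \<open>X, Y, Z\<close> of
  \<open>x, y, z\<close>.  With this sign the Ricci form below is positive on round spheres.\<close>

definition curvature ::
  "('a::topological_space, 'e::euclidean_space) chart set \<Rightarrow>
   (('a \<Rightarrow> 'e) \<Rightarrow> ('a \<Rightarrow> 'e) \<Rightarrow> 'a \<Rightarrow> 'e) \<Rightarrow> 'a \<Rightarrow> 'e \<Rightarrow> 'e \<Rightarrow> 'e \<Rightarrow> 'e" where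
  "curvature A D p x y z =
     (THE w. \<forall>X Y Z. smooth_vf A X \<and> smooth_vf A Y \<and> smooth_vf A Z \<and> X p = x \<and> Y p = y \<and> Z p = z
        \<longrightarrow> w = D X (D Y Z) p - D Y (D X Z) p - D (lie_bracket A X Y) Z p)"

definition ricci ::
  "('a::topological_space, 'e::euclidean_space) chart set \<Rightarrow>
   (('a \<Rightarrow> 'e) \<Rightarrow> ('a \<Rightarrow> 'e) \<Rightarrow> 'a \<Rightarrow> 'e) \<Rightarrow> 'a \<Rightarrow> 'e \<Rightarrow> 'e \<Rightarrow> real" where
  "ricci A D p y z = linear_trace (\<lambda>x. curvature A D p x y z)"

definition scalar_curvature ::
  "('a::topological_space, 'e::euclidean_space) chart set \<Rightarrow> ('a \<Rightarrow> 'e \<Rightarrow> 'e \<Rightarrow> real) \<Rightarrow>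
   (('a \<Rightarrow> 'e) \<Rightarrow> ('a \<Rightarrow> 'e) \<Rightarrow> 'a \<Rightarrow> 'e) \<Rightarrow> 'a \<Rightarrow> real" where
  "scalar_curvature A h D p = metric_trace (h p) (ricci A D p)"

text \<open>\<open>(D\<^sub>X \<omega>)(Y\<^sub>1, \<dots>, Y\<^sub>k) = X(\<omega>(Y\<^sub>1, \<dots>, Y\<^sub>k)) - \<Sum>\<^sub>i \<omega>(Y\<^sub>1, \<dots>, D\<^sub>X Y\<^sub>i, \<dots>, Y\<^sub>k)\<close>\<close>

definition cov_deriv ::
  "('a::topological_space, 'e::euclidean_space) chart set \<Rightarrow>
   (('a \<Rightarrow> 'e) \<Rightarrow> ('a \<Rightarrow> 'e) \<Rightarrow> 'a \<Rightarrow> 'e) \<Rightarrow> ('a \<Rightarrow> 'e list \<Rightarrow> real) \<Rightarrow>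
   ('a \<Rightarrow> 'e) \<Rightarrow> ('a \<Rightarrow> 'e) list \<Rightarrow> 'a \<Rightarrow> real" where
  "cov_deriv A D \<omega> X Ys p =
     dir_deriv A (\<lambda>q. \<omega> q (map (\<lambda>Y. Y q) Ys)) p (X p)
     - (\<Sum>i<length Ys. \<omega> p (map (\<lambda>Y. Y p) (Ys[i := D X (Ys ! i)])))"

definition codazzi ::
  "('a::topological_space, 'e::euclidean_space) chart set \<Rightarrow>
   (('a \<Rightarrow> 'e) \<Rightarrow> ('a \<Rightarrow> 'e) \<Rightarrow> 'a \<Rightarrow> 'e) \<Rightarrow> nat \<Rightarrow> ('a \<Rightarrow> 'e list \<Rightarrow> real) \<Rightarrow> bool" where
  "codazzi A D k \<omega> \<longleftrightarrow>
     (\<forall>X Y Zs p. smooth_vf A X \<and> smooth_vf A Y \<and> (\<forall>Z\<in>set Zs. smooth_vf A Z) \<and> length Zs + 1 = k \<longrightarrow>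
        cov_deriv A D \<omega> X (Y # Zs) p = cov_deriv A D \<omega> Y (X # Zs) p)"

text \<open>The Levi-Civita connection is introduced existentially; it is unique on smooth vector fields,
  and nothing below evaluates \<open>D\<close> on other arguments.\<close>

definition coupled_einstein ::
  "('a::{t2_space, second_countable_topology}, 'e::euclidean_space) chart set \<Rightarrow> nat \<Rightarrow>
   ('a \<Rightarrow> 'e \<Rightarrow> 'e \<Rightarrow> real) \<Rightarrow> ('a \<Rightarrow> 'e list \<Rightarrow> real) \<Rightarrow> real \<Rightarrow> real \<Rightarrow> bool" where
  "coupled_einstein A k h \<omega> c \<kappa> \<longleftrightarrow>
     smooth_atlas A \<and> k \<ge> 2 \<and> riemannian_metric A h \<and> symmetric_tensor_field A k \<omega> \<and>
     (\<forall>p. trace_free_form k (h p) (\<omega> p)) \<and>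
     (\<exists>D. levi_civita A h D \<and> codazzi A D k \<omega> \<and>
        (let n = real DIM('e) in
         \<forall>p v w.
           ricci A D p v w - 1/2 * scalar_curvature A h D p * h p v w
             + (n - 2) / (2 * n) * \<kappa> * h p v w
           = c * (rho_form k (h p) (\<omega> p) v w - 1/2 * norm_sq_form k (h p) (\<omega> p) * h p v w)))"


section \<open>Lie groups\<close>

locale lie_group = group G
  for G :: "'a::{t2_space, second_countable_topology} monoid" (structure) +
  fixes A :: "('a, 'e::euclidean_space) chart set"
  assumes carrier_UNIV: "carrier G = UNIV"
    and atlas: "smooth_atlas A"
    and smooth_mult: "smooth_map (prod_atlas A A) A (\<lambda>(x, y). x \<otimes> y)"
    and smooth_inv: "smooth_map A A (\<lambda>x. inv x)"

text \<open>The Lie algebra is the tangent space at the identity, represented by \<open>'e\<close>, with the bracket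
  of left-invariant vector fields.\<close>

definition left_inv_vf ::
  "'a monoid \<Rightarrow> ('a, 'e::euclidean_space) chart set \<Rightarrow> 'e \<Rightarrow> 'a \<Rightarrow> 'e" where
  "left_inv_vf G A v p = tangent_map A A (\<lambda>x. p \<otimes>\<^bsub>G\<^esub> x) \<one>\<^bsub>G\<^esub> v"

definition la_bracket ::
  "'a monoid \<Rightarrow> ('a, 'e::euclidean_space) chart set \<Rightarrow> 'e \<Rightarrow> 'e \<Rightarrow> 'e" where
  "la_bracket G A v w = lie_bracket A (left_inv_vf G A v) (left_inv_vf G A w) \<one>\<^bsub>G\<^esub>"

definition Ad ::
  "'a monoid \<Rightarrow> ('a, 'e::euclidean_space) chart set \<Rightarrow> 'a \<Rightarrow> 'e \<Rightarrow> 'e" where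
  "Ad G A g = tangent_map A A (\<lambda>x. g \<otimes>\<^bsub>G\<^esub> x \<otimes>\<^bsub>G\<^esub> inv\<^bsub>G\<^esub> g) \<one>\<^bsub>G\<^esub>"

definition killing_form ::
  "'a monoid \<Rightarrow> ('a, 'e::euclidean_space) chart set \<Rightarrow> 'e \<Rightarrow> 'e \<Rightarrow> real" where
  "killing_form G A v w = linear_trace (\<lambda>x. la_bracket G A v (la_bracket G A w x))"

definition simple_lie_algebra :: "('e::real_vector \<Rightarrow> 'e \<Rightarrow> 'e) \<Rightarrow> bool" where
  "simple_lie_algebra br \<longleftrightarrow>
     (\<exists>v w. br v w \<noteq> 0) \<and>
     (\<forall>I. subspace I \<and> (\<forall>v. \<forall>w\<in>I. br v w \<in> I) \<longrightarrow> I = {0} \<or> I = UNIV)"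

text \<open>The extension of a \<open>k\<close>-linear form on the Lie algebra to a left-invariant tensor field: pull
  back along the left translation taking \<open>p\<close> to the identity.\<close>

definition left_inv_tensor ::
  "'a monoid \<Rightarrow> ('a, 'e::euclidean_space) chart set \<Rightarrow> ('e list \<Rightarrow> real) \<Rightarrow> 'a \<Rightarrow> 'e list \<Rightarrow> real"
  where
  "left_inv_tensor G A T p vs = T (map (tangent_map A A (\<lambda>x. inv\<^bsub>G\<^esub> p \<otimes>\<^bsub>G\<^esub> x) p) vs)"

definition neg_killing ::
  "'a monoid \<Rightarrow> ('a, 'e::euclidean_space) chart set \<Rightarrow> 'e \<Rightarrow> 'e \<Rightarrow> real" where
  "neg_killing G A v w = - killing_form G A v w"

definition killing_metric ::
  "'a monoid \<Rightarrow> ('a, 'e::euclidean_space) chart set \<Rightarrow> 'a \<Rightarrow> 'e \<Rightarrow> 'e \<Rightarrow> real" where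
  "killing_metric G A p v w =
     (let dL = tangent_map A A (\<lambda>x. inv\<^bsub>G\<^esub> p \<otimes>\<^bsub>G\<^esub> x) p in neg_killing G A (dL v) (dL w))"


section \<open>Invariant harmonic polynomials\<close>

definition homogeneous_polynomial :: "nat \<Rightarrow> ('e::euclidean_space \<Rightarrow> real) \<Rightarrow> bool" where
  "homogeneous_polynomial k P \<longleftrightarrow>
     real_polynomial_function P \<and> (\<forall>t v. P (t *\<^sub>R v) = t ^ k * P v)"

text \<open>\<open>\<Delta>\<^sub>g P = g\<^sup>i\<^sup>j \<partial>\<^sub>i \<partial>\<^sub>j P\<close> for a constant metric \<open>g\<close>.\<close>

definition flat_laplacian ::
  "('e::euclidean_space \<Rightarrow> 'e \<Rightarrow> real) \<Rightarrow> ('e \<Rightarrow> real) \<Rightarrow> 'e \<Rightarrow> real" where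
  "flat_laplacian g P x =
     metric_trace g (\<lambda>v w.
       frechet_derivative (\<lambda>y. frechet_derivative P (at y) w) (at x) v)"

text \<open>Normalized to restrict to \<open>P\<close> itself on the diagonal; a different constant factor amounts to
  rescaling \<open>P\<close>.\<close>

definition complete_polarization ::
  "nat \<Rightarrow> ('e::euclidean_space \<Rightarrow> real) \<Rightarrow> ('e list \<Rightarrow> real) \<Rightarrow> bool" where
  "complete_polarization k P T \<longleftrightarrow>
     multilinear_form k T \<and> symmetric_form k T \<and> (\<forall>v. T (replicate k v) = P v)"

end

theory Submission
  imports Defs
begin

text \<open>
  Everything is done in the left trivialisation: a vector field \<open>X\<close> corresponds to the function
  \<open>x p = dL\<^sub>p\<^sup>-\<^sup>1 (X p)\<close> with values in the Lie algebra, and smooth fields correspond exactly to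
  smooth functions.  There the bracket of fields is \<open>X y - Y x + [x, y]\<close>, so that
  \<open>D\<^sub>X Y = X y + 1/2 [x, y]\<close> is torsion-free; it is metric because the Killing form is
  invariant.  The terms with derivatives cancel in the curvature, and the Jacobi identity leaves
  \<open>R(x, y) z = - 1/4 [[x, y], z]\<close>, whence \<open>Ric = 1/4 h\<close>.

  An invariant polynomial has an \<open>Ad\<close>-invariant polarisation \<open>T\<close>.  Differentiating the invariance
  at the identity gives \<open>\<Sum>\<^sub>i T(\<dots>, [x, v\<^sub>i], \<dots>) = 0\<close>, which says that \<open>\<omega>\<close> is parallel; in
  particular it is Codazzi.  Harmonicity says that the trace of \<open>T\<close>, a symmetric form of degree
  \<open>k - 2\<close>, vanishes on the diagonal, hence vanishes.  Finally \<open>\<rho>(\<omega> \<circledast> \<omega>)\<close> is an invariant symmetric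
  bilinear form on a simple Lie algebra carrying an invariant inner product, so it is a multiple
  \<open>l h\<close> by Schur's argument (\<open>simple_lie_algebra_invariant_form\<close>), and \<open>|\<omega>|\<^sup>2 = l n\<close>.
  All terms of the equation are then constant multiples of \<open>h\<close>, and \<open>\<kappa>\<close> balances them.

  Two ingredients need more work.  That \<open>h\<close> is positive definite uses an \<open>Ad\<close>-invariant inner
  product \<open>q\<close>, obtained from compactness without integration over the group
  (\<open>bounded_group_invariant_inner_form\<close>): each \<open>ad x\<close> is \<open>q\<close>-skew, so \<open>- tr (ad x)\<^sup>2\<close> is a sum of
  squares, vanishing only for central \<open>x\<close>.  That the derivative of \<open>Ad\<close> is \<open>ad\<close>
  (\<open>dir_deriv_adj\<close>) is read off from the second derivative of the multiplication at the identity;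
  the Jacobi identity and all infinitesimal invariances follow by differentiating statements
  about \<open>Ad\<close>.
\<close>

section \<open>Calculus on open sets\<close>

abbreviation fderiv :: "('a::real_normed_vector \<Rightarrow> 'b::real_normed_vector) \<Rightarrow> 'a \<Rightarrow> 'a \<Rightarrow> 'b" where
  "fderiv f x \<equiv> frechet_derivative f (at x)"

lemma Ck_on_cong:
  assumes "open S" "\<And>x. x \<in> S \<Longrightarrow> f x = g x"
  shows "Ck_on n S f \<longleftrightarrow> Ck_on n S g"
  using assms(2)
proof (induction n arbitrary: f g)
  case 0
  then show ?case by (simp cong: continuous_on_cong)
next
  case (Suc n)
  have D: "f differentiable (at x) \<longleftrightarrow> g differentiable (at x)" if "x \<in> S" for x
    using has_derivative_transform_within_open[OF _ assms(1) that] Suc.prems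
    unfolding differentiable_def by metis
  show ?case
  proof (cases "\<forall>x\<in>S. f differentiable (at x)")
    case True
    then have "fderiv f x v = fderiv g x v" if "x \<in> S" for x v
      using frechet_derivative_transform_within_open[OF _ assms(1) that, of f g] Suc.prems that
      by metis
    then have "Ck_on n S (\<lambda>x. fderiv f x v) = Ck_on n S (\<lambda>x. fderiv g x v)" for v
      by (rule Suc.IH)
    then show ?thesis using D by simp
  qed (use D in auto)
qed

lemma Ck_on_subset: "Ck_on n T f \<Longrightarrow> S \<subseteq> T \<Longrightarrow> Ck_on n S f"
  by (induction n arbitrary: f) (auto intro: continuous_on_subset)

lemma Ck_on_Suc_imp: "Ck_on (Suc n) S f \<Longrightarrow> Ck_on n S f"
proof (induction n arbitrary: f)
  case 0
  then show ?case
    by (simp add: continuous_at_imp_continuous_on differentiable_imp_continuous_within)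
next
  case (Suc n)
  then show ?case by (metis Ck_on.simps(2))
qed

lemma Ck_on_imp_continuous: "Ck_on n S f \<Longrightarrow> continuous_on S f"
proof (induction n)
  case (Suc n)
  then show ?case using Ck_on_Suc_imp by blast
qed simp

lemma Ck_on_local:
  assumes "\<And>x. x \<in> S \<Longrightarrow> \<exists>T. open T \<and> x \<in> T \<and> Ck_on n (S \<inter> T) f"
  shows "Ck_on n S f"
  using assms
proof (induction n arbitrary: f)
  case 0
  have "continuous (at x within S) f" if xS: "x \<in> S" for x
  proof -
    obtain T where T: "open T" "x \<in> T" "Ck_on 0 (S \<inter> T) f" using 0 xS by blast
    then have "continuous (at x within S \<inter> T) f"
      using xS by (simp add: continuous_on_eq_continuous_within)
    moreover have "at x within S \<inter> T = at x within S"
      using at_within_nhd[OF T(2,1), of "S \<inter> T" S] by auto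
    ultimately show ?thesis by simp
  qed
  then show ?case by (simp add: continuous_on_eq_continuous_within)
next
  case (Suc n)
  show ?case unfolding Ck_on.simps
  proof (intro conjI ballI allI)
    fix x assume "x \<in> S" then show "f differentiable at x" using Suc.prems by fastforce
  next
    fix v show "Ck_on n S (\<lambda>x. fderiv f x v)"
      by (rule Suc.IH) (use Suc.prems in fastforce)
  qed
qed

lemma Ck_on_bounded_linear_compose:
  assumes "bounded_linear L" "Ck_on n S f" "open S"
  shows "Ck_on n S (\<lambda>x. L (f x))"
  using assms(2)
proof (induction n arbitrary: f)
  case 0
  then show ?case using assms(1) by (simp add: bounded_linear.continuous_on)
next
  case (Suc n)
  have D: "((\<lambda>x. L (f x)) has_derivative (\<lambda>h. L (fderiv f x h))) (at x)" if "x \<in> S" for x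
    using bounded_linear.has_derivative[OF assms(1)] Suc.prems that
    by (metis (no_types) Ck_on.simps(2) frechet_derivative_works)
  have "Ck_on n S (\<lambda>x. L (fderiv f x v))" for v
    using Suc by simp
  moreover have "fderiv (\<lambda>x. L (f x)) x v = L (fderiv f x v)" if "x \<in> S" for x v
    using frechet_derivative_at[OF D[OF that]] by metis
  ultimately have "Ck_on n S (\<lambda>x. fderiv (\<lambda>x. L (f x)) x v)" for v
    using Ck_on_cong[OF assms(3)] by (metis (no_types, lifting))
  then show ?case using D by (auto simp: differentiable_def)
qed

lemma Ck_on_add:
  assumes "open S" "Ck_on n S f" "Ck_on n S g"
  shows "Ck_on n S (\<lambda>x. f x + g x)"
  using assms(2,3)
proof (induction n arbitrary: f g)
  case 0
  then show ?case by (simp add: continuous_on_add)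
next
  case (Suc n)
  have D: "((\<lambda>x. f x + g x) has_derivative (\<lambda>h. fderiv f x h + fderiv g x h)) (at x)" 
    if "x \<in> S" for x
    using that Suc.prems by (intro has_derivative_add) (auto simp: frechet_derivative_works)
  have "Ck_on n S (\<lambda>x. fderiv f x v + fderiv g x v)" for v
    using Suc by simp
  moreover have "fderiv (\<lambda>x. f x + g x) x v = fderiv f x v + fderiv g x v" if "x \<in> S" for x v
    using frechet_derivative_at[OF D[OF that]] by metis
  ultimately have "Ck_on n S (\<lambda>x. fderiv (\<lambda>x. f x + g x) x v)" for v
    using Ck_on_cong[OF assms(1), of "\<lambda>x. fderiv (\<lambda>x. f x + g x) x v"] by simp
  then show ?case using D by (auto simp: differentiable_def)
qed

lemma Ck_on_const: "Ck_on n S (\<lambda>x. c)"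
  by (induction n arbitrary: c) auto

lemma Ck_on_ident: "Ck_on n S (\<lambda>x. x)"
  by (cases n) (auto intro: Ck_on_const)

lemma Ck_on_sum:
  assumes "open S" "\<And>i. i \<in> I \<Longrightarrow> Ck_on n S (f i)"
  shows "Ck_on n S (\<lambda>x. \<Sum>i\<in>I. f i x)"
  using assms(2) by (induction I rule: infinite_finite_induct) (auto intro: Ck_on_const Ck_on_add[OF assms(1)])

lemma Ck_on_bilinear:
  assumes B: "bounded_bilinear B" and S: "open S" and "Ck_on n S f" "Ck_on n S g"
  shows "Ck_on n S (\<lambda>x. B (f x) (g x))"
  using assms(3,4)
proof (induction n arbitrary: f g)
  case 0
  then show ?case using bounded_bilinear.continuous_on[OF B] by simp
next
  case (Suc n)
  let ?D = "\<lambda>x h. B (f x) (fderiv g x h) + B (fderiv f x h) (g x)"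
  have D: "((\<lambda>x. B (f x) (g x)) has_derivative ?D x) (at x)" if "x \<in> S" for x
    using that Suc.prems by (intro bounded_bilinear.FDERIV[OF B]) (auto simp: frechet_derivative_works)
  have "Ck_on n S (\<lambda>x. ?D x v)" for v
    using Suc.prems by (intro Ck_on_add[OF S] Suc.IH) (auto intro: Ck_on_Suc_imp simp del: Ck_on.simps, auto)
  moreover have "fderiv (\<lambda>x. B (f x) (g x)) x v = ?D x v" if "x \<in> S" for x v
    using frechet_derivative_at[OF D[OF that]] by metis
  ultimately have "Ck_on n S (\<lambda>x. fderiv (\<lambda>x. B (f x) (g x)) x v)" for v
    using Ck_on_cong[OF S, of "\<lambda>x. fderiv (\<lambda>x. B (f x) (g x)) x v"] by simp
  then show ?case using D by (auto simp: differentiable_def)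
qed

lemma linear_expand_Basis:
  fixes f :: "'a::euclidean_space \<Rightarrow> 'b::real_vector"
  assumes "linear f" shows "f v = (\<Sum>b\<in>Basis. (v \<bullet> b) *\<^sub>R f b)"
proof -
  have "f v = f (\<Sum>b\<in>Basis. (v \<bullet> b) *\<^sub>R b)" by (simp add: euclidean_representation)
  then show ?thesis using assms by (simp add: linear_sum linear_scale)
qed

text \<open>Expanding \<open>Df x v\<close> in an orthonormal basis turns \<open>Dg (f x) (Df x v)\<close> into a sum of products of
  a component of \<open>Df\<close> with a partial derivative of \<open>g\<close> composed with \<open>f\<close>, to which the induction
  hypothesis for one derivative less applies.\<close>

lemma Ck_on_compose:
  fixes f :: "'a::real_normed_vector \<Rightarrow> 'b::euclidean_space"
  assumes S: "open S" and "Ck_on n S f" "Ck_on n T g" and fS: "f ` S \<subseteq> T"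
  shows "Ck_on n S (\<lambda>x. g (f x))"
  using assms(2,3)
proof (induction n arbitrary: g)
  case 0
  then show ?case using fS by (auto intro: continuous_on_compose2)
next
  case (Suc n)
  let ?D = "\<lambda>x h. fderiv g (f x) (fderiv f x h)"
  let ?E = "\<lambda>x h. \<Sum>b\<in>Basis. (fderiv f x h \<bullet> b) *\<^sub>R fderiv g (f x) b"
  have D: "((\<lambda>x. g (f x)) has_derivative ?D x) (at x)" if "x \<in> S" for x
  proof -
    have f: "(f has_derivative fderiv f x) (at x)"
      using Suc.prems that by (simp add: frechet_derivative_works)
    have "f x \<in> T" using fS that by blast
    then have "(g has_derivative fderiv g (f x)) (at (f x))"
      using Suc.prems that by (simp add: frechet_derivative_works)
    from has_derivative_compose[OF f this] show ?thesis .
  qed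
  have "Ck_on n S (\<lambda>x. ?E x v)" for v
    using Suc.prems
    by (intro Ck_on_sum[OF S] Ck_on_bilinear[OF bounded_bilinear_scaleR S] Suc.IH
        Ck_on_bounded_linear_compose[OF bounded_linear_inner_left _ S] Ck_on_Suc_imp[of n S f])
      auto
  moreover have "fderiv (\<lambda>x. g (f x)) x v = ?E x v" if "x \<in> S" for x v
  proof -
    have "f x \<in> T" using fS that by blast
    then have "linear (fderiv g (f x))"
      using Suc.prems by (simp add: linear_frechet_derivative)
    then have "?D x v = ?E x v" by (rule linear_expand_Basis)
    then show ?thesis using frechet_derivative_at[OF D[OF that]] by metis
  qed
  ultimately have "Ck_on n S (\<lambda>x. fderiv (\<lambda>x. g (f x)) x v)" for v
    using Ck_on_cong[OF S, of "\<lambda>x. fderiv (\<lambda>x. g (f x)) x v"] by simp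
  then show ?case using D by (auto simp: differentiable_def)
qed

lemma smooth_on_cong: "open S \<Longrightarrow> (\<And>x. x \<in> S \<Longrightarrow> f x = g x) \<Longrightarrow> smooth_on S f \<longleftrightarrow> smooth_on S g"
  unfolding smooth_on_def using Ck_on_cong[of S f g] by blast
lemma smooth_on_subset: "smooth_on T f \<Longrightarrow> S \<subseteq> T \<Longrightarrow> smooth_on S f"
  unfolding smooth_on_def using Ck_on_subset by blast
lemma smooth_on_local: 
  "(\<And>x. x \<in> S \<Longrightarrow> \<exists>T. open T \<and> x \<in> T \<and> smooth_on (S \<inter> T) f) \<Longrightarrow> smooth_on S f"
  unfolding smooth_on_def by (meson Ck_on_local)
lemma smooth_on_continuous: "smooth_on S f \<Longrightarrow> continuous_on S f"
  unfolding smooth_on_def using Ck_on_imp_continuous by blast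
lemma smooth_on_differentiable: "smooth_on S f \<Longrightarrow> x \<in> S \<Longrightarrow> f differentiable (at x)"
  unfolding smooth_on_def using Ck_on.simps(2) by blast
lemma smooth_on_has_derivative:
  "smooth_on S f \<Longrightarrow> x \<in> S \<Longrightarrow> (f has_derivative fderiv f x) (at x)"
  using smooth_on_differentiable frechet_derivative_works by blast
lemma smooth_on_linear_derivative: "smooth_on S f \<Longrightarrow> x \<in> S \<Longrightarrow> linear (fderiv f x)"
  using smooth_on_differentiable linear_frechet_derivative by blast
lemma smooth_on_derivative: "smooth_on S f \<Longrightarrow> smooth_on S (\<lambda>x. fderiv f x v)"
  unfolding smooth_on_def using Ck_on.simps(2) by blast
lemma smooth_on_const: "smooth_on S (\<lambda>x. c)"
  unfolding smooth_on_def using Ck_on_const by blast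
lemma smooth_on_ident: "smooth_on S (\<lambda>x. x)"
  unfolding smooth_on_def using Ck_on_ident by blast
lemma smooth_on_bounded_linear_compose: 
  "bounded_linear L \<Longrightarrow> open S \<Longrightarrow> smooth_on S f \<Longrightarrow> smooth_on S (\<lambda>x. L (f x))"
  unfolding smooth_on_def using Ck_on_bounded_linear_compose by blast
lemma smooth_on_add: "open S \<Longrightarrow> smooth_on S f \<Longrightarrow> smooth_on S g \<Longrightarrow> smooth_on S (\<lambda>x. f x + g x)"
  unfolding smooth_on_def using Ck_on_add by blast
lemma smooth_on_sum: "open S \<Longrightarrow> (\<And>i. i \<in> I \<Longrightarrow> smooth_on S (f i)) \<Longrightarrow> smooth_on S (\<lambda>x. \<Sum>i\<in>I. f i x)"
  unfolding smooth_on_def by (intro allI Ck_on_sum) auto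
lemma smooth_on_bilinear: "bounded_bilinear B \<Longrightarrow> open S \<Longrightarrow> smooth_on S f \<Longrightarrow> smooth_on S g
    \<Longrightarrow> smooth_on S (\<lambda>x. B (f x) (g x))"
  unfolding smooth_on_def using Ck_on_bilinear by blast
lemma smooth_on_compose:
  fixes f :: "'a::real_normed_vector \<Rightarrow> 'b::euclidean_space"
  shows "open S \<Longrightarrow> smooth_on S f \<Longrightarrow> smooth_on T g \<Longrightarrow> f ` S \<subseteq> T \<Longrightarrow> smooth_on S (\<lambda>x. g (f x))"
  unfolding smooth_on_def using Ck_on_compose by blast

lemma smooth_on_Pair:
  assumes "open S" "smooth_on S f" "smooth_on S g"
  shows "smooth_on S (\<lambda>x. (f x, g x))"
proof -
  have "smooth_on S (\<lambda>x. (f x, 0) + (0, g x))"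
    by (rule smooth_on_add[OF assms(1)
          smooth_on_bounded_linear_compose[of "\<lambda>x. (x, 0)", OF bounded_linear_Pair[OF bounded_linear_ident bounded_linear_zero] assms(1,2)]
          smooth_on_bounded_linear_compose[of "\<lambda>x. (0, x)", OF bounded_linear_Pair[OF bounded_linear_zero bounded_linear_ident] assms(1,3)]])
  then show ?thesis by simp
qed

lemma smooth_on_derivative_along:
  fixes f :: "'a::euclidean_space \<Rightarrow> 'b::real_normed_vector" and g :: "'c::real_normed_vector \<Rightarrow> 'a"
    and c :: "'c \<Rightarrow> 'a"
  assumes S: "open S" and T: "smooth_on T f" and "smooth_on S c" "c ` S \<subseteq> T" "smooth_on S g"
  shows "smooth_on S (\<lambda>x. fderiv f (c x) (g x))"
proof -
  have "smooth_on S (\<lambda>x. \<Sum>b\<in>Basis. (g x \<bullet> b) *\<^sub>R fderiv f (c x) b)"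
    by (intro smooth_on_sum S smooth_on_bilinear[OF bounded_bilinear_scaleR]
        smooth_on_bounded_linear_compose[OF bounded_linear_inner_left] assms
        smooth_on_compose[of S c T "\<lambda>x. fderiv f x v" for v] smooth_on_derivative)
  moreover have "fderiv f (c x) (g x) = (\<Sum>b\<in>Basis. (g x \<bullet> b) *\<^sub>R fderiv f (c x) b)"
    if "x \<in> S" for x
    using assms(4) that by (intro linear_expand_Basis smooth_on_linear_derivative[OF T]) auto
  ultimately show ?thesis
    by (subst smooth_on_cong[OF S, where g = "\<lambda>x. \<Sum>b\<in>Basis. (g x \<bullet> b) *\<^sub>R fderiv f (c x) b"])
qed

text \<open>The derivative of \<open>Df (c y) (g y)\<close> when both the base point \<open>c y\<close> and the direction \<open>g y\<close> move:
  the first term differentiates \<open>Df\<close> with the direction frozen, the second uses the linearity of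
  \<open>Df\<close> in the direction.  Second-order computations in charts reduce to this rule.\<close>

lemma has_derivative_derivative_along:
  fixes f :: "'a::euclidean_space \<Rightarrow> 'b::real_normed_vector" and g :: "'c::real_normed_vector \<Rightarrow> 'a"
    and c :: "'c \<Rightarrow> 'a"
  assumes T: "open T" "smooth_on T f" and c: "(c has_derivative c') (at x)" "c x \<in> T"
    and g: "(g has_derivative g') (at x)"
  shows "((\<lambda>y. fderiv f (c y) (g y)) has_derivative
     (\<lambda>h. fderiv (\<lambda>z. fderiv f z (g x)) (c x) (c' h)
        + fderiv f (c x) (g' h))) (at x)"
proof -
  let ?D = "\<lambda>z v. fderiv f z v"
  let ?H = "\<lambda>v w. fderiv (\<lambda>z. ?D z v) (c x) w"
  have lin: "linear (?D z)" if "z \<in> T" for z using smooth_on_linear_derivative T(2) that by blast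
  have b: "((\<lambda>z. ?D z v) has_derivative ?H v) (at (c x))" for v
    using smooth_on_has_derivative[OF smooth_on_derivative[OF T(2)] c(2)] .
  have ex: "?D z v = (\<Sum>b\<in>Basis. (v \<bullet> b) *\<^sub>R ?D z b)" if "z \<in> T" for z v
    using linear_expand_Basis[OF lin[OF that]] .
  have "((\<lambda>z. \<Sum>b\<in>Basis. (v \<bullet> b) *\<^sub>R ?D z b) has_derivative (\<lambda>h. \<Sum>b\<in>Basis. (v \<bullet> b) *\<^sub>R ?H b h)) (at (c x))" for v
    by (intro has_derivative_sum has_derivative_scaleR_right b)
  then have Hd: "((\<lambda>z. ?D z v) has_derivative (\<lambda>h. \<Sum>b\<in>Basis. (v \<bullet> b) *\<^sub>R ?H b h)) (at (c x))" for v
    by (rule has_derivative_transform_within_open[OF _ T(1) c(2)]) (rule ex[symmetric])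
  have Hex: "?H v h = (\<Sum>b\<in>Basis. (v \<bullet> b) *\<^sub>R ?H b h)" for v h
    by (rule fun_cong[OF frechet_derivative_at[OF Hd], symmetric])
  have "((\<lambda>y. \<Sum>b\<in>Basis. (g y \<bullet> b) *\<^sub>R ?D (c y) b) has_derivative
     (\<lambda>h. \<Sum>b\<in>Basis. (g x \<bullet> b) *\<^sub>R ?H b (c' h) + (g' h \<bullet> b) *\<^sub>R ?D (c x) b)) (at x)"
    by (intro has_derivative_sum has_derivative_scaleR has_derivative_inner_left g
        has_derivative_compose[OF c(1) b])
  then have 1: "((\<lambda>y. \<Sum>b\<in>Basis. (g y \<bullet> b) *\<^sub>R ?D (c y) b) has_derivative
     (\<lambda>h. ?H (g x) (c' h) + ?D (c x) (g' h))) (at x)"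
    unfolding sum.distrib Hex[symmetric] ex[OF c(2), symmetric] .
  have "continuous (at x) c" using c(1) has_derivative_continuous by blast
  then have "\<forall>\<^sub>F y in at x. c y \<in> T"
    using topological_tendstoD[OF _ T(1) c(2)] unfolding isCont_def by blast
  then have "\<forall>\<^sub>F y in at x. (\<Sum>b\<in>Basis. (g y \<bullet> b) *\<^sub>R ?D (c y) b) = ?D (c y) (g y)"
    by (rule eventually_mono) (rule ex[symmetric])
  then show ?thesis
    by (rule has_derivative_transform_eventually[OF 1]) (auto intro: ex[OF c(2), symmetric])
qed

text \<open>The mean value theorem along \<open>v\<close>, applied to the difference of \<open>f\<close> across a step in the direction
  \<open>w\<close>, and then along \<open>w\<close>, applied to the derivative of \<open>f\<close> in the direction \<open>v\<close>.\<close>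

lemma second_difference_mvt:
  fixes f :: "'a::euclidean_space \<Rightarrow> real"
  assumes f: "smooth_on S f" and s: "s > 0"
    and box: "\<And>a b. 0 \<le> a \<Longrightarrow> a \<le> s \<Longrightarrow> 0 \<le> b \<Longrightarrow> b \<le> s \<Longrightarrow> x + a *\<^sub>R v + b *\<^sub>R w \<in> S"
  shows "\<exists>a b. 0 < a \<and> a < s \<and> 0 < b \<and> b < s \<and>
     f (x + s *\<^sub>R v + s *\<^sub>R w) - f (x + s *\<^sub>R v) - f (x + s *\<^sub>R w) + f x
      = s * s * fderiv (\<lambda>z. fderiv f z v) (x + a *\<^sub>R v + b *\<^sub>R w) w"
proof -
  let ?D = "\<lambda>z. fderiv f z v"
  have d: "((\<lambda>a. f (x + a *\<^sub>R v + b *\<^sub>R w)) has_real_derivative ?D (x + a *\<^sub>R v + b *\<^sub>R w)) (at a)"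
    if "0 \<le> a" "a \<le> s" "0 \<le> b" "b \<le> s" for a b
  proof -
    have "((\<lambda>a. f (x + a *\<^sub>R v + b *\<^sub>R w)) has_derivative
        (\<lambda>h. fderiv f (x + a *\<^sub>R v + b *\<^sub>R w) (h *\<^sub>R v))) (at a)"
      by (rule has_derivative_compose[where g = f and f = "\<lambda>a. x + a *\<^sub>R v + b *\<^sub>R w" and x = a, OF _ smooth_on_has_derivative[OF f box[OF that]]])
        (auto intro!: derivative_eq_intros)
    moreover have "(\<lambda>h. fderiv f (x + a *\<^sub>R v + b *\<^sub>R w) (h *\<^sub>R v))
       = (*) (?D (x + a *\<^sub>R v + b *\<^sub>R w))"
      by (rule ext) (simp add: linear_scale[OF smooth_on_linear_derivative[OF f box[OF that]]] mult.commute)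
    ultimately show ?thesis by (simp only: has_field_derivative_def)
  qed
  have "\<exists>a. 0 < a \<and> a < s \<and> (f (x + s *\<^sub>R v + s *\<^sub>R w) - f (x + s *\<^sub>R v + 0 *\<^sub>R w))
     - (f (x + 0 *\<^sub>R v + s *\<^sub>R w) - f (x + 0 *\<^sub>R v + 0 *\<^sub>R w))
     = (s - 0) * (?D (x + a *\<^sub>R v + s *\<^sub>R w) - ?D (x + a *\<^sub>R v + 0 *\<^sub>R w))"
    by (rule MVT2[OF s, of "\<lambda>a. f (x + a *\<^sub>R v + s *\<^sub>R w) - f (x + a *\<^sub>R v + 0 *\<^sub>R w)"])
      (use s d in \<open>auto intro!: DERIV_diff d simp del: scaleR_zero_left\<close>)
  then obtain a where a: "0 < a" "a < s" 
    and 1: "f (x + s *\<^sub>R v + s *\<^sub>R w) - f (x + s *\<^sub>R v) - f (x + s *\<^sub>R w) + f x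
      = s * (?D (x + a *\<^sub>R v + s *\<^sub>R w) - ?D (x + a *\<^sub>R v + 0 *\<^sub>R w))" by auto
  have d2: "((\<lambda>b. ?D (x + a *\<^sub>R v + b *\<^sub>R w)) has_real_derivative
      fderiv ?D (x + a *\<^sub>R v + b *\<^sub>R w) w) (at b)"
    if "0 \<le> b" "b \<le> s" for b
  proof -
    have m: "x + a *\<^sub>R v + b *\<^sub>R w \<in> S" using a that box by simp
    have "((\<lambda>b. ?D (x + a *\<^sub>R v + b *\<^sub>R w)) has_derivative
        (\<lambda>h. fderiv ?D (x + a *\<^sub>R v + b *\<^sub>R w) (h *\<^sub>R w))) (at b)"
      by (rule has_derivative_compose[where g = ?D and f = "\<lambda>b. x + a *\<^sub>R v + b *\<^sub>R w" and x = b, OF _ smooth_on_has_derivative[OF smooth_on_derivative[OF f] m]])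
        (auto intro!: derivative_eq_intros)
    moreover have "(\<lambda>h. fderiv ?D (x + a *\<^sub>R v + b *\<^sub>R w) (h *\<^sub>R w))
       = (*) (fderiv ?D (x + a *\<^sub>R v + b *\<^sub>R w) w)"
      by (rule ext)
        (simp add: linear_scale[OF smooth_on_linear_derivative[OF smooth_on_derivative[OF f] m]] mult.commute)
    ultimately show ?thesis by (simp only: has_field_derivative_def)
  qed
  obtain b where "0 < b" "b < s" "?D (x + a *\<^sub>R v + s *\<^sub>R w) - ?D (x + a *\<^sub>R v + 0 *\<^sub>R w) 
     = (s - 0) * fderiv ?D (x + a *\<^sub>R v + b *\<^sub>R w) w"
    using MVT2[OF s d2] by auto
  then show ?thesis using a 1 by (intro exI[of _ a] exI[of _ b]) auto
qed

text \<open>The second difference of \<open>f\<close> is symmetric in \<open>v\<close> and \<open>w\<close>, so by the mean value theorem both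
  mixed derivatives take a common value at points arbitrarily close to \<open>x\<close>;
  continuity of the mixed derivatives concludes.\<close>

lemma second_derivative_symmetric_real:
  fixes f :: "'a::euclidean_space \<Rightarrow> real"
  assumes S: "open S" and f: "smooth_on S f" and x: "x \<in> S"
  shows "fderiv (\<lambda>z. fderiv f z v) x w
       = fderiv (\<lambda>z. fderiv f z w) x v"
proof -
  define F where "F = (\<lambda>v w y. fderiv (\<lambda>z. fderiv f z v) y w)"
  have cont: "isCont (F v w) x" for v w
    unfolding F_def using smooth_on_continuous[OF smooth_on_derivative[OF smooth_on_derivative[OF f]]]
      S x continuous_on_eq_continuous_at by blast
  have close: "\<bar>F v w x - F w v x\<bar> < e" if e: "e > 0" for e
  proof -
    obtain r where r: "r > 0" "ball x r \<subseteq> S" using S x openE by blast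
    obtain d1 where d1: "d1 > 0" "\<And>y. dist y x < d1 \<Longrightarrow> dist (F v w y) (F v w x) < e/2"
      using cont[of v w] e unfolding continuous_at_eps_delta by (metis half_gt_zero)
    obtain d2 where d2: "d2 > 0" "\<And>y. dist y x < d2 \<Longrightarrow> dist (F w v y) (F w v x) < e/2"
      using cont[of w v] e unfolding continuous_at_eps_delta by (metis half_gt_zero)
    define d where "d = min r (min d1 d2)"
    \<comment> \<open>the parallelogram with sides \<open>s v\<close> and \<open>s w\<close> stays within distance \<open>d\<close> of \<open>x\<close>\<close>
    define s where "s = d / (2 * (norm v + norm w + 1))"
    have d: "d > 0" using r d1 d2 by (simp add: d_def)
    have s: "s > 0" using d by (simp add: s_def add_nonneg_pos)
    have near: "dist (x + a *\<^sub>R v + b *\<^sub>R w) x < d" if "0 \<le> a" "a \<le> s" "0 \<le> b" "b \<le> s" for a b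
    proof -
      have "dist (x + a *\<^sub>R v + b *\<^sub>R w) x = norm (a *\<^sub>R v + b *\<^sub>R w)" by (simp add: dist_norm add.assoc)
      also have "\<dots> \<le> a * norm v + b * norm w"
        using norm_triangle_ineq[of "a *\<^sub>R v" "b *\<^sub>R w"] that by simp
      also have "\<dots> \<le> s * norm v + s * norm w"
        using that by (intro add_mono mult_right_mono) auto
      also have "\<dots> \<le> s * (norm v + norm w + 1)" using s by (simp add: algebra_simps)
      also have "\<dots> = d / 2"
        unfolding s_def using norm_ge_zero[of v] norm_ge_zero[of w] by (simp add: field_simps add_nonneg_eq_0_iff)
      also have "\<dots> < d" using d by simp
      finally show ?thesis .
    qed
    have box: "x + a *\<^sub>R v + b *\<^sub>R w \<in> S" if "0 \<le> a" "a \<le> s" "0 \<le> b" "b \<le> s" for a b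
      using near[OF that] r(2) by (auto simp: d_def dist_commute)
    obtain a b where ab: "0 < a" "a < s" "0 < b" "b < s" 
      "f (x + s *\<^sub>R v + s *\<^sub>R w) - f (x + s *\<^sub>R v) - f (x + s *\<^sub>R w) + f x = s * s * F v w (x + a *\<^sub>R v + b *\<^sub>R w)"
      using second_difference_mvt[OF f s box] unfolding F_def by blast
    have box': "x + a *\<^sub>R w + b *\<^sub>R v \<in> S" if "0 \<le> a" "a \<le> s" "0 \<le> b" "b \<le> s" for a b
      using box[of b a] that by (simp add: algebra_simps)
    obtain a' b' where ab': "0 < a'" "a' < s" "0 < b'" "b' < s" 
      "f (x + s *\<^sub>R w + s *\<^sub>R v) - f (x + s *\<^sub>R w) - f (x + s *\<^sub>R v) + f x = s * s * F w v (x + a' *\<^sub>R w + b' *\<^sub>R v)"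
      using second_difference_mvt[OF f s box'] unfolding F_def by blast
    have "s * s * F v w (x + a *\<^sub>R v + b *\<^sub>R w) = s * s * F w v (x + a' *\<^sub>R w + b' *\<^sub>R v)"
      using ab(5) ab'(5) by (simp add: algebra_simps)
    then have eq: "F v w (x + a *\<^sub>R v + b *\<^sub>R w) = F w v (x + a' *\<^sub>R w + b' *\<^sub>R v)" using s by simp
    have c1: "dist (F v w (x + a *\<^sub>R v + b *\<^sub>R w)) (F v w x) < e/2"
      using near[of a b] ab by (intro d1(2)) (simp add: d_def)
    have c2: "dist (F w v (x + a' *\<^sub>R w + b' *\<^sub>R v)) (F w v x) < e/2"
      using near[of b' a'] ab' by (intro d2(2)) (simp add: d_def algebra_simps)
    show ?thesis using c1 c2 unfolding eq dist_real_def by arith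
  qed
  have "F v w x = F w v x"
  proof (rule ccontr)
    assume "F v w x \<noteq> F w v x"
    then show False using close[of "\<bar>F v w x - F w v x\<bar>"] by simp
  qed
  then show ?thesis by (simp add: F_def)
qed

lemma second_derivative_symmetric:
  fixes f :: "'a::euclidean_space \<Rightarrow> 'b::euclidean_space"
  assumes S: "open S" and f: "smooth_on S f" and x: "x \<in> S"
  shows "fderiv (\<lambda>z. fderiv f z v) x w
       = fderiv (\<lambda>z. fderiv f z w) x v"
proof (rule euclidean_eqI)
  fix b :: 'b assume "b \<in> Basis"
  let ?f = "\<lambda>x. f x \<bullet> b"
  have sf: "smooth_on S ?f"
    by (rule smooth_on_bounded_linear_compose[OF bounded_linear_inner_left S f])
  have 1: "fderiv (\<lambda>x. g x \<bullet> b) y v = fderiv g y v \<bullet> b"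
    if "smooth_on S g" "y \<in> S" for g :: "'a \<Rightarrow> 'b" and y v
    using frechet_derivative_at[OF has_derivative_inner_left[OF smooth_on_has_derivative[OF that]]] by metis
  have 2: "fderiv (\<lambda>z. fderiv ?f z v) x w
     = fderiv (\<lambda>z. fderiv f z v) x w \<bullet> b" for v w
  proof -
    have "fderiv (\<lambda>z. fderiv ?f z v) x
       = fderiv (\<lambda>z. fderiv f z v \<bullet> b) x"
      using smooth_on_differentiable[OF smooth_on_derivative[OF sf] x] 1[OF f]
      by (intro frechet_derivative_transform_within_open[OF _ S x]) auto
    then show ?thesis using 1[OF smooth_on_derivative[OF f] x] by simp
  qed
  show "fderiv (\<lambda>z. fderiv f z v) x w \<bullet> b
       = fderiv (\<lambda>z. fderiv f z w) x v \<bullet> b"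
    using second_derivative_symmetric_real[OF S sf x, of v w] unfolding 2 .
qed

section \<open>Charts and smooth maps\<close>

lemma smooth_atlasD:
  assumes "smooth_atlas A" "(U, \<phi>) \<in> A"
  shows "open U" "open (\<phi> ` U)" "homeomorphism U (\<phi> ` U) \<phi> (inv_into U \<phi>)"
    "inj_on \<phi> U" "continuous_on U \<phi>" "continuous_on (\<phi> ` U) (inv_into U \<phi>)"
proof -
  show *: "open U" "open (\<phi> ` U)" "homeomorphism U (\<phi> ` U) \<phi> (inv_into U \<phi>)"
    using assms unfolding smooth_atlas_def by fast+
  then show "continuous_on U \<phi>" "continuous_on (\<phi> ` U) (inv_into U \<phi>)"
    by (auto simp: homeomorphism_def)
  show "inj_on \<phi> U" using *(3) by (metis homeomorphism_def inj_on_inverseI)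
qed

lemma smooth_atlas_transition:
  assumes "smooth_atlas A" "(U, \<phi>) \<in> A" "(V, \<psi>) \<in> A"
  shows "smooth_on (\<phi> ` (U \<inter> V)) (\<psi> \<circ> inv_into U \<phi>)"
  using assms unfolding smooth_atlas_def by fast

lemma smooth_atlas_cover:
  assumes "smooth_atlas A" obtains U \<phi> where "(U, \<phi>) \<in> A" "p \<in> U"
  using assms unfolding smooth_atlas_def by blast

lemma chart_inverse:
  assumes "smooth_atlas A" "(U, \<phi>) \<in> A" "p \<in> U"
  shows "inv_into U \<phi> (\<phi> p) = p"
  using smooth_atlasD(4)[OF assms(1,2)] assms(3) by simp

lemma chart_image_open:
  assumes "smooth_atlas A" "(U, \<phi>) \<in> A" "open T"
  shows "open (\<phi> ` (U \<inter> T))"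
proof -
  have "\<phi> ` (U \<inter> T) = \<phi> ` U \<inter> inv_into U \<phi> -` T"
    using chart_inverse[OF assms(1,2)] by auto
  then show ?thesis
    using continuous_open_preimage[OF smooth_atlasD(6)[OF assms(1,2)] smooth_atlasD(2)[OF assms(1,2)] assms(3)] by simp
qed

lemma chart_at_mem:
  assumes "smooth_atlas A" "chart_at A p = (U, \<phi>)"
  shows "(U, \<phi>) \<in> A" "p \<in> U"
proof -
  obtain V \<psi> where "(V, \<psi>) \<in> A" "p \<in> V" using smooth_atlas_cover[OF assms(1)] .
  then have "\<exists>c. c \<in> A \<and> p \<in> fst c" by force
  then have "chart_at A p \<in> A \<and> p \<in> fst (chart_at A p)" unfolding chart_at_def by (rule someI_ex)
  then show "(U, \<phi>) \<in> A" "p \<in> U" using assms(2) by auto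
qed

text \<open>The local form of \<open>smooth_map\<close>, meant for open \<open>S\<close>.  It is needed because charts are smooth maps
  only on their domains: the values of \<open>\<phi>\<close> outside \<open>U\<close> are arbitrary.\<close>

definition smooth_map_on ::
  "('a::topological_space, 'e::euclidean_space) chart set \<Rightarrow>
   ('b::topological_space, 'f::euclidean_space) chart set \<Rightarrow> 'a set \<Rightarrow> ('a \<Rightarrow> 'b) \<Rightarrow> bool" where
  "smooth_map_on A B S F \<longleftrightarrow> continuous_on S F \<and>
     (\<forall>(U, \<phi>)\<in>A. \<forall>(V, \<psi>)\<in>B. smooth_on (\<phi> ` (U \<inter> S \<inter> F -` V)) (\<psi> \<circ> F \<circ> inv_into U \<phi>))"

lemma smooth_map_iff_on_UNIV: "smooth_map A B F \<longleftrightarrow> smooth_map_on A B UNIV F"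
  by (simp add: smooth_map_def smooth_map_on_def)

lemma smooth_map_onD:
  assumes "smooth_map_on A B S F"
  shows "continuous_on S F"
    "(U, \<phi>) \<in> A \<Longrightarrow> (V, \<psi>) \<in> B \<Longrightarrow> smooth_on (\<phi> ` (U \<inter> S \<inter> F -` V)) (\<psi> \<circ> F \<circ> inv_into U \<phi>)"
  using assms unfolding smooth_map_on_def by fast+

lemma smooth_map_on_subset:
  assumes F: "smooth_map_on A B T F" and S: "S \<subseteq> T"
  shows "smooth_map_on A B S F"
  unfolding smooth_map_on_def
proof (intro conjI ballI, safe)
  show "continuous_on S F" using smooth_map_onD(1)[OF F] S by (rule continuous_on_subset)
  fix U \<phi> V \<psi> assume U: "(U, \<phi>) \<in> A" "(V, \<psi>) \<in> B"
  show "smooth_on (\<phi> ` (U \<inter> S \<inter> F -` V)) (\<psi> \<circ> F \<circ> inv_into U \<phi>)"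
    using smooth_map_onD(2)[OF F U] by (rule smooth_on_subset) (use S in auto)
qed

lemma smooth_map_on_open_preimage:
  assumes "open S" "smooth_map_on A B S F" "open T"
  shows "open (S \<inter> F -` T)"
  using continuous_open_preimage[OF smooth_map_onD(1)[OF assms(2)] assms(1,3)] .

text \<open>Near a given point the coordinate expression of \<open>G \<circ> F\<close> factors through an intermediate chart; as
  no single chart of \<open>B\<close> need contain the whole image, smoothness is checked locally.\<close>

lemma smooth_map_on_compose:
  assumes A: "smooth_atlas A" and B: "smooth_atlas B" and C: "smooth_atlas C"
    and S: "open S" and T: "open T"
    and F: "smooth_map_on A B S F" and G: "smooth_map_on B C T G"
  shows "smooth_map_on A C (S \<inter> F -` T) (G \<circ> F)"
  unfolding smooth_map_on_def
proof (intro conjI ballI, safe)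
  show cGF: "continuous_on (S \<inter> F -` T) (G \<circ> F)"
    by (intro continuous_on_compose continuous_on_subset[OF smooth_map_onD(1)[OF F]]
        continuous_on_subset[OF smooth_map_onD(1)[OF G]]) auto
  fix U \<phi> W \<eta> assume U: "(U, \<phi>) \<in> A" and W: "(W, \<eta>) \<in> C"
  let ?N = "U \<inter> (S \<inter> F -` T) \<inter> (G \<circ> F) -` W"
  have oST: "open (S \<inter> F -` T)" using smooth_map_on_open_preimage[OF S F T] .
  show "smooth_on (\<phi> ` ?N) (\<eta> \<circ> (G \<circ> F) \<circ> inv_into U \<phi>)"
  proof (rule smooth_on_local)
    fix x assume "x \<in> \<phi> ` ?N"
    then obtain p where p: "p \<in> ?N" "x = \<phi> p" by blast
    obtain V \<psi> where V: "(V, \<psi>) \<in> B" "F p \<in> V" using smooth_atlas_cover[OF B] .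
    let ?M = "U \<inter> ((S \<inter> F -` T) \<inter> (G \<circ> F) -` W \<inter> (S \<inter> F -` V))"
    have oM: "open (\<phi> ` ?M)"
      by (intro chart_image_open[OF A U] open_Int smooth_map_on_open_preimage[OF S F] smooth_atlasD(1)[OF B V(1)]
          continuous_open_preimage[OF cGF oST] smooth_atlasD(1)[OF C W])
    have "smooth_on (\<phi> ` ?M) (\<psi> \<circ> F \<circ> inv_into U \<phi>)"
      using smooth_map_onD(2)[OF F U V(1)] by (rule smooth_on_subset) auto
    moreover have "smooth_on (\<psi> ` (V \<inter> T \<inter> G -` W)) (\<eta> \<circ> G \<circ> inv_into V \<psi>)"
      using smooth_map_onD(2)[OF G V(1) W] .
    moreover have "(\<psi> \<circ> F \<circ> inv_into U \<phi>) ` \<phi> ` ?M \<subseteq> \<psi> ` (V \<inter> T \<inter> G -` W)"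
      using chart_inverse[OF A U] by (auto intro!: imageI)
    ultimately have "smooth_on (\<phi> ` ?M) (\<lambda>x. (\<eta> \<circ> G \<circ> inv_into V \<psi>) ((\<psi> \<circ> F \<circ> inv_into U \<phi>) x))"
      by (rule smooth_on_compose[OF oM])
    then have "smooth_on (\<phi> ` ?M) (\<eta> \<circ> (G \<circ> F) \<circ> inv_into U \<phi>)"
      by (subst smooth_on_cong[OF oM, where g = "(\<lambda>x. (\<eta> \<circ> G \<circ> inv_into V \<psi>) ((\<psi> \<circ> F \<circ> inv_into U \<phi>) x))"])
        (auto simp: chart_inverse[OF A U] chart_inverse[OF B V(1)])
    then have "smooth_on (\<phi> ` ?N \<inter> \<phi> ` ?M) (\<eta> \<circ> (G \<circ> F) \<circ> inv_into U \<phi>)"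
      by (rule smooth_on_subset) auto
    moreover have "x \<in> \<phi> ` ?M" using p V by auto
    ultimately show "\<exists>T. open T \<and> x \<in> T \<and> smooth_on (\<phi> ` ?N \<inter> T) (\<eta> \<circ> (G \<circ> F) \<circ> inv_into U \<phi>)"
      using oM by blast
  qed
qed

lemma smooth_map_on_compose_UNIV:
  assumes "smooth_atlas A" "smooth_atlas B" "smooth_atlas C" "open S"
    and "smooth_map_on A B S F" "smooth_map_on B C UNIV G"
  shows "smooth_map_on A C S (G \<circ> F)"
  using smooth_map_on_compose[OF assms(1-4) open_UNIV assms(5,6)] by simp

lemma smooth_map_on_id: "smooth_atlas A \<Longrightarrow> smooth_map_on A A S (\<lambda>x. x)"
  unfolding smooth_map_on_def
  by (auto simp: comp_def intro!: smooth_on_subset[OF smooth_atlas_transition[unfolded comp_def]])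

lemma smooth_map_on_const: "smooth_map_on A B S (\<lambda>x. c)"
  unfolding smooth_map_on_def by (auto simp: comp_def smooth_on_const)

lemma inv_into_ident [simp]: "inv_into UNIV (\<lambda>x. x) = (\<lambda>x. x)"
  by (rule ext) (metis f_inv_into_f range_eqI)

lemma smooth_atlas_std: "smooth_atlas (std_atlas :: ('e::euclidean_space, 'e) chart set)"
  unfolding smooth_atlas_def std_atlas_def
  by (auto simp: homeomorphism_def comp_def smooth_on_ident)

lemma chart_at_std [simp]:
  fixes p :: "'e::euclidean_space" shows "chart_at std_atlas p = (UNIV, \<lambda>x. x)"
proof -
  obtain U \<phi> where c: "chart_at std_atlas p = (U, \<phi>)" by fastforce
  show ?thesis using chart_at_mem(1)[OF smooth_atlas_std c] c by (simp add: std_atlas_def)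
qed

lemma smooth_map_on_std_std: "smooth_map_on std_atlas std_atlas S f \<longleftrightarrow> smooth_on S f"
  unfolding smooth_map_on_def std_atlas_def by (auto simp: comp_def smooth_on_continuous)

lemma smooth_map_on_stdD:
  assumes "smooth_map_on A std_atlas S f" "(U, \<phi>) \<in> A"
  shows "smooth_on (\<phi> ` (U \<inter> S)) (\<lambda>u. f (inv_into U \<phi> u))"
  using smooth_map_onD(2)[OF assms, of UNIV "\<lambda>x. x"] by (simp add: std_atlas_def comp_def)

text \<open>For functions into a vector space the coordinate expressions alone decide: they already force
  continuity on \<open>S\<close>.\<close>

lemma smooth_map_on_stdI:
  fixes A :: "('a::{t2_space, second_countable_topology}, 'e::euclidean_space) chart set"
    and f :: "'a \<Rightarrow> 'b::euclidean_space"
  assumes A: "smooth_atlas A" and S: "open S"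
    and f: "\<And>U \<phi>. (U, \<phi>) \<in> A \<Longrightarrow> smooth_on (\<phi> ` (U \<inter> S)) (\<lambda>u. f (inv_into U \<phi> u))"
  shows "smooth_map_on A std_atlas S f"
proof -
  have "continuous (at p within S) f" if p: "p \<in> S" for p
  proof -
    obtain U \<phi> where U: "(U, \<phi>) \<in> A" "p \<in> U" using smooth_atlas_cover[OF A] .
    have "continuous_on (U \<inter> S) ((\<lambda>u. f (inv_into U \<phi> u)) \<circ> \<phi>)"
      by (intro continuous_on_compose smooth_on_continuous[OF f[OF U(1)]]
          continuous_on_subset[OF smooth_atlasD(5)[OF A U(1)]]) auto
    then have "continuous_on (U \<inter> S) f"
      by (rule continuous_on_eq) (simp add: chart_inverse[OF A U(1)])
    moreover have "open (U \<inter> S)" using smooth_atlasD(1)[OF A U(1)] S by blast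
    ultimately have "isCont f p" using U p continuous_on_eq_continuous_at by blast
    then show ?thesis by (simp add: continuous_at_imp_continuous_at_within)
  qed
  then have "continuous_on S f" by (simp add: continuous_on_eq_continuous_within)
  then show ?thesis unfolding smooth_map_on_def std_atlas_def using f by (auto simp: comp_def)
qed

lemma smooth_chart: "smooth_atlas A \<Longrightarrow> (U, \<phi>) \<in> A \<Longrightarrow> smooth_map_on A std_atlas U \<phi>"
  using smooth_atlasD(1) smooth_atlas_transition
  by (intro smooth_map_on_stdI) (auto simp: comp_def Int_commute)

section \<open>Product manifolds\<close>

lemma inv_into_map_prod:
  assumes "inj_on \<phi> U" "inj_on \<psi> V" "a \<in> \<phi> ` U" "b \<in> \<psi> ` V"
  shows "inv_into (U \<times> V) (map_prod \<phi> \<psi>) (a, b) = (inv_into U \<phi> a, inv_into V \<psi> b)"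
proof (rule inv_into_f_eq)
  show "inj_on (map_prod \<phi> \<psi>) (U \<times> V)" using assms(1,2) by (rule map_prod_inj_on)
qed (use assms in \<open>auto simp: inv_into_into f_inv_into_f\<close>)

text \<open>Smoothness of the group multiplication refers to the product atlas.  Once this is known to be an
  atlas, maps such as \<open>(p, q) \<mapsto> p q p\<^sup>-\<^sup>1\<close> are smooth by composition and pairing.\<close>

lemma smooth_atlas_prod:
  assumes A: "smooth_atlas A" and B: "smooth_atlas B"
  shows "smooth_atlas (prod_atlas A B)"
proof -
  have 1: "open (U \<times> V) \<and> open (map_prod \<phi> \<psi> ` (U \<times> V)) \<and>
      homeomorphism (U \<times> V) (map_prod \<phi> \<psi> ` (U \<times> V)) (map_prod \<phi> \<psi>) (inv_into (U \<times> V) (map_prod \<phi> \<psi>))"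
    if U: "(U, \<phi>) \<in> A" and V: "(V, \<psi>) \<in> B" for U \<phi> V \<psi>
  proof -
    have img: "map_prod \<phi> \<psi> ` (U \<times> V) = \<phi> ` U \<times> \<psi> ` V" by force
    have inj: "inj_on (map_prod \<phi> \<psi>) (U \<times> V)"
      using smooth_atlasD(4)[OF A U] smooth_atlasD(4)[OF B V] by (rule map_prod_inj_on)
    have "continuous_on (U \<times> V) (map_prod \<phi> \<psi>)"
      unfolding map_prod_def case_prod_beta
      using smooth_atlasD(5)[OF A U] smooth_atlasD(5)[OF B V]
      by (intro continuous_on_Pair continuous_on_compose2[OF _ continuous_on_fst]
          continuous_on_compose2[OF _ continuous_on_snd]) (auto intro: continuous_on_id)
    moreover have "continuous_on (\<phi> ` U \<times> \<psi> ` V) (\<lambda>z. (inv_into U \<phi> (fst z), inv_into V \<psi> (snd z)))"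
      using smooth_atlasD(6)[OF A U] smooth_atlasD(6)[OF B V]
      by (intro continuous_on_Pair continuous_on_compose2[OF _ continuous_on_fst]
          continuous_on_compose2[OF _ continuous_on_snd]) (auto intro: continuous_on_id)
    then have "continuous_on (\<phi> ` U \<times> \<psi> ` V) (inv_into (U \<times> V) (map_prod \<phi> \<psi>))"
      by (rule continuous_on_eq)
        (auto simp: inv_into_map_prod[OF smooth_atlasD(4)[OF A U] smooth_atlasD(4)[OF B V]])
    moreover have "inv_into (U \<times> V) (map_prod \<phi> \<psi>) ` (map_prod \<phi> \<psi> ` (U \<times> V)) = U \<times> V"
      using inj by (simp add: inv_into_image_cancel)
    ultimately show ?thesis
      using smooth_atlasD(1,2)[OF A U] smooth_atlasD(1,2)[OF B V] inj
      by (auto simp: homeomorphism_def img open_Times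
          inv_into_map_prod[OF smooth_atlasD(4)[OF A U] smooth_atlasD(4)[OF B V]]
          chart_inverse[OF A U] chart_inverse[OF B V])
  qed
  have 2: "(\<Union>(U, \<phi>)\<in>prod_atlas A B. U) = UNIV"
  proof -
    have "(p, q) \<in> (\<Union>(U, \<phi>)\<in>prod_atlas A B. U)" for p q
    proof -
      obtain U \<phi> V \<psi> where "(U, \<phi>) \<in> A" "(V, \<psi>) \<in> B" "p \<in> U" "q \<in> V"
        using smooth_atlas_cover[OF A, of p] smooth_atlas_cover[OF B, of q] by metis
      then have "(U \<times> V, map_prod \<phi> \<psi>) \<in> prod_atlas A B" "(p, q) \<in> U \<times> V"
        unfolding prod_atlas_def by blast+
      then show ?thesis by (intro UN_I[where a = "(U \<times> V, map_prod \<phi> \<psi>)"]) auto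
    qed
    then show ?thesis by auto
  qed
  have 3: "smooth_on (map_prod \<phi> \<psi> ` (U \<times> V \<inter> U' \<times> V')) (map_prod \<phi>' \<psi>' \<circ> inv_into (U \<times> V) (map_prod \<phi> \<psi>))"
    if U: "(U, \<phi>) \<in> A" and V: "(V, \<psi>) \<in> B" and U': "(U', \<phi>') \<in> A" and V': "(V', \<psi>') \<in> B" for U \<phi> V \<psi> U' \<phi>' V' \<psi>'
  proof -
    have img: "map_prod \<phi> \<psi> ` (U \<times> V \<inter> U' \<times> V') = \<phi> ` (U \<inter> U') \<times> \<psi> ` (V \<inter> V')" by force
    have op: "open (\<phi> ` (U \<inter> U') \<times> \<psi> ` (V \<inter> V'))"
      by (intro open_Times chart_image_open[OF A U] chart_image_open[OF B V] smooth_atlasD(1)[OF A U'] smooth_atlasD(1)[OF B V'])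
    have "smooth_on (\<phi> ` (U \<inter> U') \<times> \<psi> ` (V \<inter> V')) (\<lambda>z. ((\<phi>' \<circ> inv_into U \<phi>) (fst z), (\<psi>' \<circ> inv_into V \<psi>) (snd z)))"
      by (intro smooth_on_Pair[OF op] smooth_on_compose[OF op _ smooth_atlas_transition[OF A U U']]
          smooth_on_compose[OF op _ smooth_atlas_transition[OF B V V']]
          smooth_on_bounded_linear_compose[OF bounded_linear_fst op smooth_on_ident]
          smooth_on_bounded_linear_compose[OF bounded_linear_snd op smooth_on_ident]) auto
    then show ?thesis unfolding img
      by (subst smooth_on_cong[OF op, where g = "(\<lambda>z. ((\<phi>' \<circ> inv_into U \<phi>) (fst z), (\<psi>' \<circ> inv_into V \<psi>) (snd z)))"])
       (auto simp: inv_into_map_prod[OF smooth_atlasD(4)[OF A U] smooth_atlasD(4)[OF B V]])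
  qed
  show ?thesis unfolding smooth_atlas_def
    by (intro conjI 2) (auto simp: prod_atlas_def dest: 1 intro: 3)
qed

lemma smooth_map_on_fst:
  assumes A: "smooth_atlas A" and B: "smooth_atlas B"
  shows "smooth_map_on (prod_atlas A B) A UNIV fst"
  unfolding smooth_map_on_def
proof (intro conjI ballI, safe)
  show "continuous_on UNIV (fst :: 'a \<times> 'c \<Rightarrow> 'a)" by (intro continuous_intros)
  fix N \<nu> U' \<phi>' assume "(N, \<nu>) \<in> prod_atlas A B" and U': "(U', \<phi>') \<in> A"
  then obtain U \<phi> V \<psi> where U: "(U, \<phi>) \<in> A" and V: "(V, \<psi>) \<in> B" and N: "N = U \<times> V" "\<nu> = map_prod \<phi> \<psi>"
    by (auto simp: prod_atlas_def)
  have img: "map_prod \<phi> \<psi> ` (U \<times> V \<inter> UNIV \<inter> fst -` U') = \<phi> ` (U \<inter> U') \<times> \<psi> ` V" by force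
  have op: "open (\<phi> ` (U \<inter> U') \<times> \<psi> ` V)"
    by (intro open_Times chart_image_open[OF A U] smooth_atlasD[OF A U'] smooth_atlasD[OF B V])
  have "smooth_on (\<phi> ` (U \<inter> U') \<times> \<psi> ` V) (\<lambda>z. ((\<phi>' \<circ> inv_into U \<phi>) (fst z)))"
    by (intro smooth_on_compose[OF op _ smooth_atlas_transition[OF A U U']]
        smooth_on_bounded_linear_compose[OF bounded_linear_fst op smooth_on_ident]) auto
  then show "smooth_on (\<nu> ` (N \<inter> UNIV \<inter> fst -` U')) (\<phi>' \<circ> fst \<circ> inv_into N \<nu>)"
    unfolding N img
    by (subst smooth_on_cong[OF op, where g = "(\<lambda>z. ((\<phi>' \<circ> inv_into U \<phi>) (fst z)))"])
      (auto simp: inv_into_map_prod[OF smooth_atlasD(4)[OF A U] smooth_atlasD(4)[OF B V]])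
qed

lemma smooth_map_on_snd:
  assumes A: "smooth_atlas A" and B: "smooth_atlas B"
  shows "smooth_map_on (prod_atlas A B) B UNIV snd"
  unfolding smooth_map_on_def
proof (intro conjI ballI, safe)
  show "continuous_on UNIV (snd :: 'a \<times> 'c \<Rightarrow> 'c)" by (intro continuous_intros)
  fix N \<nu> U' \<phi>' assume "(N, \<nu>) \<in> prod_atlas A B" and U': "(U', \<phi>') \<in> B"
  then obtain U \<phi> V \<psi> where U: "(U, \<phi>) \<in> A" and V: "(V, \<psi>) \<in> B" and N: "N = U \<times> V" "\<nu> = map_prod \<phi> \<psi>"
    by (auto simp: prod_atlas_def)
  have img: "map_prod \<phi> \<psi> ` (U \<times> V \<inter> UNIV \<inter> snd -` U') = \<phi> ` U \<times> \<psi> ` (V \<inter> U')" by force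
  have op: "open (\<phi> ` U \<times> \<psi> ` (V \<inter> U'))"
    by (intro open_Times chart_image_open[OF B V] smooth_atlasD[OF B U'] smooth_atlasD[OF A U])
  have "smooth_on (\<phi> ` U \<times> \<psi> ` (V \<inter> U')) (\<lambda>z. ((\<phi>' \<circ> inv_into V \<psi>) (snd z)))"
    by (intro smooth_on_compose[OF op _ smooth_atlas_transition[OF B V U']]
        smooth_on_bounded_linear_compose[OF bounded_linear_snd op smooth_on_ident]) auto
  then show "smooth_on (\<nu> ` (N \<inter> UNIV \<inter> snd -` U')) (\<phi>' \<circ> snd \<circ> inv_into N \<nu>)"
    unfolding N img
    by (subst smooth_on_cong[OF op, where g = "(\<lambda>z. ((\<phi>' \<circ> inv_into V \<psi>) (snd z)))"])
      (auto simp: inv_into_map_prod[OF smooth_atlasD(4)[OF A U] smooth_atlasD(4)[OF B V]])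
qed

lemma smooth_map_on_Pair:
  assumes A: "smooth_atlas A" and B: "smooth_atlas B" and C: "smooth_atlas C" and S: "open S"
    and f: "smooth_map_on A B S f" and g: "smooth_map_on A C S g"
  shows "smooth_map_on A (prod_atlas B C) S (\<lambda>x. (f x, g x))"
  unfolding smooth_map_on_def
proof (intro conjI ballI, safe)
  show "continuous_on S (\<lambda>x. (f x, g x))" 
    using smooth_map_onD(1)[OF f] smooth_map_onD(1)[OF g] by (rule continuous_on_Pair)
  fix N \<nu> U \<phi> assume U: "(U, \<phi>) \<in> A" and "(N, \<nu>) \<in> prod_atlas B C"
  then obtain V \<psi> W \<eta> where V: "(V, \<psi>) \<in> B" and W: "(W, \<eta>) \<in> C" and N: "N = V \<times> W" "\<nu> = map_prod \<psi> \<eta>"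
    by (auto simp: prod_atlas_def)
  let ?M = "\<phi> ` (U \<inter> S \<inter> (\<lambda>x. (f x, g x)) -` (V \<times> W))"
  have "?M = \<phi> ` (U \<inter> ((S \<inter> f -` V) \<inter> (S \<inter> g -` W)))" by (rule arg_cong[of _ _ "image \<phi>"]) auto
  moreover have "open \<dots>"
    by (intro chart_image_open[OF A U] open_Int smooth_map_on_open_preimage[OF S f] smooth_map_on_open_preimage[OF S g]
         smooth_atlasD(1)[OF B V] smooth_atlasD(1)[OF C W])
  ultimately have op: "open ?M" by simp
  have "smooth_on ?M (\<lambda>x. ((\<psi> \<circ> f \<circ> inv_into U \<phi>) x, (\<eta> \<circ> g \<circ> inv_into U \<phi>) x))"
    by (intro smooth_on_Pair[OF op] smooth_on_subset[OF smooth_map_onD(2)[OF f U V]]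
      smooth_on_subset[OF smooth_map_onD(2)[OF g U W]]) auto
  then show "smooth_on (\<phi> ` (U \<inter> S \<inter> (\<lambda>x. (f x, g x)) -` N)) (\<nu> \<circ> (\<lambda>x. (f x, g x)) \<circ> inv_into U \<phi>)"
    unfolding N by (simp add: comp_def)
qed

section \<open>Functions with values in a Euclidean space\<close>

context
  fixes A :: "('a::{t2_space, second_countable_topology}, 'e::euclidean_space) chart set" and S :: "'a set"
  assumes A: "smooth_atlas A" and S: "open S"
begin

lemma smooth_map_on_std_bounded_linear:
  fixes f :: "'a \<Rightarrow> 'b::euclidean_space" and L :: "'b \<Rightarrow> 'c::euclidean_space"
  assumes "bounded_linear L" "smooth_map_on A std_atlas S f"
  shows "smooth_map_on A std_atlas S (\<lambda>x. L (f x))"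
proof (rule smooth_map_on_stdI[OF A S])
  fix U \<phi> assume U: "(U, \<phi>) \<in> A"
  note op = chart_image_open[OF A U S]
  show "smooth_on (\<phi> ` (U \<inter> S)) (\<lambda>u. L (f (inv_into U \<phi> u)))"
    by (rule smooth_on_bounded_linear_compose[OF assms(1) op smooth_map_on_stdD[OF assms(2) U]])
qed

lemma smooth_map_on_std_bilinear:
  fixes f :: "'a \<Rightarrow> 'b::euclidean_space" and g :: "'a \<Rightarrow> 'c::euclidean_space" and B :: "'b \<Rightarrow> 'c \<Rightarrow> 'd::euclidean_space"
  assumes "bounded_bilinear B" "smooth_map_on A std_atlas S f" "smooth_map_on A std_atlas S g"
  shows "smooth_map_on A std_atlas S (\<lambda>x. B (f x) (g x))"
proof (rule smooth_map_on_stdI[OF A S])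
  fix U \<phi> assume U: "(U, \<phi>) \<in> A"
  note op = chart_image_open[OF A U S]
  show "smooth_on (\<phi> ` (U \<inter> S)) (\<lambda>u. B (f (inv_into U \<phi> u)) (g (inv_into U \<phi> u)))"
    by (rule smooth_on_bilinear[OF assms(1) op smooth_map_on_stdD[OF assms(2) U] smooth_map_on_stdD[OF assms(3) U]])
qed

lemma smooth_map_on_std_add:
  fixes f :: "'a \<Rightarrow> 'b::euclidean_space"
  assumes "smooth_map_on A std_atlas S f" "smooth_map_on A std_atlas S g"
  shows "smooth_map_on A std_atlas S (\<lambda>x. f x + g x)"
proof (rule smooth_map_on_stdI[OF A S])
  fix U \<phi> assume U: "(U, \<phi>) \<in> A"
  note op = chart_image_open[OF A U S]
  show "smooth_on (\<phi> ` (U \<inter> S)) (\<lambda>u. f (inv_into U \<phi> u) + g (inv_into U \<phi> u))"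
    by (rule smooth_on_add[OF op smooth_map_on_stdD[OF assms(1) U] smooth_map_on_stdD[OF assms(2) U]])
qed

lemma smooth_map_on_std_sum:
  fixes f :: "'i \<Rightarrow> 'a \<Rightarrow> 'b::euclidean_space"
  assumes "\<And>i. i \<in> I \<Longrightarrow> smooth_map_on A std_atlas S (f i)"
  shows "smooth_map_on A std_atlas S (\<lambda>x. \<Sum>i\<in>I. f i x)"
proof (rule smooth_map_on_stdI[OF A S])
  fix U \<phi> assume U: "(U, \<phi>) \<in> A"
  note op = chart_image_open[OF A U S]
  show "smooth_on (\<phi> ` (U \<inter> S)) (\<lambda>u. \<Sum>i\<in>I. f i (inv_into U \<phi> u))"
    by (rule smooth_on_sum[OF op smooth_map_on_stdD[OF assms(1) U]])
qed

end

section \<open>Tangent maps\<close>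

lemma tangent_map_has_derivative:
  assumes A: "smooth_atlas A" and B: "smooth_atlas B" and S: "open S" "p \<in> S"
    and F: "smooth_map_on A B S F" and U: "chart_at A p = (U, \<phi>)" and V: "chart_at B (F p) = (V, \<psi>)"
  shows "((\<psi> \<circ> F \<circ> inv_into U \<phi>) has_derivative tangent_map A B F p) (at (\<phi> p))"
  unfolding tangent_map_def U V Let_def split_beta fst_conv snd_conv
  using chart_at_mem[OF A U] chart_at_mem[OF B V] S
  by (intro smooth_on_has_derivative[OF smooth_map_onD(2)[OF F]]) auto

lemma tangent_map_linear:
  assumes "smooth_atlas A" "smooth_atlas B" "open S" "p \<in> S" "smooth_map_on A B S F"
  shows "linear (tangent_map A B F p)"
proof -
  obtain U \<phi> V \<psi> where "chart_at A p = (U, \<phi>)" "chart_at B (F p) = (V, \<psi>)" by fastforce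
  then show ?thesis using tangent_map_has_derivative[OF assms] has_derivative_linear by blast
qed

lemma tangent_map_eqI:
  assumes "chart_at A p = (U, \<phi>)" "chart_at B (F p) = (V, \<psi>)"
    and "((\<psi> \<circ> F \<circ> inv_into U \<phi>) has_derivative D) (at (\<phi> p))"
  shows "tangent_map A B F p = D"
  unfolding tangent_map_def using frechet_derivative_at[OF assms(3)] by (simp add: assms(1,2))

lemma tangent_map_cong:
  assumes A: "smooth_atlas A" and B: "smooth_atlas B" and S: "open S" "p \<in> S"
    and F: "smooth_map_on A B S F" and eq: "\<And>x. x \<in> S \<Longrightarrow> F x = G x"
  shows "tangent_map A B F p = tangent_map A B G p"
proof -
  obtain U \<phi> V \<psi> where U: "chart_at A p = (U, \<phi>)" and V: "chart_at B (F p) = (V, \<psi>)" by fastforce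
  have "((\<psi> \<circ> G \<circ> inv_into U \<phi>) has_derivative tangent_map A B F p) (at (\<phi> p))"
  proof (rule has_derivative_transform_within_open[OF tangent_map_has_derivative[OF A B S F U V]])
    show "open (\<phi> ` (U \<inter> S))" using chart_image_open[OF A chart_at_mem(1)[OF A U] S(1)] .
    show "\<phi> p \<in> \<phi> ` (U \<inter> S)" using chart_at_mem[OF A U] S by auto
  qed (use chart_inverse[OF A chart_at_mem(1)[OF A U]] eq in auto)
  then show ?thesis using tangent_map_eqI[OF U, of B G V \<psi>] V eq[OF S(2)] by simp
qed

text \<open>With the chain rule, tangent maps can be handled without unfolding the arbitrarily chosen charts
  in which they are computed.\<close>

lemma tangent_map_compose:
  assumes A: "smooth_atlas A" and B: "smooth_atlas B" and C: "smooth_atlas C"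
    and S: "open S" "p \<in> S" and T: "open T" "F p \<in> T"
    and F: "smooth_map_on A B S F" and G: "smooth_map_on B C T G"
  shows "tangent_map A C (G \<circ> F) p v = tangent_map B C G (F p) (tangent_map A B F p v)"
proof -
  obtain U \<phi> V \<psi> W \<eta> where U: "chart_at A p = (U, \<phi>)" and V: "chart_at B (F p) = (V, \<psi>)"
    and W: "chart_at C (G (F p)) = (W, \<eta>)" by (metis surj_pair)
  note U' = chart_at_mem[OF A U] and V' = chart_at_mem[OF B V]
  have "((\<psi> \<circ> F \<circ> inv_into U \<phi>) has_derivative tangent_map A B F p) (at (\<phi> p))"
    using tangent_map_has_derivative[OF A B S F U V] .
  moreover have "((\<eta> \<circ> G \<circ> inv_into V \<psi>) has_derivative tangent_map B C G (F p)) (at ((\<psi> \<circ> F \<circ> inv_into U \<phi>) (\<phi> p)))"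
    using tangent_map_has_derivative[OF B C T G V W] U' by (simp add: chart_inverse[OF A])
  ultimately have "((\<eta> \<circ> G \<circ> inv_into V \<psi>) \<circ> (\<psi> \<circ> F \<circ> inv_into U \<phi>) has_derivative tangent_map B C G (F p) \<circ> tangent_map A B F p) (at (\<phi> p))"
    by (rule diff_chain_at)
  then have "((\<eta> \<circ> (G \<circ> F) \<circ> inv_into U \<phi>) has_derivative tangent_map B C G (F p) \<circ> tangent_map A B F p) (at (\<phi> p))"
  proof (rule has_derivative_transform_within_open)
    show "open (\<phi> ` (U \<inter> (S \<inter> F -` V)))"
      by (intro chart_image_open[OF A U'(1)] smooth_map_on_open_preimage[OF S(1) F] smooth_atlasD(1)[OF B V'(1)])
    show "\<phi> p \<in> \<phi> ` (U \<inter> (S \<inter> F -` V))" using U' V' S by auto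
  qed (auto simp: chart_inverse[OF A U'(1)] chart_inverse[OF B V'(1)])
  then show ?thesis using tangent_map_eqI[OF U, of C "G \<circ> F" W \<eta>] W by simp
qed

lemma tangent_map_id:
  assumes A: "smooth_atlas A" shows "tangent_map A A (\<lambda>x. x) p = (\<lambda>v. v)"
proof -
  obtain U \<phi> where U: "chart_at A p = (U, \<phi>)" by fastforce
  note U' = chart_at_mem[OF A U]
  have "((\<phi> \<circ> (\<lambda>x. x) \<circ> inv_into U \<phi>) has_derivative (\<lambda>v. v)) (at (\<phi> p))"
    by (rule has_derivative_transform_within_open[OF has_derivative_ident smooth_atlasD(2)[OF A U'(1)]])
      (use U' in \<open>auto simp: chart_inverse[OF A U'(1)]\<close>)
  then show ?thesis using tangent_map_eqI[OF U, of A "\<lambda>x. x" U \<phi>] U by simp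
qed

lemma dir_deriv_chart_at:
  assumes A: "smooth_atlas A" and U: "chart_at A p = (U, \<phi>)" shows "dir_deriv A \<phi> p = (\<lambda>v. v)"
proof -
  note U' = chart_at_mem[OF A U]
  have "(((\<lambda>x. x) \<circ> \<phi> \<circ> inv_into U \<phi>) has_derivative (\<lambda>v. v)) (at (\<phi> p))"
    by (rule has_derivative_transform_within_open[OF has_derivative_ident smooth_atlasD(2)[OF A U'(1)]])
      (use U' in \<open>auto simp: chart_inverse[OF A U'(1)]\<close>)
  then show ?thesis by (rule tangent_map_eqI[OF U chart_at_std])
qed

lemma tangent_map_std: "tangent_map std_atlas std_atlas f x = fderiv f x"
  unfolding tangent_map_def by (simp add: comp_def)

text \<open>A directional derivative can be computed in any chart around the point, once the tangent vector is
  replaced by its components there.\<close>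

lemma dir_deriv_in_chart:
  assumes A: "smooth_atlas A" and U: "(U, \<phi>) \<in> A" "p \<in> U" and S: "open S" "p \<in> S"
    and f: "smooth_map_on A std_atlas S f"
  shows "dir_deriv A f p v = fderiv (\<lambda>u. f (inv_into U \<phi> u)) (\<phi> p) (dir_deriv A \<phi> p v)"
proof -
  let ?g = "\<lambda>u. f (inv_into U \<phi> u)" and ?N = "\<phi> ` (U \<inter> S)"
  have oN: "open ?N" using chart_image_open[OF A U(1) S(1)] .
  have oU: "open U" using smooth_atlasD(1)[OF A U(1)] .
  have eq: "f x = (?g \<circ> \<phi>) x" if "x \<in> S \<inter> U" for x using that by (simp add: chart_inverse[OF A U(1)])
  have "dir_deriv A f p = dir_deriv A (?g \<circ> \<phi>) p"
    using tangent_map_cong[OF A smooth_atlas_std _ _ smooth_map_on_subset[OF f], of "S \<inter> U" p "?g \<circ> \<phi>"] eq S U oU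
    by auto
  moreover have "tangent_map A std_atlas (?g \<circ> \<phi>) p v = tangent_map std_atlas std_atlas ?g (\<phi> p) (dir_deriv A \<phi> p v)"
    by (rule tangent_map_compose[OF A smooth_atlas_std smooth_atlas_std oU U(2) oN _ smooth_chart[OF A U(1)]])
      (use U S smooth_map_on_stdD[OF f U(1)] in \<open>auto simp: smooth_map_on_std_std\<close>)
  ultimately show ?thesis by (simp add: tangent_map_std)
qed

lemma dir_deriv_has_derivative:
  assumes "smooth_atlas A" "open S" "p \<in> S" "smooth_map_on A std_atlas S f" "chart_at A p = (U, \<phi>)"
  shows "((\<lambda>u. f (inv_into U \<phi> u)) has_derivative dir_deriv A f p) (at (\<phi> p))"
  using tangent_map_has_derivative[OF assms(1) smooth_atlas_std assms(2-5) chart_at_std] by (simp add: comp_def)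

lemma dir_deriv_eqI:
  assumes "chart_at A p = (U, \<phi>)" "((\<lambda>u. f (inv_into U \<phi> u)) has_derivative D) (at (\<phi> p))"
  shows "dir_deriv A f p = D"
  using tangent_map_eqI[OF assms(1) chart_at_std] assms(2) by (simp add: comp_def)

lemma smooth_vf_iff:
  "smooth_vf A X \<longleftrightarrow> (\<forall>(U, \<phi>)\<in>A. smooth_on (\<phi> ` U) (\<lambda>u. dir_deriv A \<phi> (inv_into U \<phi> u) (X (inv_into U \<phi> u))))"
  unfolding smooth_vf_def vf_in_chart_def Let_def split_conv ..

lemma smooth_vfD:
  assumes "smooth_vf A X" "(U, \<phi>) \<in> A"
  shows "smooth_on (\<phi> ` U) (\<lambda>u. dir_deriv A \<phi> (inv_into U \<phi> u) (X (inv_into U \<phi> u)))"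
  using assms unfolding smooth_vf_iff by fast

lemma smooth_dir_deriv:
  fixes f :: "'a::{t2_space, second_countable_topology} \<Rightarrow> 'b::euclidean_space"
  assumes A: "smooth_atlas A" and X: "smooth_vf A X" and S: "open S" and f: "smooth_map_on A std_atlas S f"
  shows "smooth_map_on A std_atlas S (\<lambda>q. dir_deriv A f q (X q))"
proof (rule smooth_map_on_stdI[OF A S])
  fix U \<phi> assume U: "(U, \<phi>) \<in> A"
  have op: "open (\<phi> ` (U \<inter> S))" using chart_image_open[OF A U S] .
  have "smooth_on (\<phi> ` (U \<inter> S)) (\<lambda>u. fderiv (\<lambda>u. f (inv_into U \<phi> u)) u (dir_deriv A \<phi> (inv_into U \<phi> u) (X (inv_into U \<phi> u))))"
    by (intro smooth_on_derivative_along[OF op smooth_map_on_stdD[OF f U]] smooth_on_ident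
        smooth_on_subset[OF smooth_vfD[OF X U]]) auto
  then show "smooth_on (\<phi> ` (U \<inter> S)) (\<lambda>u. dir_deriv A f (inv_into U \<phi> u) (X (inv_into U \<phi> u)))"
    by (subst smooth_on_cong[OF op, where g = "(\<lambda>u. fderiv (\<lambda>u. f (inv_into U \<phi> u)) u (dir_deriv A \<phi> (inv_into U \<phi> u) (X (inv_into U \<phi> u))))"])
      (auto simp: chart_inverse[OF A U] dir_deriv_in_chart[OF A U _ S _ f])
qed

text \<open>In a chart, \<open>X (Y f) = D\<^sup>2f (X, Y) + Df (DY X)\<close>; the second derivative is symmetric and drops out
  of the commutator.  Conversely, taking for \<open>f\<close> a chart shows that the identity determines the
  bracket, and this is how brackets are computed below.\<close>

lemma dir_deriv_lie_bracket:
  fixes f :: "'a::{t2_space, second_countable_topology} \<Rightarrow> 'b::euclidean_space"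
  assumes A: "smooth_atlas A" and X: "smooth_vf A X" and Y: "smooth_vf A Y"
    and S: "open S" "p \<in> S" and f: "smooth_map_on A std_atlas S f"
  shows "dir_deriv A f p (lie_bracket A X Y p) =
     dir_deriv A (\<lambda>q. dir_deriv A f q (Y q)) p (X p) - dir_deriv A (\<lambda>q. dir_deriv A f q (X q)) p (Y p)"
proof -
  obtain U \<phi> where c: "chart_at A p = (U, \<phi>)" by fastforce
  note U = chart_at_mem[OF A c]
  define g where "g = (\<lambda>u. f (inv_into U \<phi> u))"
  define T where "T = \<phi> ` (U \<inter> S)"
  have oT: "open T" and pT: "\<phi> p \<in> T" using chart_image_open[OF A U(1) S(1)] U S by (auto simp: T_def)
  have g: "smooth_on T g" using smooth_map_on_stdD[OF f U(1)] by (simp add: g_def T_def)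
  have df: "dir_deriv A f p v = fderiv g (\<phi> p) v" for v
    using dir_deriv_in_chart[OF A U S f] dir_deriv_chart_at[OF A c] by (simp add: g_def)
  let ?V = "\<lambda>Z u. vf_in_chart A (U, \<phi>) Z u"
  have V: "?V Z u = dir_deriv A \<phi> (inv_into U \<phi> u) (Z (inv_into U \<phi> u))" for Z u
    by (simp add: vf_in_chart_def Let_def)
  have dV: "(?V Z has_derivative fderiv (?V Z) (\<phi> p)) (at (\<phi> p))" if "smooth_vf A Z" for Z
    using that U by (intro smooth_on_has_derivative[of "\<phi> ` U"]) (auto simp: smooth_vf_def)
  have Vp: "?V Z (\<phi> p) = Z p" for Z using U dir_deriv_chart_at[OF A c] by (simp add: V chart_inverse[OF A])
  have 2: "dir_deriv A (\<lambda>q. dir_deriv A f q (Z q)) p h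
      = fderiv (\<lambda>z. fderiv g z (Z p)) (\<phi> p) h
       + fderiv g (\<phi> p) (fderiv (?V Z) (\<phi> p) h)" if Z: "smooth_vf A Z" for Z h
  proof -
    have "((\<lambda>u. fderiv g u (?V Z u)) has_derivative
       (\<lambda>h. fderiv (\<lambda>z. fderiv g z (Z p)) (\<phi> p) h
       + fderiv g (\<phi> p) (fderiv (?V Z) (\<phi> p) h))) (at (\<phi> p))"
      using has_derivative_derivative_along[OF oT g has_derivative_ident pT dV[OF Z]] by (simp add: Vp)
    then have "((\<lambda>u. dir_deriv A f (inv_into U \<phi> u) (Z (inv_into U \<phi> u))) has_derivative
       (\<lambda>h. fderiv (\<lambda>z. fderiv g z (Z p)) (\<phi> p) h
       + fderiv g (\<phi> p) (fderiv (?V Z) (\<phi> p) h))) (at (\<phi> p))"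
      by (rule has_derivative_transform_within_open[OF _ oT pT])
        (auto simp: T_def V g_def chart_inverse[OF A U(1)] dir_deriv_in_chart[OF A U(1) _ S(1) _ f])
    from dir_deriv_eqI[OF c this] show ?thesis by simp
  qed
  have lin: "linear (fderiv g (\<phi> p))" using smooth_on_linear_derivative[OF g pT] .
  show ?thesis
    unfolding 2[OF X] 2[OF Y] df lie_bracket_def c Let_def snd_conv
    using second_derivative_symmetric[OF oT g pT, of "X p" "Y p"] by (simp add: linear_diff[OF lin])
qed

text \<open>\<open>F\<close>-relatedness means \<open>(Y' f) \<circ> F = Y (f \<circ> F)\<close>; applying this twice to the coordinate functions of
  a chart around \<open>F p\<close> transports the commutator of the derivations.\<close>

lemma lie_bracket_related:
  fixes A :: "('a::{t2_space, second_countable_topology}, 'e::euclidean_space) chart set"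
    and B :: "('b::{t2_space, second_countable_topology}, 'f::euclidean_space) chart set"
  assumes A: "smooth_atlas A" and B: "smooth_atlas B" and F: "smooth_map_on A B UNIV F"
    and X: "smooth_vf A X" "smooth_vf B X'" "\<And>q. tangent_map A B F q (X q) = X' (F q)"
    and Y: "smooth_vf A Y" "smooth_vf B Y'" "\<And>q. tangent_map A B F q (Y q) = Y' (F q)"
  shows "tangent_map A B F p (lie_bracket A X Y p) = lie_bracket B X' Y' (F p)"
proof -
  obtain V \<psi> where c: "chart_at B (F p) = (V, \<psi>)" by fastforce
  note V = chart_at_mem[OF B c]
  have oV: "open V" using smooth_atlasD(1)[OF B V(1)] .
  have \<psi>: "smooth_map_on B std_atlas V \<psi>" using smooth_chart[OF B V(1)] .
  let ?S = "F -` V"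
  have oS: "open ?S" using smooth_map_on_open_preimage[OF open_UNIV F oV] by simp
  have pS: "p \<in> ?S" using V by simp
  have comp: "smooth_map_on A std_atlas ?S (f \<circ> F)" if "smooth_map_on B std_atlas V f" for f :: "'b \<Rightarrow> 'f"
    using smooth_map_on_compose[OF A B smooth_atlas_std open_UNIV oV F that] by simp
  have chain: "dir_deriv A (f \<circ> F) q v = dir_deriv B f (F q) (tangent_map A B F q v)"
    if "smooth_map_on B std_atlas V f" "q \<in> ?S" for f :: "'b \<Rightarrow> 'f" and q v
    using tangent_map_compose[OF A B smooth_atlas_std open_UNIV UNIV_I oV _ F that(1)] that(2) by simp
  have 2: "dir_deriv A (\<lambda>q. dir_deriv A (\<psi> \<circ> F) q (Z q)) p v = dir_deriv B (\<lambda>q. dir_deriv B \<psi> q (Z' q)) (F p) (tangent_map A B F p v)"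
    if Z: "smooth_vf A Z" "smooth_vf B Z'" "\<And>q. tangent_map A B F q (Z q) = Z' (F q)" for Z Z' v
  proof -
    have sm: "smooth_map_on B std_atlas V (\<lambda>q. dir_deriv B \<psi> q (Z' q))"
      by (rule smooth_dir_deriv[OF B Z(2) oV \<psi>])
    have "dir_deriv A (\<lambda>q. dir_deriv A (\<psi> \<circ> F) q (Z q)) p = dir_deriv A ((\<lambda>q. dir_deriv B \<psi> q (Z' q)) \<circ> F) p"
      by (rule tangent_map_cong[OF A smooth_atlas_std oS pS smooth_dir_deriv[OF A Z(1) oS comp[OF \<psi>]]])
        (simp add: chain[OF \<psi>] Z(3))
    then show ?thesis using chain[OF sm pS] by simp
  qed
  have "dir_deriv B \<psi> (F p) (tangent_map A B F p (lie_bracket A X Y p)) = dir_deriv B \<psi> (F p) (lie_bracket B X' Y' (F p))"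
    using dir_deriv_lie_bracket[OF A X(1) Y(1) oS pS comp[OF \<psi>]] dir_deriv_lie_bracket[OF B X(2) Y(2) oV V(2) \<psi>]
      2[OF X] 2[OF Y] chain[OF \<psi> pS] X(3) Y(3) by simp
  then show ?thesis using dir_deriv_chart_at[OF B c] by simp
qed

section \<open>Maps of two variables\<close>

text \<open>The coordinate expression of a map of two variables with respect to three charts.  It is meaningful on
  \<open>joint_domain\<close>, the coordinates of those points whose image lies in the third chart.\<close>

definition joint_in_charts :: "('a set \<times> ('a \<Rightarrow> 'e)) \<Rightarrow> ('b set \<times> ('b \<Rightarrow> 'f)) \<Rightarrow> ('c set \<times> ('c \<Rightarrow> 'g)) \<Rightarrow>
    ('a \<Rightarrow> 'b \<Rightarrow> 'c) \<Rightarrow> 'e \<times> 'f \<Rightarrow> 'g" where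
  "joint_in_charts c d e F = (\<lambda>(a, b). snd e (F (inv_into (fst c) (snd c) a) (inv_into (fst d) (snd d) b)))"

definition joint_domain :: "('a set \<times> ('a \<Rightarrow> 'e)) \<Rightarrow> ('b set \<times> ('b \<Rightarrow> 'f)) \<Rightarrow> ('c set \<times> ('c \<Rightarrow> 'g)) \<Rightarrow>
    ('a \<Rightarrow> 'b \<Rightarrow> 'c) \<Rightarrow> ('e \<times> 'f) set" where
  "joint_domain c d e F = {(snd c p, snd d q) | p q. p \<in> fst c \<and> q \<in> fst d \<and> F p q \<in> fst e}"

lemma smooth_map_on_section:
  assumes A: "smooth_atlas A" and B: "smooth_atlas B" and C: "smooth_atlas C"
    and F: "smooth_map_on (prod_atlas A B) C UNIV (\<lambda>(p, q). F p q)"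
  shows "smooth_map_on B C UNIV (F p)"
  using smooth_map_on_compose_UNIV[OF B smooth_atlas_prod[OF A B] C open_UNIV
      smooth_map_on_Pair[OF B A B open_UNIV smooth_map_on_const smooth_map_on_id[OF B]] F, of p]
  by (simp add: comp_def)

context
  fixes A :: "('a::{t2_space, second_countable_topology}, 'e::euclidean_space) chart set"
    and B :: "('b::{t2_space, second_countable_topology}, 'f::euclidean_space) chart set"
    and C :: "('c::{t2_space, second_countable_topology}, 'g::euclidean_space) chart set"
    and F U \<phi> V \<psi> W \<eta>
  assumes A: "smooth_atlas A" and B: "smooth_atlas B" and C: "smooth_atlas C"
    and F: "smooth_map_on (prod_atlas A B) C UNIV (\<lambda>(p, q). F p q)"
    and U: "(U, \<phi>) \<in> A" and V: "(V, \<psi>) \<in> B" and W: "(W, \<eta>) \<in> C"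
begin

lemma joint_domain_eq: "joint_domain (U, \<phi>) (V, \<psi>) (W, \<eta>) F = map_prod \<phi> \<psi> ` (U \<times> V \<inter> (\<lambda>(p, q). F p q) -` W)"
  unfolding joint_domain_def by force

lemma open_joint_domain: "open (joint_domain (U, \<phi>) (V, \<psi>) (W, \<eta>) F)"
  unfolding joint_domain_eq
  using smooth_map_on_open_preimage[OF open_UNIV F smooth_atlasD(1)[OF C W]]
  by (intro chart_image_open[OF smooth_atlas_prod[OF A B]]) (use U V in \<open>auto simp: prod_atlas_def\<close>)

lemma smooth_joint_in_charts:
  "smooth_on (joint_domain (U, \<phi>) (V, \<psi>) (W, \<eta>) F) (joint_in_charts (U, \<phi>) (V, \<psi>) (W, \<eta>) F)"
proof -
  have "(U \<times> V, map_prod \<phi> \<psi>) \<in> prod_atlas A B" using U V by (auto simp: prod_atlas_def)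
  from smooth_map_onD(2)[OF F this W]
  have "smooth_on (joint_domain (U, \<phi>) (V, \<psi>) (W, \<eta>) F) (\<eta> \<circ> (\<lambda>(p, q). F p q) \<circ> inv_into (U \<times> V) (map_prod \<phi> \<psi>))"
    unfolding joint_domain_eq by simp
  then show ?thesis
    by (subst smooth_on_cong[OF open_joint_domain, where g = "\<eta> \<circ> (\<lambda>(p, q). F p q) \<circ> inv_into (U \<times> V) (map_prod \<phi> \<psi>)"])
     (auto simp: joint_domain_def joint_in_charts_def inv_into_map_prod[OF smooth_atlasD(4)[OF A U] smooth_atlasD(4)[OF B V]]
       chart_inverse[OF A U] chart_inverse[OF B V])
qed

text \<open>The tangent map of \<open>F p\<close> at \<open>q\<close> is the partial derivative, in the second variable, of a function
  that is smooth in both; so it varies smoothly with \<open>p\<close> and \<open>q\<close>.  The three charts are arbitrary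
  here, since the chart chosen at a point of a product need not be the product of the charts
  chosen at its components.\<close>

lemma tangent_map_section:
  assumes p: "p \<in> U" and q: "q \<in> V" and pq: "F p q \<in> W"
  shows "dir_deriv C \<eta> (F p q) (tangent_map B C (F p) q w)
     = fderiv (joint_in_charts (U, \<phi>) (V, \<psi>) (W, \<eta>) F) (\<phi> p, \<psi> q) (0, dir_deriv B \<psi> q w)"
proof -
  let ?J = "joint_in_charts (U, \<phi>) (V, \<psi>) (W, \<eta>) F"
  have oW: "open W" using smooth_atlasD(1)[OF C W] .
  have \<eta>: "smooth_map_on C std_atlas W \<eta>" using smooth_chart[OF C W] .
  note smooth_section = smooth_map_on_section[OF A B C F]
  have oS: "open (F p -` W)" using smooth_map_on_open_preimage[OF open_UNIV smooth_section oW] by simp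
  have "dir_deriv C \<eta> (F p q) (tangent_map B C (F p) q w) = dir_deriv B (\<eta> \<circ> F p) q w"
    using tangent_map_compose[OF B C smooth_atlas_std open_UNIV UNIV_I oW _ smooth_section \<eta>] pq by simp
  also have "\<dots> = fderiv (\<lambda>u. (\<eta> \<circ> F p) (inv_into V \<psi> u)) (\<psi> q) (dir_deriv B \<psi> q w)"
    using pq smooth_map_on_compose[OF B C smooth_atlas_std open_UNIV oW smooth_section \<eta>]
    by (intro dir_deriv_in_chart[OF B V q oS]) auto
  also have "(\<lambda>u. (\<eta> \<circ> F p) (inv_into V \<psi> u)) = (\<lambda>u. ?J (\<phi> p, u))"
    using chart_inverse[OF A U p] by (simp add: joint_in_charts_def)
  also have "fderiv (\<lambda>u. ?J (\<phi> p, u)) (\<psi> q) (dir_deriv B \<psi> q w)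
     = fderiv ?J (\<phi> p, \<psi> q) (0, dir_deriv B \<psi> q w)"
  proof -
    have "(\<phi> p, \<psi> q) \<in> joint_domain (U, \<phi>) (V, \<psi>) (W, \<eta>) F" using p q pq by (auto simp: joint_domain_def)
    then have "((\<lambda>u. ?J (\<phi> p, u)) has_derivative (\<lambda>h. fderiv ?J (\<phi> p, \<psi> q) (0, h))) (at (\<psi> q))"
      by (intro has_derivative_compose[OF _ smooth_on_has_derivative[OF smooth_joint_in_charts]]
         has_derivative_Pair has_derivative_const has_derivative_ident) simp
    then show ?thesis using frechet_derivative_at by metis
  qed
  finally show ?thesis .
qed

end

section \<open>Multilinear forms and polarisation\<close>

lemma multilinear_form_Cons:
  "multilinear_form (Suc k) T \<Longrightarrow> multilinear_form k (\<lambda>vs. T (v # vs))"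
  unfolding multilinear_form_def
proof (intro allI impI)
  fix xs ys :: "'a list"
  assume T: "\<forall>xs ys. length xs + length ys + 1 = Suc k \<longrightarrow> linear (\<lambda>v. T (xs @ v # ys))"
    and l: "length xs + length ys + 1 = k"
  show "linear (\<lambda>va. T (v # xs @ va # ys))"
    using T[rule_format, of "v # xs" ys] l by simp
qed

lemma multilinear_form_linear:
  assumes "multilinear_form (Suc k) T" "length vs = k"
  shows "linear (\<lambda>v. T (v # vs))"
  using assms(1)[unfolded multilinear_form_def, rule_format, of "[]" vs] assms(2) by simp

lemma symmetric_form_Cons:
  "symmetric_form (Suc k) T \<Longrightarrow> symmetric_form k (\<lambda>vs. T (v # vs))"
  unfolding symmetric_form_def by auto

lemma multilinear_expand_Basis:
  fixes T :: "'e::euclidean_space list \<Rightarrow> real"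
  assumes "multilinear_form (Suc k) T" "length vs = k"
  shows "T (v # vs) = (\<Sum>b\<in>Basis. (v \<bullet> b) * T (b # vs))"
  using linear_expand_Basis[OF multilinear_form_linear[OF assms], of v] by simp

text \<open>The product rule, by induction on the number of arguments: expanding the first argument in a basis
  leaves products of its coordinates with forms of one degree less.\<close>

lemma multilinear_form_has_derivative:
  fixes T :: "'e::euclidean_space list \<Rightarrow> real" and fs :: "('x::real_normed_vector \<Rightarrow> 'e) list"
  assumes "multilinear_form (length fs) T"
    and "\<And>i. i < length fs \<Longrightarrow> (fs ! i has_derivative D i) (at x)"
  shows "((\<lambda>y. T (map (\<lambda>f. f y) fs)) has_derivative
     (\<lambda>h. \<Sum>i<length fs. T ((map (\<lambda>f. f x) fs)[i := D i h]))) (at x)"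
  using assms
proof (induction fs arbitrary: T D)
  case Nil
  then show ?case by simp
next
  case (Cons f fs)
  let ?m = "\<lambda>y. map (\<lambda>f. f y) fs"
  note T = Cons.prems(1)[unfolded length_Cons]
  have f: "(f has_derivative D 0) (at x)" using Cons.prems(2)[of 0] by simp
  have "((\<lambda>y. T (b # ?m y)) has_derivative (\<lambda>h. \<Sum>i<length fs. T (b # (?m x)[i := D (Suc i) h]))) (at x)" for b
    using Cons.prems(2) by (intro Cons.IH multilinear_form_Cons[OF T]) force
  then have "((\<lambda>y. \<Sum>b\<in>Basis. (f y \<bullet> b) * T (b # ?m y)) has_derivative
      (\<lambda>h. \<Sum>b\<in>Basis. (f x \<bullet> b) * (\<Sum>i<length fs. T (b # (?m x)[i := D (Suc i) h])) + (D 0 h \<bullet> b) * T (b # ?m x))) (at x)"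
    by (intro has_derivative_sum has_derivative_mult has_derivative_inner_left f)
  also have "(\<lambda>y. \<Sum>b\<in>Basis. (f y \<bullet> b) * T (b # ?m y)) = (\<lambda>y. T (f y # ?m y))"
    by (rule ext, rule multilinear_expand_Basis[OF T, symmetric]) simp
  also have "(\<lambda>h. \<Sum>b\<in>Basis. (f x \<bullet> b) * (\<Sum>i<length fs. T (b # (?m x)[i := D (Suc i) h])) + (D 0 h \<bullet> b) * T (b # ?m x))
    = (\<lambda>h. (\<Sum>i<length fs. T (f x # (?m x)[i := D (Suc i) h])) + T (D 0 h # ?m x))"
  proof (rule ext)
    fix h
    have "(\<Sum>b\<in>Basis. (f x \<bullet> b) * (\<Sum>i<length fs. T (b # (?m x)[i := D (Suc i) h])))
       = (\<Sum>i<length fs. \<Sum>b\<in>Basis. (f x \<bullet> b) * T (b # (?m x)[i := D (Suc i) h]))"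
      unfolding sum_distrib_left by (rule sum.swap)
    also have "\<dots> = (\<Sum>i<length fs. T (f x # (?m x)[i := D (Suc i) h]))"
      by (rule sum.cong[OF refl], rule multilinear_expand_Basis[OF T, symmetric]) simp
    finally show "(\<Sum>b\<in>Basis. (f x \<bullet> b) * (\<Sum>i<length fs. T (b # (?m x)[i := D (Suc i) h])) + (D 0 h \<bullet> b) * T (b # ?m x))
       = (\<Sum>i<length fs. T (f x # (?m x)[i := D (Suc i) h])) + T (D 0 h # ?m x)"
      using multilinear_expand_Basis[OF T, of "?m x" "D 0 h"] by (simp add: sum.distrib)
  qed
  finally show ?case by (simp add: sum.lessThan_Suc_shift add.commute del: sum.lessThan_Suc)
qed

lemma smooth_map_on_std_multilinear:
  fixes A :: "('a::{t2_space, second_countable_topology}, 'e::euclidean_space) chart set"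
    and T :: "'f::euclidean_space list \<Rightarrow> real"
  assumes A: "smooth_atlas A" and S: "open S" and "multilinear_form (length fs) T"
    and "\<And>f. f \<in> set fs \<Longrightarrow> smooth_map_on A std_atlas S f"
  shows "smooth_map_on A std_atlas S (\<lambda>p. T (map (\<lambda>f. f p) fs))"
  using assms(3,4)
proof (induction fs arbitrary: T)
  case Nil
  then show ?case by (simp add: smooth_map_on_const)
next
  case (Cons f fs)
  note T = Cons.prems(1)[unfolded length_Cons]
  have b: "smooth_map_on A std_atlas S (\<lambda>p. T (b # map (\<lambda>f. f p) fs))" for b
    using Cons.prems(2) by (intro Cons.IH[of "\<lambda>vs. T (b # vs)"] multilinear_form_Cons[OF T]) auto
  have f: "smooth_map_on A std_atlas S (\<lambda>p. f p \<bullet> b)" for b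
    using Cons.prems(2) by (intro smooth_map_on_std_bounded_linear[OF A S bounded_linear_inner_left]) auto
  have "smooth_map_on A std_atlas S (\<lambda>p. \<Sum>b\<in>Basis. (f p \<bullet> b) * T (b # map (\<lambda>f. f p) fs))"
    by (rule smooth_map_on_std_sum[OF A S smooth_map_on_std_bilinear[OF A S bounded_bilinear_mult f b]])
  moreover have "(\<lambda>p. \<Sum>b\<in>Basis. (f p \<bullet> b) * T (b # map (\<lambda>f. f p) fs)) = (\<lambda>p. T (f p # map (\<lambda>f. f p) fs))"
    by (rule ext, rule multilinear_expand_Basis[OF T, symmetric]) simp
  ultimately show ?case by simp
qed

lemma diagonal_has_derivative:
  fixes T :: "'e::euclidean_space list \<Rightarrow> real"
  assumes T: "multilinear_form k T" "symmetric_form k T"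
  shows "((\<lambda>y. T (replicate k y)) has_derivative (\<lambda>h. real k * T (h # replicate (k - 1) y))) (at y)"
proof -
  have "T ((replicate k y)[i := h]) = T (h # replicate (k - 1) y)" if i: "i < k" for i h
  proof -
    have "mset ((replicate k y)[i := h]) = mset (h # replicate (k - 1) y)"
      using i by (cases k) (auto simp: mset_update nth_replicate simp del: replicate_Suc)
    then show ?thesis using T(2) unfolding symmetric_form_def by simp
  qed
  then have eq: "(\<Sum>i<k. T ((replicate k y)[i := h])) = real k * T (h # replicate (k - 1) y)" for h
    by simp
  have "((\<lambda>x. T (map (\<lambda>f. f x) (replicate k (\<lambda>x. x)))) has_derivative
     (\<lambda>h. \<Sum>i<length (replicate k (\<lambda>x::'e. x)). T ((map (\<lambda>f. f y) (replicate k (\<lambda>x. x)))[i := h]))) (at y)"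
    using T(1) by (intro multilinear_form_has_derivative) (auto simp: nth_replicate intro: has_derivative_ident)
  then show ?thesis by (simp add: map_replicate_trivial eq)
qed

text \<open>Differentiating \<open>T(y, \<dots>, y) = 0\<close> in the direction \<open>v\<close> gives \<open>k T(v, y, \<dots>, y) = 0\<close>, so the form
  \<open>T(v, \<dots>)\<close> of one degree less vanishes on the diagonal as well.\<close>

lemma polarization_zero:
  fixes T :: "'e::euclidean_space list \<Rightarrow> real"
  assumes "multilinear_form k T" "symmetric_form k T" "\<And>v. T (replicate k v) = 0" "length vs = k"
  shows "T vs = 0"
  using assms
proof (induction k arbitrary: T vs)
  case 0
  then show ?case by simp
next
  case (Suc k)
  obtain v ws where vs: "vs = v # ws" "length ws = k" using Suc.prems(4) by (cases vs) auto
  have "T (v # replicate k y) = 0" for y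
  proof -
    have "((\<lambda>y. 0) has_derivative (\<lambda>h. real (Suc k) * T (h # replicate k y))) (at y)"
      using diagonal_has_derivative[OF Suc.prems(1,2), of y] Suc.prems(3) by simp
    then have "(\<lambda>h. real (Suc k) * T (h # replicate k y)) = (\<lambda>h. 0)"
      using has_derivative_unique has_derivative_const by blast
    then have "real (Suc k) * T (v # replicate k y) = 0" by meson
    then show ?thesis by simp
  qed
  then show ?case
    using Suc.IH[OF multilinear_form_Cons[OF Suc.prems(1)] symmetric_form_Cons[OF Suc.prems(2)], of v ws] vs by simp
qed

section \<open>Traces with respect to an inner product\<close>

lemma linear_trace_commute:
  fixes f g :: "'e::euclidean_space \<Rightarrow> 'e"
  assumes "linear f" "linear g"
  shows "linear_trace (\<lambda>x. f (g x)) = linear_trace (\<lambda>x. g (f x))"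
proof -
  have 1: "f (g b) \<bullet> b = (\<Sum>c\<in>Basis. (g b \<bullet> c) * (f c \<bullet> b))" if "linear f" for f g :: "'e \<Rightarrow> 'e" and b
    using linear_expand_Basis[OF that, of "g b"] by (simp add: inner_sum_left)
  have "linear_trace (\<lambda>x. f (g x)) = (\<Sum>b\<in>Basis. \<Sum>c\<in>Basis. (g b \<bullet> c) * (f c \<bullet> b))"
    unfolding linear_trace_def using 1[OF assms(1)] by simp
  also have "\<dots> = (\<Sum>c\<in>Basis. \<Sum>b\<in>Basis. (f c \<bullet> b) * (g b \<bullet> c))" by (subst sum.swap) (simp add: mult.commute)
  also have "\<dots> = linear_trace (\<lambda>x. g (f x))"
    unfolding linear_trace_def using 1[OF assms(2)] by simp
  finally show ?thesis .
qed

definition inner_form :: "('e::euclidean_space \<Rightarrow> 'e \<Rightarrow> real) \<Rightarrow> bool" where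
  "inner_form g \<longleftrightarrow> bilinear g \<and> (\<forall>v w. g v w = g w v) \<and> (\<forall>v. v \<noteq> 0 \<longrightarrow> g v v > 0)"

lemma inner_formD:
  assumes "inner_form g"
  shows "bilinear g" "g v w = g w v" "v \<noteq> 0 \<Longrightarrow> g v v > 0" "g v v \<ge> 0" "linear (g v)" "linear (\<lambda>v. g v w)"
proof -
  show *: "bilinear g" "g v w = g w v" "v \<noteq> 0 \<Longrightarrow> g v v > 0" using assms by (auto simp: inner_form_def)
  then show "linear (g v)" "linear (\<lambda>v. g v w)" by (auto simp: bilinear_def)
  show "g v v \<ge> 0" using *(1,3) by (cases "v = 0") (auto simp: bilinear_lzero)
qed

lemma inner_form_nondegenerate:
  assumes "inner_form g" "\<And>v. g w v = g w' v" shows "w = w'"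
proof -
  have "g (w - w') (w - w') = 0" using assms(2) bilinear_lsub[OF inner_formD(1)[OF assms(1)]] by simp
  then show ?thesis using inner_formD(3)[OF assms(1), of "w - w'"] by force
qed

lemma raise_exists:
  assumes g: "inner_form g" shows "\<exists>w. \<forall>v. g w v = u \<bullet> v"
proof -
  note lin = inner_formD(5,6)[OF g]
  let ?f = "\<lambda>w. \<Sum>b\<in>Basis. g w b *\<^sub>R b"
  have f: "?f w \<bullet> v = g w v" for w v
  proof -
    have "g w v = (\<Sum>b\<in>Basis. (v \<bullet> b) *\<^sub>R g w b)" by (rule linear_expand_Basis[OF lin(1)])
    then show ?thesis by (simp add: inner_sum_left inner_commute[of u] inner_commute[of v] mult.commute)
  qed
  have "linear ?f"
    by (intro linearI) (simp_all add: linear_add[OF lin(2)] linear_scale[OF lin(2)] scaleR_add_left sum.distrib scaleR_sum_right)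
  moreover have "inj ?f"
  proof (rule injI)
    fix w w' assume "?f w = ?f w'"
    then have "g w v = g w' v" for v using f[of w v] f[of w' v] by simp
    then show "w = w'" by (rule inner_form_nondegenerate[OF g])
  qed
  ultimately have "surj ?f" by (rule linear_inj_imp_surj)
  then obtain w where "u = ?f w" by (rule surjE)
  then show ?thesis using f[of w] by auto
qed

lemma raise_unique: "inner_form g \<Longrightarrow> (\<And>v. g w v = u \<bullet> v) \<Longrightarrow> raise g u = w"
  unfolding raise_def by (rule the_equality) (auto intro: inner_form_nondegenerate)

lemma raise: "inner_form g \<Longrightarrow> g (raise g u) v = u \<bullet> v"
  using raise_exists[of g u] raise_unique[of g _ u] by blast

lemma inner_form_pullback:
  assumes g: "inner_form g" and L: "linear L" "inj L"
  shows "inner_form (\<lambda>v w. g (L v) (L w))"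
  unfolding inner_form_def bilinear_def
proof (intro conjI allI impI)
  fix v show "linear (\<lambda>w. g (L v) (L w))"
    using linear_compose[OF L(1) inner_formD(5)[OF g]] by (simp add: comp_def)
next
  fix w show "linear (\<lambda>v. g (L v) (L w))"
    using linear_compose[OF L(1) inner_formD(6)[OF g]] by (simp add: comp_def)
next
  fix v w show "g (L v) (L w) = g (L w) (L v)" using inner_formD(2)[OF g] .
next
  fix v :: 'b assume "v \<noteq> 0"
  then have "L v \<noteq> 0" using L by (metis linear_injective_0)
  then show "g (L v) (L v) > 0" using inner_formD(3)[OF g] by blast
qed

text \<open>If \<open>w\<^sub>b\<close> is the raised basis of the pulled-back form, then \<open>raise g c = \<Sum>\<^sub>b (L b \<bullet> c) L w\<^sub>b\<close>: the
  contraction does not depend on the basis.  With \<open>L\<close> the left trivialisation this moves traces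
  at a point of the group to the Lie algebra, and with \<open>L = Ad g\<close> it shows their invariance.\<close>

lemma metric_trace_pullback:
  fixes g S :: "'e::euclidean_space \<Rightarrow> 'e \<Rightarrow> real" and L :: "'e \<Rightarrow> 'e"
  assumes g: "inner_form g" and L: "linear L" "inj L" and S: "bilinear S"
  shows "metric_trace (\<lambda>v w. g (L v) (L w)) (\<lambda>v w. S (L v) (L w)) = metric_trace g S"
proof -
  let ?g = "\<lambda>v w. g (L v) (L w)"
  let ?w = "\<lambda>b. raise ?g b"
  note g' = inner_form_pullback[OF g L]
  have surj: "surj L" using linear_inj_imp_surj[OF L] .
  have S1: "linear (\<lambda>v. S v w)" and S2: "linear (S v)" for v w using S by (auto simp: bilinear_def)
  have e1: "S v w = (\<Sum>c\<in>Basis. (v \<bullet> c) * S c w)" for v w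
    using linear_expand_Basis[OF S1[of w], of v] by simp
  have rc: "raise g c = (\<Sum>b\<in>Basis. (L b \<bullet> c) *\<^sub>R L (?w b))" for c
  proof (rule raise_unique[OF g])
    fix v obtain u where v: "v = L u" using surj by (rule surjE)
    have "g (\<Sum>b\<in>Basis. (L b \<bullet> c) *\<^sub>R L (?w b)) v = (\<Sum>b\<in>Basis. (L b \<bullet> c) * ?g (?w b) u)"
      by (simp add: v linear_sum[OF inner_formD(6)[OF g]] linear_scale[OF inner_formD(6)[OF g]])
    also have "\<dots> = (\<Sum>b\<in>Basis. (L b \<bullet> c) * (b \<bullet> u))" using raise[OF g'] by simp
    also have "\<dots> = (\<Sum>b\<in>Basis. (u \<bullet> b) *\<^sub>R L b) \<bullet> c" by (simp add: inner_sum_left inner_commute[of u] mult.commute)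
    also have "\<dots> = c \<bullet> v" using linear_expand_Basis[OF L(1), of u] v by (simp add: inner_commute)
    finally show "g (\<Sum>b\<in>Basis. (L b \<bullet> c) *\<^sub>R L (?w b)) v = c \<bullet> v" .
  qed
  have "metric_trace ?g (\<lambda>v w. S (L v) (L w)) = (\<Sum>b\<in>Basis. \<Sum>c\<in>Basis. (L b \<bullet> c) * S c (L (?w b)))"
    unfolding metric_trace_def
    by (rule sum.cong[OF refl], rule e1)
  also have "\<dots> = (\<Sum>c\<in>Basis. \<Sum>b\<in>Basis. (L b \<bullet> c) * S c (L (?w b)))" by (rule sum.swap)
  also have "\<dots> = metric_trace g S"
    unfolding metric_trace_def rc by (simp add: linear_sum[OF S2] linear_scale[OF S2])
  finally show ?thesis .
qed

lemma metric_trace_transpose: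
  assumes g: "inner_form g" and S: "bilinear S"
  shows "metric_trace g (\<lambda>v w. S w v) = metric_trace g S"
proof -
  have S1: "linear (\<lambda>v. S v w)" and S2: "linear (S v)" for v w using S by (auto simp: bilinear_def)
  have e1: "S v w = (\<Sum>c\<in>Basis. (v \<bullet> c) * S c w)" for v w
    using linear_expand_Basis[OF S1[of w], of v] by simp
  have e2: "S w v = (\<Sum>c\<in>Basis. (v \<bullet> c) * S w c)" for v w
    using linear_expand_Basis[OF S2[of w], of v] by simp
  have sym: "raise g b \<bullet> c = raise g c \<bullet> b" for b c
    using raise[OF g, of c "raise g b"] raise[OF g, of b "raise g c"] inner_formD(2)[OF g] by (metis inner_commute)
  have "metric_trace g (\<lambda>v w. S w v) = (\<Sum>b\<in>Basis. \<Sum>c\<in>Basis. (raise g b \<bullet> c) * S c b)"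
    unfolding metric_trace_def by (rule sum.cong[OF refl], rule e1)
  also have "\<dots> = (\<Sum>c\<in>Basis. \<Sum>b\<in>Basis. (raise g b \<bullet> c) * S c b)" by (rule sum.swap)
  also have "\<dots> = (\<Sum>c\<in>Basis. S c (raise g c))"
    by (rule sum.cong[OF refl], subst sym, rule e2[symmetric])
  finally show ?thesis by (simp add: metric_trace_def)
qed

lemma metric_trace_scale: "metric_trace g (\<lambda>v w. c * S v w) = c * metric_trace g S"
  by (simp add: metric_trace_def sum_distrib_left)

lemma metric_trace_self: 
  fixes g :: "'e::euclidean_space \<Rightarrow> 'e \<Rightarrow> real"
  assumes "inner_form g" shows "metric_trace g g = real DIM('e)"
proof -
  have "g b (raise g b) = 1" if "b \<in> Basis" for b
    using raise[OF assms, of b b] inner_formD(2)[OF assms] that by simp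
  then show ?thesis by (simp add: metric_trace_def)
qed

lemma metric_trace_endomorphism:
  assumes "inner_form g" shows "metric_trace g (\<lambda>v w. g (f v) w) = linear_trace f"
  unfolding metric_trace_def linear_trace_def
  by (rule sum.cong[OF refl]) (metis raise[OF assms] inner_formD(2)[OF assms] inner_commute)

section \<open>Contractions over several indices\<close>

text \<open>\<open>S\<^sub>a\<^sub>\<dots>\<^sub>b T\<^sup>a\<^sup>\<dots>\<^sup>b\<close>, the common shape of \<open>rho_form\<close> and \<open>norm_sq_form\<close>.  By \<open>contraction_Suc\<close> it is an
  iterated \<open>metric_trace\<close>, so that properties of the trace pass to it by induction.\<close>

definition contraction ::
  "nat \<Rightarrow> ('e::euclidean_space \<Rightarrow> 'e \<Rightarrow> real) \<Rightarrow> ('e list \<Rightarrow> real) \<Rightarrow> ('e list \<Rightarrow> real) \<Rightarrow> real" where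
  "contraction n g S T = (\<Sum>bs | set bs \<subseteq> Basis \<and> length bs = n. S bs * T (map (raise g) bs))"

lemma sum_lists_Suc:
  assumes "finite B"
  shows "(\<Sum>bs | set bs \<subseteq> B \<and> length bs = Suc n. f bs) = (\<Sum>b\<in>B. \<Sum>bs | set bs \<subseteq> B \<and> length bs = n. f (b # bs))"
proof -
  let ?L = "{xs. set xs \<subseteq> B \<and> length xs = n}"
  have "(\<Sum>bs | set bs \<subseteq> B \<and> length bs = Suc n. f bs) = (\<Sum>z\<in>?L \<times> B. f (snd z # fst z))"
    unfolding lists_length_Suc_eq
    by (subst sum.reindex) (auto simp: inj_on_def case_prod_beta)
  also have "\<dots> = (\<Sum>xs\<in>?L. \<Sum>b\<in>B. f (b # xs))" by (simp add: sum.cartesian_product case_prod_beta)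
  also have "\<dots> = (\<Sum>b\<in>B. \<Sum>xs\<in>?L. f (b # xs))" by (rule sum.swap)
  finally show ?thesis .
qed

lemma contraction_0: "contraction 0 g S T = S [] * T []"
proof -
  have "{bs::'a list. set bs \<subseteq> Basis \<and> length bs = 0} = {[]}" by auto
  then show ?thesis by (simp add: contraction_def)
qed

lemma contraction_Suc:
  "contraction (Suc n) g S T = metric_trace g (\<lambda>v w. contraction n g (\<lambda>bs. S (v # bs)) (\<lambda>bs. T (w # bs)))"
  unfolding contraction_def metric_trace_def by (subst sum_lists_Suc) auto

lemma bilinear_contraction:
  assumes "multilinear_form (Suc n) S" "multilinear_form (Suc n) T"
  shows "bilinear (\<lambda>v w. contraction n g (\<lambda>bs. S (v # bs)) (\<lambda>bs. T (w # bs)))"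
proof -
  have S: "linear (\<lambda>v. S (v # bs))" if "length bs = n" for bs using multilinear_form_linear[OF assms(1) that] .
  have T: "linear (\<lambda>v. T (v # bs))" if "length bs = n" for bs using multilinear_form_linear[OF assms(2) that] .
  show ?thesis unfolding bilinear_def contraction_def
    by (auto intro!: linearI sum.cong simp: linear_add[OF S] linear_add[OF T] linear_scale[OF S] linear_scale[OF T]
        sum.distrib[symmetric] sum_distrib_left algebra_simps)
qed

lemma contraction_commute:
  assumes g: "inner_form g" and "multilinear_form n S" "multilinear_form n T"
  shows "contraction n g S T = contraction n g T S"
  using assms(2,3)
proof (induction n arbitrary: S T)
  case 0
  then show ?case by (simp add: contraction_0)
next
  case (Suc n)
  have "contraction (Suc n) g S T = metric_trace g (\<lambda>v w. contraction n g (\<lambda>bs. T (w # bs)) (\<lambda>bs. S (v # bs)))"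
    unfolding contraction_Suc by (subst Suc.IH) (auto intro: multilinear_form_Cons Suc.prems)
  also have "\<dots> = contraction (Suc n) g T S"
    unfolding contraction_Suc by (rule metric_trace_transpose[OF g bilinear_contraction[OF Suc.prems(2,1)]])
  finally show ?case .
qed

lemma contraction_pullback:
  fixes L :: "'e::euclidean_space \<Rightarrow> 'e"
  assumes g: "inner_form g" and L: "linear L" "inj L"
    and "multilinear_form n S" "multilinear_form n T"
  shows "contraction n (\<lambda>v w. g (L v) (L w)) (\<lambda>bs. S (map L bs)) (\<lambda>bs. T (map L bs)) = contraction n g S T"
  using assms(4,5)
proof (induction n arbitrary: S T)
  case 0
  then show ?case by (simp add: contraction_0)
next
  case (Suc n)
  have "contraction n (\<lambda>v w. g (L v) (L w)) (\<lambda>bs. S (map L (v # bs))) (\<lambda>bs. T (map L (w # bs)))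
     = contraction n g (\<lambda>bs. S (L v # bs)) (\<lambda>bs. T (L w # bs))" for v w
    using Suc.IH[OF multilinear_form_Cons[OF Suc.prems(1)] multilinear_form_Cons[OF Suc.prems(2)]] by simp
  then show ?case
    unfolding contraction_Suc
    using metric_trace_pullback[OF g L bilinear_contraction[OF Suc.prems]] by simp
qed

lemma rho_form_contraction:
  "rho_form k g T v w = contraction (k - 1) g (\<lambda>bs. T (v # bs)) (\<lambda>bs. T (w # bs))"
  by (simp add: rho_form_def contraction_def)

lemma norm_sq_form_trace: "norm_sq_form (Suc k) g T = metric_trace g (rho_form (Suc k) g T)"
  unfolding rho_form_contraction diff_Suc_1 contraction_Suc[symmetric]
  by (simp add: norm_sq_form_def contraction_def)

lemma rho_form_bilinear: "multilinear_form (Suc k) T \<Longrightarrow> bilinear (rho_form (Suc k) g T)"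
  unfolding rho_form_contraction[abs_def] diff_Suc_1 by (rule bilinear_contraction)

lemma rho_form_commute: 
  "inner_form g \<Longrightarrow> multilinear_form (Suc k) T \<Longrightarrow> rho_form (Suc k) g T v w = rho_form (Suc k) g T w v"
  unfolding rho_form_contraction diff_Suc_1 by (intro contraction_commute multilinear_form_Cons)

lemma rho_form_pullback:
  fixes L :: "'e::euclidean_space \<Rightarrow> 'e"
  assumes "inner_form g" "linear L" "inj L" "multilinear_form (Suc k) T"
  shows "rho_form (Suc k) (\<lambda>v w. g (L v) (L w)) (\<lambda>bs. T (map L bs)) v w = rho_form (Suc k) g T (L v) (L w)"
  unfolding rho_form_contraction diff_Suc_1
  using contraction_pullback[OF assms(1-3) multilinear_form_Cons[OF assms(4), of "L v"] multilinear_form_Cons[OF assms(4), of "L w"]]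
  by simp

section \<open>Orthonormal frames\<close>

text \<open>Gram-Schmidt, run over subsets \<open>D\<close> of the standard basis: the vectors chosen for a proper subset
  span a proper subspace, and a vector outside it can be orthogonalised and normalised.\<close>

lemma orthonormal_frame:
  fixes q :: "'e::euclidean_space \<Rightarrow> 'e \<Rightarrow> real"
  assumes q: "inner_form q"
  shows "\<exists>M :: 'e \<Rightarrow> 'e. linear M \<and> inj M \<and> (\<forall>v w. q (M v) (M w) = v \<bullet> w)"
proof -
  note l1 = inner_formD(6)[OF q] and l2 = inner_formD(5)[OF q]
  have "\<exists>f. \<forall>b\<in>D. \<forall>c\<in>D. q (f b) (f c) = (if b = c then 1 else 0)" if "D \<subseteq> (Basis :: 'e set)" for D
    using finite_subset[OF that finite_Basis] that
  proof (induction D rule: finite_induct)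
    case empty
    then show ?case by simp
  next
    case (insert d D)
    then obtain f where f: "\<And>b c. b \<in> D \<Longrightarrow> c \<in> D \<Longrightarrow> q (f b) (f c) = (if b = c then 1 else 0)" by force
    have "card D < card (insert d D)" using insert by simp
    also have "\<dots> \<le> DIM('e)" using insert.prems by (intro card_mono) auto
    finally have "card (f ` D) < DIM('e)" using card_image_le[OF insert.hyps(1), of f] by linarith
    then have "dim (f ` D) < DIM('e)" using dim_le_card'[of "f ` D"] insert.hyps(1) by simp
    then have "span (f ` D) \<noteq> UNIV" by (metis dim_UNIV dim_span less_irrefl)
    then obtain v where v: "v \<notin> span (f ` D)" by blast
    define u where "u = v - (\<Sum>c\<in>D. q v (f c) *\<^sub>R f c)"
    have "u \<noteq> 0"
    proof
      assume "u = 0"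
      then have "v = (\<Sum>c\<in>D. q v (f c) *\<^sub>R f c)" by (simp add: u_def)
      then show False using v by (metis (no_types, lifting) imageI span_base span_scale span_sum)
    qed
    then have uu: "q u u > 0" using inner_formD(3)[OF q] by blast
    have uf: "q u (f b) = 0" if "b \<in> D" for b
    proof -
      have "q u (f b) = q v (f b) - (\<Sum>c\<in>D. q v (f c) * q (f c) (f b))"
        by (simp add: u_def linear_diff[OF l1] linear_sum[OF l1] linear_scale[OF l1])
      also have "(\<Sum>c\<in>D. q v (f c) * q (f c) (f b)) = (\<Sum>c\<in>D. if c = b then q v (f c) else 0)"
        using f that by (intro sum.cong) auto
      also have "\<dots> = q v (f b)" using that insert.hyps(1) by simp
      finally show ?thesis by simp
    qed
    define e where "e = (1 / sqrt (q u u)) *\<^sub>R u"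
    have ee: "q e e = 1" using uu by (simp add: e_def linear_scale[OF l1] linear_scale[OF l2])
    have ef: "q e (f b) = 0" "q (f b) e = 0" if "b \<in> D" for b
      using uf[OF that] inner_formD(2)[OF q, of "f b" e] by (simp_all add: e_def linear_scale[OF l1])
    show ?case
      by (rule exI[of _ "f(d := e)"]) (use insert.hyps(2) f ee ef in auto)
  qed
  from this[OF order_refl] obtain f where f: "\<forall>b\<in>(Basis :: 'e set). \<forall>c\<in>Basis. q (f b) (f c) = (if b = c then 1 else 0)" ..
  let ?M = "\<lambda>v :: 'e. \<Sum>b\<in>Basis. (v \<bullet> b) *\<^sub>R f b"
  have M: "linear ?M" by (intro linearI) (simp_all add: inner_add_left scaleR_add_left sum.distrib scaleR_sum_right)
  have iso: "q (?M v) (?M w) = v \<bullet> w" for v w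
  proof -
    have "q (?M v) (?M w) = (\<Sum>b\<in>Basis. \<Sum>c\<in>Basis. (v \<bullet> b) * ((w \<bullet> c) * q (f b) (f c)))"
      by (subst sum.swap)
        (simp add: linear_sum[OF l1] linear_scale[OF l1] linear_sum[OF l2] linear_scale[OF l2] sum_distrib_left mult.left_commute)
    also have "\<dots> = (\<Sum>b\<in>Basis. \<Sum>c\<in>Basis. if b = c then (v \<bullet> b) * (w \<bullet> c) else 0)"
      using f by (intro sum.cong) auto
    also have "\<dots> = v \<bullet> w" by (simp add: euclidean_inner[of v w])
    finally show ?thesis .
  qed
  have "inj ?M" unfolding linear_injective_0[OF M] by (metis iso inner_eq_zero_iff linear_0[OF l1])
  then show ?thesis using M iso by blast
qed

lemma inner_form_inner: "inner_form (\<lambda>v w. v \<bullet> (w::'e::euclidean_space))"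
  unfolding inner_form_def bilinear_def
  by (auto simp: inner_commute intro!: linearI simp: inner_add_left inner_add_right)

text \<open>In a \<open>q\<close>-orthonormal frame \<open>e\<^sub>i\<close> the trace is \<open>\<Sum>\<^sub>i q(L e\<^sub>i, L e\<^sub>i)\<close>.\<close>

lemma metric_trace_pullback_form_nonneg:
  fixes q :: "'e::euclidean_space \<Rightarrow> 'e \<Rightarrow> real"
  assumes q: "inner_form q" and L: "linear L"
  shows "metric_trace q (\<lambda>v w. q (L v) (L w)) \<ge> 0"
    and "metric_trace q (\<lambda>v w. q (L v) (L w)) = 0 \<Longrightarrow> L v = 0"
proof -
  obtain M :: "'e \<Rightarrow> 'e" where M: "linear M" "inj M" "\<And>v w. q (M v) (M w) = v \<bullet> w" using orthonormal_frame[OF q] by blast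
  let ?S = "\<lambda>v w. q (L v) (L w)"
  have S: "bilinear ?S"
    using linear_compose[OF L inner_formD(5)[OF q]] linear_compose[OF L inner_formD(6)[OF q]]
    by (simp add: bilinear_def comp_def)
  have "metric_trace q ?S = metric_trace (\<lambda>v w. v \<bullet> w) (\<lambda>v w. ?S (M v) (M w))"
    using metric_trace_pullback[OF q M(1,2) S] by (simp add: M(3))
  also have "\<dots> = (\<Sum>b\<in>Basis. ?S (M b) (M b))"
    unfolding metric_trace_def using raise_unique[OF inner_form_inner, of b b for b :: 'e] by (intro sum.cong) auto
  finally have eq: "metric_trace q ?S = (\<Sum>b\<in>Basis. ?S (M b) (M b))" .
  show "metric_trace q ?S \<ge> 0" unfolding eq by (intro sum_nonneg inner_formD(4)[OF q])
  assume "metric_trace q ?S = 0"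
  then have "(\<Sum>b\<in>Basis. ?S (M b) (M b)) = 0" using eq by simp
  then have "?S (M b) (M b) = 0" if "b \<in> Basis" for b
    using that inner_formD(4)[OF q] by (subst (asm) sum_nonneg_eq_0_iff) auto
  then have 0: "L (M b) = 0" if "b \<in> Basis" for b
    using that inner_formD(3)[OF q, of "L (M b)"] by force
  obtain u where "v = M u" using linear_inj_imp_surj[OF M(1,2)] by (rule surjE)
  moreover have "L (M u) = 0" using linear_expand_Basis[OF linear_compose[OF M(1) L], of u] 0 by simp
  ultimately show "L v = 0" by simp
qed

section \<open>Inner products invariant under a bounded group\<close>

text \<open>The invariant form is found by minimisation instead of averaging.  For a symmetric form \<open>q\<close> let
  \<open>N q f\<close> be the squared Hilbert-Schmidt norm of \<open>q \<circ> (f \<times> f)\<close>, and minimise the supremum of \<open>N q\<close> over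
  the group in the convex, invariant set \<open>K\<close> of forms uniformly bounded below.  By the
  parallelogram law two almost-minimisers are close together: their midpoint is not better than
  the infimum for at least one \<open>f\<close>, so their difference is small after composition with that \<open>f\<close>,
  and \<open>f\<close> can be undone at bounded cost.  Hence minimising sequences converge, and since a
  translate of an almost-minimiser is again one, the limit is invariant.\<close>

lemma bounded_group_invariant_inner_form:
  fixes H :: "('e::euclidean_space \<Rightarrow> 'e) set"
  assumes lin: "\<And>f. f \<in> H \<Longrightarrow> linear f" and id: "(\<lambda>v. v) \<in> H"
    and comp: "\<And>f g. f \<in> H \<Longrightarrow> g \<in> H \<Longrightarrow> (\<lambda>v. f (g v)) \<in> H"
    and inv: "\<And>f. f \<in> H \<Longrightarrow> \<exists>g\<in>H. (\<forall>v. f (g v) = v) \<and> (\<forall>v. g (f v) = v)"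
    and bd: "\<And>f v. f \<in> H \<Longrightarrow> norm (f v) \<le> C * norm v"
  shows "\<exists>q. inner_form q \<and> (\<forall>f\<in>H. \<forall>v w. q (f v) (f w) = q v w)"
proof -
  have C: "C > 0"
  proof -
    obtain b :: 'e where b: "b \<in> Basis" using nonempty_Basis by blast
    then show ?thesis using bd[OF id, of b] by simp
  qed
  \<comment> \<open>the standard inner product satisfies this lower bound along the whole group, since inverses are bounded by \<open>C\<close>\<close>
  define cf where "cf = 1 / C\<^sup>2"
  have cf: "cf > 0" using C by (simp add: cf_def)
  define K where "K = {q. bilinear q \<and> (\<forall>v w. q v w = q w v) \<and> (\<forall>f\<in>H. \<forall>v. q (f v) (f v) \<ge> cf * (norm v)\<^sup>2)}"
  define N :: "('e \<Rightarrow> 'e \<Rightarrow> real) \<Rightarrow> ('e \<Rightarrow> 'e) \<Rightarrow> real"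
    where "N = (\<lambda>q f. \<Sum>b\<in>Basis. \<Sum>c\<in>Basis. (q (f b) (f c))\<^sup>2)"
  \<comment> \<open>upper bounds for \<open>N q\<close> over the group; their infimum is the minimum aimed at\<close>
  define R where "R = {r. \<exists>q\<in>K. \<forall>f\<in>H. N q f \<le> r}"
  define \<mu> where "\<mu> = Inf R"
  have N0: "N q f \<ge> 0" for q f unfolding N_def by (intro sum_nonneg) auto
  have R0: "r \<ge> 0" if "r \<in> R" for r using that N0 id unfolding R_def by (auto intro: order_trans)
  have Rbd: "bdd_below R" by (rule bdd_belowI[OF R0])
  have std: "(\<lambda>v w. v \<bullet> w) \<in> K"
  proof -
    have "cf * (norm v)\<^sup>2 \<le> f v \<bullet> f v" if f: "f \<in> H" for f v
    proof -
      obtain g where g: "g \<in> H" "g (f v) = v" using inv[OF f] by blast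
      have "norm v \<le> C * norm (f v)" using bd[OF g(1), of "f v"] g by simp
      then have "(norm v)\<^sup>2 \<le> (C * norm (f v))\<^sup>2" by (intro power_mono) auto
      then show ?thesis using C by (simp add: cf_def power_mult_distrib power2_norm_eq_inner field_simps)
    qed
    then show ?thesis using inner_form_inner unfolding K_def inner_form_def by (auto simp: inner_commute)
  qed
  have Rne: "R \<noteq> {}"
  proof -
    have "N (\<lambda>v w. v \<bullet> w) f \<le> (\<Sum>b\<in>(Basis::'e set). \<Sum>c\<in>(Basis::'e set). (C * C)\<^sup>2)" if f: "f \<in> H" for f
      unfolding N_def
    proof (intro sum_mono)
      fix b c :: 'e assume bc: "b \<in> Basis" "c \<in> Basis"
      have "norm (f b) \<le> C" "norm (f c) \<le> C" using bd[OF f, of b] bd[OF f, of c] bc by auto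
      then have "\<bar>f b \<bullet> f c\<bar> \<le> C * C"
        using Cauchy_Schwarz_ineq2[of "f b" "f c"] mult_mono[of "norm (f b)" C "norm (f c)" C] C by simp
      then show "(f b \<bullet> f c)\<^sup>2 \<le> (C * C)\<^sup>2" by (metis abs_ge_zero power2_abs power_mono)
    qed
    then show ?thesis using std unfolding R_def by blast
  qed
  have mid: "(\<lambda>v w. (1/2) * (q v w + q' v w)) \<in> K" if qK: "q \<in> K" "q' \<in> K" for q q'
  proof -
    have "bilinear (\<lambda>v w. (1/2) * (q v w + q' v w))"
      using that unfolding K_def bilinear_def
      by (auto intro!: linearI simp: linear_add linear_scale algebra_simps add_divide_distrib)
    moreover have "cf * (norm v)\<^sup>2 \<le> (1/2) * (q (f v) (f v) + q' (f v) (f v))" if f: "f \<in> H" for f v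
    proof -
      have "cf * (norm v)\<^sup>2 \<le> q (f v) (f v)" "cf * (norm v)\<^sup>2 \<le> q' (f v) (f v)"
        using qK f unfolding K_def by blast+
      from add_mono[OF this] show ?thesis by simp
    qed
    ultimately show ?thesis using that unfolding K_def by auto
  qed
  have close: "\<bar>q v w - q' v w\<bar> \<le> real DIM('e) * real DIM('e) * (C * norm v) * (C * norm w) * sqrt (8 * \<epsilon>)"
    if q: "q \<in> K" "\<And>f. f \<in> H \<Longrightarrow> N q f \<le> \<mu> + \<epsilon>" and q': "q' \<in> K" "\<And>f. f \<in> H \<Longrightarrow> N q' f \<le> \<mu> + \<epsilon>" and e: "\<epsilon> > 0"
    for q q' v w \<epsilon>
  proof -
    let ?m = "\<lambda>v w. (1/2) * (q v w + q' v w)" and ?d = "\<lambda>v w. q v w - q' v w"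
    \<comment> \<open>the midpoint competes for the infimum, so it exceeds \<open>\<mu> - \<epsilon>\<close> at some group element\<close>
    have "\<mu> - \<epsilon> \<notin> R"
      using cInf_lower[OF _ Rbd, of "\<mu> - \<epsilon>"] e unfolding \<mu>_def by force
    then obtain f where f: "f \<in> H" "N ?m f > \<mu> - \<epsilon>" using mid[OF q(1) q'(1)] unfolding R_def by force
    have "N ?d f + 4 * N ?m f = 2 * N q f + 2 * N q' f"
      unfolding N_def sum_distrib_left sum.distrib[symmetric]
      by (intro sum.cong refl) (simp add: power2_eq_square algebra_simps)
    then have Nd: "N ?d f \<le> 8 * \<epsilon>" using q(2)[OF f(1)] q'(2)[OF f(1)] f(2) by linarith
    have ent: "\<bar>?d (f b) (f c)\<bar> \<le> sqrt (8 * \<epsilon>)" if "b \<in> Basis" "c \<in> Basis" for b c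
    proof -
      have "(?d (f b) (f c))\<^sup>2 \<le> (\<Sum>c\<in>Basis. (?d (f b) (f c))\<^sup>2)"
        using that by (intro member_le_sum) auto
      also have "\<dots> \<le> N ?d f" unfolding N_def using that by (intro member_le_sum[of b Basis "\<lambda>b. \<Sum>c\<in>Basis. (?d (f b) (f c))\<^sup>2"] sum_nonneg) auto
      finally have "\<bar>?d (f b) (f c)\<bar>\<^sup>2 \<le> 8 * \<epsilon>" using Nd by simp
      then show ?thesis by (rule real_le_rsqrt)
    qed
    obtain g where g: "g \<in> H" "\<And>v. f (g v) = v" using inv[OF f(1)] by blast
    have lf: "linear f" using lin[OF f(1)] .
    have d1: "linear (\<lambda>v. ?d v w)" and d2: "linear (\<lambda>w. ?d v w)" for v w
      using q(1) q'(1) unfolding K_def bilinear_def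
      by (auto intro!: linear_compose_sub)
    have "?d v w = (\<Sum>b\<in>Basis. (g v \<bullet> b) * ?d (f b) w)"
      using linear_expand_Basis[where v = "g v", OF linear_compose[OF lf d1[of w]]] g by (simp add: comp_def)
    also have "\<dots> = (\<Sum>b\<in>Basis. (g v \<bullet> b) * (\<Sum>c\<in>Basis. (g w \<bullet> c) * ?d (f b) (f c)))"
      using linear_expand_Basis[where v = "g w", OF linear_compose[OF lf d2]] g
      by (intro sum.cong refl arg_cong2[where f = "(*)"]) (simp add: comp_def)
    also have "\<bar>\<dots>\<bar> \<le> (\<Sum>b\<in>(Basis::'e set). (C * norm v) * (\<Sum>c\<in>(Basis::'e set). (C * norm w) * sqrt (8 * \<epsilon>)))"
    proof (rule order_trans[OF sum_abs sum_mono])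
      fix b :: 'e assume b: "b \<in> Basis"
      have "\<bar>\<Sum>c\<in>Basis. (g w \<bullet> c) * ?d (f b) (f c)\<bar> \<le> (\<Sum>c\<in>(Basis::'e set). (C * norm w) * sqrt (8 * \<epsilon>))"
      proof (rule order_trans[OF sum_abs sum_mono])
        fix c :: 'e assume c: "c \<in> Basis"
        have "\<bar>g w \<bullet> c\<bar> \<le> C * norm w" using Basis_le_norm[OF c, of "g w"] bd[OF g(1), of w] by linarith
        then show "\<bar>(g w \<bullet> c) * ?d (f b) (f c)\<bar> \<le> (C * norm w) * sqrt (8 * \<epsilon>)"
          unfolding abs_mult using ent[OF b c] by (intro mult_mono) auto
      qed
      moreover have "\<bar>g v \<bullet> b\<bar> \<le> C * norm v" using Basis_le_norm[OF b, of "g v"] bd[OF g(1), of v] by linarith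
      ultimately show "\<bar>(g v \<bullet> b) * (\<Sum>c\<in>Basis. (g w \<bullet> c) * ?d (f b) (f c))\<bar>
          \<le> (C * norm v) * (\<Sum>c\<in>(Basis::'e set). (C * norm w) * sqrt (8 * \<epsilon>))"
        unfolding abs_mult by (intro mult_mono) auto
    qed
    also have "\<dots> = real DIM('e) * real DIM('e) * (C * norm v) * (C * norm w) * sqrt (8 * \<epsilon>)" by simp
    finally show ?thesis .
  qed
  have "\<exists>q\<in>K. \<forall>f\<in>H. N q f \<le> \<mu> + inverse (real (Suc n))" for n
  proof -
    have "\<exists>r\<in>R. r < \<mu> + inverse (real (Suc n))"
      using cInf_lessD[OF Rne, of "\<mu> + inverse (real (Suc n))"] unfolding \<mu>_def by auto
    then obtain r q where "q \<in> K" "\<forall>f\<in>H. N q f \<le> r" "r < \<mu> + inverse (real (Suc n))"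
      unfolding R_def by blast
    then show ?thesis by (intro bexI[of _ q] ballI) (auto intro: order_trans less_imp_le)
  qed
  then obtain q where q: "\<And>n. q n \<in> K" "\<And>n f. f \<in> H \<Longrightarrow> N (q n) f \<le> \<mu> + inverse (real (Suc n))" by metis
  define M where "M = (\<lambda>v w. real DIM('e) * real DIM('e) * (C * norm (v::'e)) * (C * norm (w::'e)))"
  have lim0: "(\<lambda>n. M v w * sqrt (8 * inverse (real (Suc n)))) \<longlonglongrightarrow> 0" for v w
    by (rule tendsto_eq_intros refl LIMSEQ_inverse_real_of_nat | simp)+
  have cauchy: "Cauchy (\<lambda>n. q n v w)" for v w
  proof (rule metric_CauchyI)
    fix e :: real assume "e > 0"
    then obtain n0 where n0: "M v w * sqrt (8 * inverse (real (Suc n0))) < e"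
      using order_tendstoD(2)[OF lim0[of v w], of e] eventually_happens'[OF sequentially_bot] by blast
    have "dist (q m v w) (q n v w) < e" if "m \<ge> n0" "n \<ge> n0" for m n
    proof -
      have "inverse (real (Suc m)) \<le> inverse (real (Suc n0))" "inverse (real (Suc n)) \<le> inverse (real (Suc n0))"
        using that by (auto intro!: le_imp_inverse_le)
      then have "N (q m) f \<le> \<mu> + inverse (real (Suc n0))" "N (q n) f \<le> \<mu> + inverse (real (Suc n0))" if "f \<in> H" for f
        using q(2)[OF that, of m] q(2)[OF that, of n] by linarith+
      then have "\<bar>q m v w - q n v w\<bar> \<le> M v w * sqrt (8 * inverse (real (Suc n0)))"
        unfolding M_def by (intro close q(1)) auto
      then show ?thesis using n0 by (simp add: dist_real_def)
    qed
    then show "\<exists>M. \<forall>m\<ge>M. \<forall>n\<ge>M. dist (q m v w) (q n v w) < e" by blast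
  qed
  define Q where "Q = (\<lambda>v w. lim (\<lambda>n. q n v w))"
  have Q: "(\<lambda>n. q n v w) \<longlonglongrightarrow> Q v w" for v w
    unfolding Q_def using cauchy by (simp add: Cauchy_convergent_iff convergent_LIMSEQ_iff)
  have lin_q: "linear (q n v)" "linear (\<lambda>v. q n v w)" for n v w using q(1)[of n] by (auto simp: K_def bilinear_def)
  have "bilinear Q" unfolding bilinear_def
  proof (intro conjI allI linearI)
    fix v w w' c
    show "Q v (w + w') = Q v w + Q v w'"
      using tendsto_add[OF Q[of v w] Q[of v w']] Q[of v "w + w'"] LIMSEQ_unique by (simp add: linear_add[OF lin_q(1)])
    show "Q v (c *\<^sub>R w) = c *\<^sub>R Q v w"
      using tendsto_mult_left[OF Q[of v w], of c] Q[of v "c *\<^sub>R w"] LIMSEQ_unique by (simp add: linear_scale[OF lin_q(1)])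
    show "Q (w + w') v = Q w v + Q w' v"
      using tendsto_add[OF Q[of w v] Q[of w' v]] Q[of "w + w'" v] LIMSEQ_unique by (simp add: linear_add[OF lin_q(2)])
    show "Q (c *\<^sub>R w) v = c *\<^sub>R Q w v"
      using tendsto_mult_left[OF Q[of w v], of c] Q[of "c *\<^sub>R w" v] LIMSEQ_unique by (simp add: linear_scale[OF lin_q(2)])
  qed
  moreover have "Q v w = Q w v" for v w
  proof -
    have "q n v w = q n w v" for n using q(1)[of n] unfolding K_def by blast
    then show ?thesis by (simp add: Q_def)
  qed
  moreover have "Q v v > 0" if v: "v \<noteq> 0" for v
  proof -
    have "cf * (norm v)\<^sup>2 \<le> q n v v" for n
    proof -
      have "\<forall>f\<in>H. \<forall>v. cf * (norm v)\<^sup>2 \<le> q n (f v) (f v)" using q(1)[of n] unfolding K_def by blast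
      from bspec[OF this id] show ?thesis by blast
    qed
    then have "cf * (norm v)\<^sup>2 \<le> Q v v" by (intro LIMSEQ_le_const[OF Q]) blast
    moreover have "cf * (norm v)\<^sup>2 > 0" using cf v by simp
    ultimately show ?thesis by linarith
  qed
  ultimately have "inner_form Q" by (simp add: inner_form_def)
  moreover have "Q (f v) (f w) = Q v w" if f: "f \<in> H" for f v w
  proof -
    have "\<bar>q n (f v) (f w) - q n v w\<bar> \<le> M v w * sqrt (8 * inverse (real (Suc n)))" for n
      unfolding M_def
    proof (rule close[of "\<lambda>v w. q n (f v) (f w)"])
      have lf: "linear f" using lin[OF f] .
      show "(\<lambda>v w. q n (f v) (f w)) \<in> K"
        using q(1)[of n] comp[OF f] linear_compose[OF lf lin_q(1)[of n]] linear_compose[OF lf lin_q(2)[of n]]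
        by (auto simp: K_def bilinear_def comp_def)
      show "N (\<lambda>v w. q n (f v) (f w)) g \<le> \<mu> + inverse (real (Suc n))" if "g \<in> H" for g
        using q(2)[OF comp[OF f that], of n] by (simp add: N_def)
    qed (use q in auto)
    then have "(\<lambda>n. q n (f v) (f w) - q n v w) \<longlonglongrightarrow> 0"
      by (intro Lim_null_comparison[OF _ lim0[of v w]]) auto
    then show ?thesis using tendsto_diff[OF Q[of "f v" "f w"] Q[of v w]] LIMSEQ_unique by fastforce
  qed
  ultimately show ?thesis by blast
qed

section \<open>Invariant forms on simple Lie algebras\<close>

text \<open>The Cauchy-Schwarz argument.  The quadratic \<open>t \<mapsto> s(v + t w, v + t w)\<close> would be negative at a
  suitable \<open>t\<close>; adding 1 to \<open>s(w, w)\<close> keeps the choice of \<open>t\<close> uniform when \<open>s(w, w) = 0\<close>.\<close>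

lemma psd_form_null_vector:
  fixes s :: "'e::real_vector \<Rightarrow> 'e \<Rightarrow> real"
  assumes s: "bilinear s" "\<And>v w. s v w = s w v" "\<And>v. s v v \<ge> 0" and v: "s v v = 0"
  shows "s v w = 0"
proof (rule ccontr)
  assume ne: "s v w \<noteq> 0"
  define p where "p = s w w + 1"
  have p: "p > 0" using s(3)[of w] by (simp add: p_def)
  define t where "t = - s v w / p"
  have "0 \<le> s (v + t *\<^sub>R w) (v + t *\<^sub>R w)" using s(3) .
  also have "\<dots> = 2 * t * s v w + t\<^sup>2 * s w w"
    using v s(2)[of w v] by (simp add: bilinear_ladd[OF s(1)] bilinear_radd[OF s(1)] bilinear_lmul[OF s(1)] bilinear_rmul[OF s(1)]
        power2_eq_square algebra_simps)
  also have "\<dots> \<le> 2 * t * s v w + t\<^sup>2 * p" by (simp add: p_def algebra_simps)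
  also have "\<dots> = - (s v w)\<^sup>2 / p" using p by (simp add: t_def field_simps power2_eq_square)
  also have "\<dots> < 0" using p ne by simp
  finally show False by simp
qed

text \<open>Schur's argument without diagonalisation.  If \<open>c\<close> is the minimum of the quotient \<open>r(v, v) / h(v, v)\<close>
  and \<open>u\<close> a minimiser, then \<open>s = r - c h\<close> is positive semidefinite with \<open>s(u, u) = 0\<close>, so \<open>u\<close> lies in the
  radical of \<open>s\<close>.  The radical of an invariant form is an ideal; being nonzero it is everything.\<close>

lemma simple_lie_algebra_invariant_form:
  fixes br :: "'e::euclidean_space \<Rightarrow> 'e \<Rightarrow> 'e"
  assumes simple: "simple_lie_algebra br" and h: "inner_form h"
    and hinv: "\<And>x v w. h (br x v) w + h v (br x w) = 0"
    and r: "bilinear r" "\<And>v w. r v w = r w v" and rinv: "\<And>x v w. r (br x v) w + r v (br x w) = 0"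
  shows "\<exists>c. \<forall>v w. r v w = c * h v w"
proof -
  have cont: "continuous_on S (\<lambda>v. g v v)" if "bilinear g" for g :: "'e \<Rightarrow> 'e \<Rightarrow> real" and S
    using bounded_bilinear.continuous_on[OF that[unfolded bilinear_conv_bounded_bilinear] continuous_on_id continuous_on_id] .
  have hpos: "h v v > 0" if "v \<noteq> 0" for v using inner_formD(3)[OF h that] .
  have ne: "sphere (0::'e) 1 \<noteq> {}" using SOME_Basis norm_Basis by force
  have nz: "\<forall>v\<in>sphere 0 1. h v v \<noteq> 0"
  proof
    fix v :: 'e assume "v \<in> sphere 0 1"
    then have "v \<noteq> 0" by force
    then show "h v v \<noteq> 0" using hpos[of v] by simp
  qed
  have "continuous_on (sphere 0 1) (\<lambda>v. r v v / h v v)"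
    by (intro continuous_on_divide cont[OF r(1)] cont[OF inner_formD(1)[OF h]] nz)
  then obtain u where u: "u \<in> sphere 0 1" "\<And>v. v \<in> sphere 0 1 \<Longrightarrow> r u u / h u u \<le> r v v / h v v"
    using continuous_attains_inf[OF compact_sphere ne] by blast
  define c where "c = r u u / h u u"
  define s where "s = (\<lambda>v w. r v w - c * h v w)"
  have "u \<noteq> 0" using u(1) by force
  have s: "bilinear s" using r(1) inner_formD(1)[OF h] unfolding s_def bilinear_def
    by (auto intro!: linear_compose_sub linear_compose_scale_right[where f = "h _"] linear_compose_scale_right[where f = "\<lambda>v. h v _"]
        simp: real_scaleR_def[symmetric] simp del: real_scaleR_def)
  have ssym: "s v w = s w v" for v w using r(2)[of v w] inner_formD(2)[OF h, of v w] by (simp add: s_def)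
  have spos: "s v v \<ge> 0" for v
  proof (cases "v = 0")
    case True then show ?thesis by (simp add: bilinear_lzero[OF s])
  next
    case False
    define e where "e = (1 / norm v) *\<^sub>R v"
    have e: "v = norm v *\<^sub>R e" "e \<in> sphere 0 1" using False by (auto simp: e_def)
    have "e \<noteq> 0" using e(2) by force
    then have "s e e \<ge> 0" using u(2)[OF e(2)] hpos[of e] by (simp add: s_def c_def[symmetric] pos_le_divide_eq)
    moreover have "s v v = norm v * norm v * s e e"
      by (subst e(1), subst (2) e(1)) (simp add: bilinear_lmul[OF s] bilinear_rmul[OF s])
    ultimately show ?thesis by simp
  qed
  have "s u u = 0" using hpos[OF \<open>u \<noteq> 0\<close>] by (simp add: s_def c_def)
  then have su: "s u w = 0" for w by (rule psd_form_null_vector[OF s ssym spos])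
  let ?I = "{v. \<forall>w. s v w = 0}"
  have "subspace ?I"
    unfolding subspace_def by (auto simp: bilinear_lzero[OF s] bilinear_ladd[OF s] bilinear_lmul[OF s])
  moreover have "\<forall>x. \<forall>v\<in>?I. br x v \<in> ?I"
  proof (intro allI ballI)
    fix x v assume v: "v \<in> ?I"
    have "s (br x v) w = - s v (br x w)" for w
    proof -
      have "h (br x v) w = - h v (br x w)" "r (br x v) w = - r v (br x w)"
        using hinv[of x v w] rinv[of x v w] by linarith+
      then show ?thesis by (simp add: s_def)
    qed
    then show "br x v \<in> ?I" using v by simp
  qed
  ultimately have "?I = {0} \<or> ?I = UNIV" using simple unfolding simple_lie_algebra_def by blast
  moreover have "u \<in> ?I" using su by blast
  ultimately have "?I = UNIV" using \<open>u \<noteq> 0\<close> by blast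
  then have "s v w = 0" for v w by blast
  then have "r v w = c * h v w" for v w by (simp add: s_def)
  then show ?thesis by blast
qed

text \<open>The centre is an ideal, and it is proper because the bracket does not vanish identically.\<close>

lemma simple_lie_algebra_center:
  fixes br :: "'e::real_vector \<Rightarrow> 'e \<Rightarrow> 'e"
  assumes simple: "simple_lie_algebra br" and br: "\<And>v. linear (br v)" "\<And>w. linear (\<lambda>v. br v w)"
    and jacobi: "\<And>x v w. br x (br v w) = br (br x v) w + br v (br x w)"
    and x: "\<And>v. br x v = 0"
  shows "x = 0"
proof -
  let ?Z = "{z. \<forall>v. br z v = 0}"
  have "subspace ?Z"
    unfolding subspace_def by (auto simp: linear_0[OF br(2)] linear_add[OF br(2)] linear_scale[OF br(2)])
  moreover have "\<forall>y. \<forall>z\<in>?Z. br y z \<in> ?Z"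
  proof (intro allI ballI)
    fix y z assume z: "z \<in> ?Z"
    have "br (br y z) v = 0" for v
      using jacobi[of y z v] z by (simp add: linear_0[OF br(1)])
    then show "br y z \<in> ?Z" by simp
  qed
  ultimately have "?Z = {0} \<or> ?Z = UNIV" using simple unfolding simple_lie_algebra_def by blast
  moreover have "?Z \<noteq> UNIV" using simple unfolding simple_lie_algebra_def by blast
  ultimately show ?thesis using x by blast
qed

section \<open>Rules for directional derivatives\<close>

context
  fixes A :: "('a::{t2_space, second_countable_topology}, 'e::euclidean_space) chart set" and S and p :: 'a
  assumes A: "smooth_atlas A" and S: "open S" "p \<in> S"
begin

lemma dir_deriv_linear:
  fixes f :: "'a \<Rightarrow> 'b::euclidean_space"
  assumes "smooth_map_on A std_atlas S f"
  shows "linear (dir_deriv A f p)"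
  using tangent_map_linear[OF A smooth_atlas_std S assms] .

lemma dir_deriv_add:
  fixes f g :: "'a \<Rightarrow> 'b::euclidean_space"
  assumes f: "smooth_map_on A std_atlas S f" and g: "smooth_map_on A std_atlas S g"
  shows "dir_deriv A (\<lambda>q. f q + g q) p h = dir_deriv A f p h + dir_deriv A g p h"
proof -
  obtain U \<phi> where c: "chart_at A p = (U, \<phi>)" by fastforce
  show ?thesis
    using dir_deriv_eqI[OF c has_derivative_add[OF dir_deriv_has_derivative[OF A S f c] dir_deriv_has_derivative[OF A S g c]]]
    by simp
qed

lemma dir_deriv_sum:
  fixes f :: "'i \<Rightarrow> 'a \<Rightarrow> 'b::euclidean_space"
  assumes f: "\<And>i. i \<in> I \<Longrightarrow> smooth_map_on A std_atlas S (f i)"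
  shows "dir_deriv A (\<lambda>q. \<Sum>i\<in>I. f i q) p h = (\<Sum>i\<in>I. dir_deriv A (f i) p h)"
proof -
  obtain U \<phi> where c: "chart_at A p = (U, \<phi>)" by fastforce
  have "((\<lambda>u. \<Sum>i\<in>I. f i (inv_into U \<phi> u)) has_derivative (\<lambda>h. \<Sum>i\<in>I. dir_deriv A (f i) p h)) (at (\<phi> p))"
    by (rule has_derivative_sum) (rule dir_deriv_has_derivative[OF A S f c])
  then show ?thesis using dir_deriv_eqI[OF c, of "\<lambda>q. \<Sum>i\<in>I. f i q"] by simp
qed

lemma dir_deriv_bounded_linear:
  fixes f :: "'a \<Rightarrow> 'b::euclidean_space" and L :: "'b \<Rightarrow> 'c::euclidean_space"
  assumes L: "bounded_linear L" and f: "smooth_map_on A std_atlas S f"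
  shows "dir_deriv A (\<lambda>q. L (f q)) p h = L (dir_deriv A f p h)"
proof -
  obtain U \<phi> where c: "chart_at A p = (U, \<phi>)" by fastforce
  show ?thesis
    using dir_deriv_eqI[OF c bounded_linear.has_derivative[OF L dir_deriv_has_derivative[OF A S f c]]]
    by simp
qed

lemma dir_deriv_bilinear:
  fixes f :: "'a \<Rightarrow> 'b::euclidean_space" and g :: "'a \<Rightarrow> 'c::euclidean_space" and B :: "'b \<Rightarrow> 'c \<Rightarrow> 'd::euclidean_space"
  assumes B: "bounded_bilinear B" and f: "smooth_map_on A std_atlas S f" and g: "smooth_map_on A std_atlas S g"
  shows "dir_deriv A (\<lambda>q. B (f q) (g q)) p h = B (f p) (dir_deriv A g p h) + B (dir_deriv A f p h) (g p)"
proof -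
  obtain U \<phi> where c: "chart_at A p = (U, \<phi>)" by fastforce
  show ?thesis
    using dir_deriv_eqI[OF c bounded_bilinear.FDERIV[OF B dir_deriv_has_derivative[OF A S f c] dir_deriv_has_derivative[OF A S g c]]]
      chart_inverse[OF A chart_at_mem[OF A c]]
    by simp
qed

lemma dir_deriv_multilinear:
  fixes fs :: "('a \<Rightarrow> 'b::euclidean_space) list" and T :: "'b list \<Rightarrow> real"
  assumes T: "multilinear_form (length fs) T" and f: "\<And>f. f \<in> set fs \<Longrightarrow> smooth_map_on A std_atlas S f"
  shows "dir_deriv A (\<lambda>q. T (map (\<lambda>f. f q) fs)) p h
    = (\<Sum>i<length fs. T ((map (\<lambda>f. f p) fs)[i := dir_deriv A (fs ! i) p h]))"
proof -
  obtain U \<phi> where c: "chart_at A p = (U, \<phi>)" by fastforce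
  let ?fs = "map (\<lambda>f u. f (inv_into U \<phi> u)) fs"
  have "((\<lambda>y. T (map (\<lambda>f. f y) ?fs)) has_derivative
     (\<lambda>h. \<Sum>i<length ?fs. T ((map (\<lambda>f. f (\<phi> p)) ?fs)[i := dir_deriv A (fs ! i) p h]))) (at (\<phi> p))"
    using T by (intro multilinear_form_has_derivative) (simp_all add: dir_deriv_has_derivative[OF A S f c])
  then have "((\<lambda>u. T (map (\<lambda>f. f (inv_into U \<phi> u)) fs)) has_derivative
     (\<lambda>h. \<Sum>i<length fs. T ((map (\<lambda>f. f p) fs)[i := dir_deriv A (fs ! i) p h]))) (at (\<phi> p))"
    by (simp add: comp_def chart_inverse[OF A chart_at_mem[OF A c]])
  then show ?thesis using dir_deriv_eqI[OF c] by fastforce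
qed

end

lemma dir_deriv_const: "dir_deriv A (\<lambda>q. k) p h = 0"
proof -
  obtain U \<phi> where c: "chart_at A p = (U, \<phi>)" by fastforce
  show ?thesis using dir_deriv_eqI[OF c, of "\<lambda>q. k", OF has_derivative_const] by simp
qed

section \<open>The adjoint representation of a Lie group\<close>

context lie_group
begin

lemma mem_carrier [simp]: "x \<in> carrier G" by (simp add: carrier_UNIV)

lemma cancel_left [simp]: "inv x \<otimes> (x \<otimes> y) = y" "x \<otimes> (inv x \<otimes> y) = y"
  by (simp_all add: m_assoc[symmetric])

abbreviation br :: "'e \<Rightarrow> 'e \<Rightarrow> 'e" where "br \<equiv> la_bracket G A"
abbreviation E :: "'e \<Rightarrow> 'a \<Rightarrow> 'e" where "E \<equiv> left_inv_vf G A"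
abbreviation adj :: "'a \<Rightarrow> 'e \<Rightarrow> 'e" where "adj \<equiv> Ad G A"

text \<open>The left trivialisation \<open>dL\<^sub>p\<^sup>-\<^sup>1\<close>, from the tangent space at \<open>p\<close> to the Lie algebra.\<close>

definition triv :: "'a \<Rightarrow> 'e \<Rightarrow> 'e" where
  "triv p = tangent_map A A (\<lambda>x. inv p \<otimes> x) p"

lemma atlas2: "smooth_atlas (prod_atlas A A)" using smooth_atlas_prod[OF atlas atlas] .

lemma smooth_fst: "smooth_map_on (prod_atlas A A) A UNIV fst" using smooth_map_on_fst[OF atlas atlas] .
lemma smooth_snd: "smooth_map_on (prod_atlas A A) A UNIV snd" using smooth_map_on_snd[OF atlas atlas] .

lemma smooth_joint_mult: "smooth_map_on (prod_atlas A A) A UNIV (\<lambda>(p, q). p \<otimes> q)"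
  using smooth_mult by (simp add: smooth_map_iff_on_UNIV)

lemma smooth_inverse: "smooth_map_on A A UNIV (\<lambda>x. inv x)"
  using smooth_inv by (simp add: smooth_map_iff_on_UNIV)

lemma smooth_mult_compose:
  assumes f: "smooth_map_on (prod_atlas A A) A UNIV f" and g: "smooth_map_on (prod_atlas A A) A UNIV g"
  shows "smooth_map_on (prod_atlas A A) A UNIV (\<lambda>z. f z \<otimes> g z)"
  using smooth_map_on_compose_UNIV[OF atlas2 atlas2 atlas open_UNIV
      smooth_map_on_Pair[OF atlas2 atlas atlas open_UNIV f g] smooth_joint_mult]
  by (simp add: comp_def)

lemma smooth_fst_inverse: "smooth_map_on (prod_atlas A A) A UNIV (\<lambda>z. inv (fst z))"
  using smooth_map_on_compose_UNIV[OF atlas2 atlas atlas open_UNIV smooth_fst smooth_inverse] by (simp add: comp_def)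

lemma smooth_joint_left_div: "smooth_map_on (prod_atlas A A) A UNIV (\<lambda>(p, q). inv p \<otimes> q)"
  using smooth_mult_compose[OF smooth_fst_inverse smooth_snd] by (simp add: case_prod_beta')

lemma smooth_joint_conj: "smooth_map_on (prod_atlas A A) A UNIV (\<lambda>(p, q). p \<otimes> q \<otimes> inv p)"
  using smooth_mult_compose[OF smooth_mult_compose[OF smooth_fst smooth_snd] smooth_fst_inverse] by (simp add: case_prod_beta')

lemma smooth_joint_swap_mult: "smooth_map_on (prod_atlas A A) A UNIV (\<lambda>(p, q). q \<otimes> p)"
  using smooth_mult_compose[OF smooth_snd smooth_fst] by (simp add: case_prod_beta')

lemma smooth_left_mult: "smooth_map_on A A UNIV (\<lambda>x. p \<otimes> x)"
  using smooth_map_on_section[OF atlas atlas atlas smooth_joint_mult] .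

lemma smooth_right_mult: "smooth_map_on A A UNIV (\<lambda>x. x \<otimes> p)"
  using smooth_map_on_section[OF atlas atlas atlas smooth_joint_swap_mult] .

lemma smooth_conj: "smooth_map_on A A UNIV (\<lambda>x. p \<otimes> x \<otimes> inv p)"
  using smooth_map_on_section[OF atlas atlas atlas smooth_joint_conj] .

lemma tangent_compose:
  "smooth_map_on A A UNIV f \<Longrightarrow> smooth_map_on A A UNIV g \<Longrightarrow>
    tangent_map A A g (f p) (tangent_map A A f p v) = tangent_map A A (\<lambda>x. g (f x)) p v"
  using tangent_map_compose[OF atlas atlas atlas open_UNIV UNIV_I open_UNIV UNIV_I, of f g p v] by (simp add: comp_def)

lemma tangent_linear: "smooth_map_on A A UNIV f \<Longrightarrow> linear (tangent_map A A f p)"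
  by (rule tangent_map_linear[OF atlas atlas open_UNIV UNIV_I])

lemma linear_E: "linear (\<lambda>v. E v p)"
  unfolding left_inv_vf_def using tangent_linear[OF smooth_left_mult] .

lemma linear_triv: "linear (triv p)"
  unfolding triv_def using tangent_linear[OF smooth_left_mult] .

lemma linear_adj: "linear (adj g)"
  unfolding Ad_def using tangent_linear[OF smooth_conj] .

lemma left_mult_E: "tangent_map A A (\<lambda>x. g \<otimes> x) p (E v p) = E v (g \<otimes> p)"
  unfolding left_inv_vf_def
proof -
  have "(\<lambda>x. g \<otimes> (p \<otimes> x)) = (\<lambda>x. (g \<otimes> p) \<otimes> x)" by (simp add: m_assoc)
  then show "tangent_map A A (\<lambda>x. g \<otimes> x) p (tangent_map A A (\<lambda>x. p \<otimes> x) \<one> v) = tangent_map A A (\<lambda>x. g \<otimes> p \<otimes> x) \<one> v"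
    using tangent_compose[OF smooth_left_mult smooth_left_mult, of g p "\<one>" v] by simp
qed

lemma E_one [simp]: "E v \<one> = v"
proof -
  have "(\<lambda>x. \<one> \<otimes> x) = (\<lambda>x. x)" by simp
  then show ?thesis unfolding left_inv_vf_def using tangent_map_id[OF atlas] by metis
qed

lemma triv_E [simp]: "triv p (E v p) = v"
  unfolding triv_def left_mult_E by simp

lemma E_triv [simp]: "E (triv p w) p = w"
  unfolding left_inv_vf_def triv_def
  using tangent_compose[OF smooth_left_mult[of "inv p"] smooth_left_mult[of p], of p w] tangent_map_id[OF atlas] by simp

lemma inj_triv: "inj (triv p)" by (metis E_triv injI)

text \<open>Together with \<open>smooth_triv\<close> this identifies smooth vector fields with smooth functions into the Lie
  algebra; both directions hold because the tangent map of a translation depends smoothly on the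
  translating element.\<close>

lemma smooth_vf_of_triv:
  assumes x: "smooth_map_on A std_atlas UNIV x"
  shows "smooth_vf A (\<lambda>p. E (x p) p)"
  unfolding smooth_vf_iff
proof safe
  fix W \<eta> assume W: "(W, \<eta>) \<in> A"
  obtain V \<psi> where c: "chart_at A \<one> = (V, \<psi>)" by fastforce
  note V = chart_at_mem[OF atlas c]
  let ?J = "joint_in_charts (W, \<eta>) (V, \<psi>) (W, \<eta>) (\<otimes>)" and ?T = "joint_domain (W, \<eta>) (V, \<psi>) (W, \<eta>) (\<otimes>)"
  have J: "smooth_on ?T ?J"
    using smooth_joint_in_charts[OF atlas atlas atlas smooth_joint_mult W V(1) W] .
  have oW: "open (\<eta> ` W)" using smooth_atlasD[OF atlas W] by blast
  have "smooth_on (\<eta> ` W) (\<lambda>u. x (inv_into W \<eta> u))" using smooth_map_on_stdD[OF x W] by simp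
  then have "smooth_on (\<eta> ` W) (\<lambda>u. fderiv ?J (u, \<psi> \<one>) (0, x (inv_into W \<eta> u)))"
    using V(2) by (intro smooth_on_derivative_along[OF oW J] smooth_on_Pair[OF oW] smooth_on_const smooth_on_ident)
      (force simp: joint_domain_def)+
  moreover have "dir_deriv A \<eta> (inv_into W \<eta> u) (E (x (inv_into W \<eta> u)) (inv_into W \<eta> u))
     = fderiv ?J (u, \<psi> \<one>) (0, x (inv_into W \<eta> u))" if u: "u \<in> \<eta> ` W" for u
  proof -
    obtain p where p: "p \<in> W" "u = \<eta> p" using u by blast
    show ?thesis
      using tangent_map_section[OF atlas atlas atlas smooth_joint_mult W V(1) W p(1) V(2), of "x p"] p
      by (simp add: chart_inverse[OF atlas W] left_inv_vf_def dir_deriv_chart_at[OF atlas c])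
  qed
  ultimately show "smooth_on (\<eta> ` W) (\<lambda>u. dir_deriv A \<eta> (inv_into W \<eta> u) (E (x (inv_into W \<eta> u)) (inv_into W \<eta> u)))"
    by (subst smooth_on_cong[OF oW]) auto
qed

lemma smooth_E: "smooth_vf A (E v)"
  using smooth_vf_of_triv[OF smooth_map_on_const[of A std_atlas UNIV v]] .

lemma smooth_triv:
  assumes X: "smooth_vf A X"
  shows "smooth_map_on A std_atlas UNIV (\<lambda>p. triv p (X p))"
proof (rule smooth_map_on_stdI[OF atlas open_UNIV])
  fix U \<phi> assume U: "(U, \<phi>) \<in> A"
  obtain V \<psi> where c: "chart_at A \<one> = (V, \<psi>)" by fastforce
  note V = chart_at_mem[OF atlas c]
  let ?F = "\<lambda>p q. inv p \<otimes> q"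
  let ?J = "joint_in_charts (U, \<phi>) (U, \<phi>) (V, \<psi>) ?F" and ?T = "joint_domain (U, \<phi>) (U, \<phi>) (V, \<psi>) ?F"
  have J: "smooth_on ?T ?J"
    using smooth_joint_in_charts[OF atlas atlas atlas smooth_joint_left_div U U V(1)] .
  have oU: "open (\<phi> ` U)" using smooth_atlasD[OF atlas U] by blast
  have "smooth_on (\<phi> ` U) (\<lambda>u. fderiv ?J (u, u) (0, dir_deriv A \<phi> (inv_into U \<phi> u) (X (inv_into U \<phi> u))))"
    using V(2) by (intro smooth_on_derivative_along[OF oU J] smooth_on_Pair[OF oU] smooth_on_const smooth_on_ident smooth_vfD[OF X U])
      (force simp: joint_domain_def)
  moreover have "triv (inv_into U \<phi> u) (X (inv_into U \<phi> u))
     = fderiv ?J (u, u) (0, dir_deriv A \<phi> (inv_into U \<phi> u) (X (inv_into U \<phi> u)))" if u: "u \<in> \<phi> ` U" for u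
  proof -
    obtain p where p: "p \<in> U" "u = \<phi> p" using u by blast
    show ?thesis
      using tangent_map_section[OF atlas atlas atlas smooth_joint_left_div U U V(1) p(1) p(1), of "X p"] p V(2)
      by (simp add: chart_inverse[OF atlas U] triv_def dir_deriv_chart_at[OF atlas c])
  qed
  ultimately show "smooth_on (\<phi> ` (U \<inter> UNIV)) (\<lambda>u. triv (inv_into U \<phi> u) (X (inv_into U \<phi> u)))"
    by (subst smooth_on_cong) (auto simp: oU)
qed

lemma smooth_adj: "smooth_map_on A std_atlas UNIV (\<lambda>g. adj g v)"
proof (rule smooth_map_on_stdI[OF atlas open_UNIV])
  fix U \<phi> assume U: "(U, \<phi>) \<in> A"
  obtain V \<psi> where c: "chart_at A \<one> = (V, \<psi>)" by fastforce
  note V = chart_at_mem[OF atlas c]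
  let ?F = "\<lambda>p q. p \<otimes> q \<otimes> inv p"
  let ?J = "joint_in_charts (U, \<phi>) (V, \<psi>) (V, \<psi>) ?F" and ?T = "joint_domain (U, \<phi>) (V, \<psi>) (V, \<psi>) ?F"
  have J: "smooth_on ?T ?J"
    using smooth_joint_in_charts[OF atlas atlas atlas smooth_joint_conj U V(1) V(1)] .
  have oU: "open (\<phi> ` U)" using smooth_atlasD[OF atlas U] by blast
  have "smooth_on (\<phi> ` U) (\<lambda>u. fderiv ?J (u, \<psi> \<one>) (0, v))"
    using V(2) by (intro smooth_on_derivative_along[OF oU J] smooth_on_Pair[OF oU] smooth_on_const smooth_on_ident)
      (force simp: joint_domain_def)
  moreover have "adj (inv_into U \<phi> u) v = fderiv ?J (u, \<psi> \<one>) (0, v)" if u: "u \<in> \<phi> ` U" for u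
  proof -
    obtain p where p: "p \<in> U" "u = \<phi> p" using u by blast
    show ?thesis
      using tangent_map_section[OF atlas atlas atlas smooth_joint_conj U V(1) V(1) p(1) V(2), of v] p V(2)
      by (simp add: chart_inverse[OF atlas U] Ad_def dir_deriv_chart_at[OF atlas c])
  qed
  ultimately show "smooth_on (\<phi> ` (U \<inter> UNIV)) (\<lambda>u. adj (inv_into U \<phi> u) v)"
    by (subst smooth_on_cong) (auto simp: oU)
qed

text \<open>Left-invariant fields are related to themselves by left translations, hence so is their bracket.\<close>

lemma lie_bracket_left_inv: "lie_bracket A (E v) (E w) p = E (br v w) p"
  using lie_bracket_related[OF atlas atlas smooth_left_mult smooth_E smooth_E left_mult_E smooth_E smooth_E left_mult_E, of p "\<one>" v w]
  by (simp add: la_bracket_def left_inv_vf_def[of G A _ p])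

text \<open>Conjugation by \<open>g\<close> relates the left-invariant field of \<open>v\<close> to that of \<open>Ad g v\<close>, because it carries
  the left translation by \<open>p\<close> into the one by \<open>g p g\<^sup>-\<^sup>1\<close>.  So \<open>Ad g\<close> is an automorphism of the bracket.\<close>

lemma conj_E: "tangent_map A A (\<lambda>x. g \<otimes> x \<otimes> inv g) p (E v p) = E (adj g v) (g \<otimes> p \<otimes> inv g)"
proof -
  have "tangent_map A A (\<lambda>x. g \<otimes> x \<otimes> inv g) p (E v p) = tangent_map A A (\<lambda>x. g \<otimes> (p \<otimes> x) \<otimes> inv g) \<one> v"
    unfolding left_inv_vf_def using tangent_compose[OF smooth_left_mult smooth_conj, of g p "\<one>" v] by simp
  also have "(\<lambda>x. g \<otimes> (p \<otimes> x) \<otimes> inv g) = (\<lambda>x. (g \<otimes> p \<otimes> inv g) \<otimes> (g \<otimes> x \<otimes> inv g))" by (simp add: m_assoc)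
  also have "tangent_map A A \<dots> \<one> v = E (adj g v) (g \<otimes> p \<otimes> inv g)"
    unfolding left_inv_vf_def Ad_def
    using tangent_compose[OF smooth_conj[of g] smooth_left_mult[of "g \<otimes> p \<otimes> inv g"], of "\<one>" v] by simp
  finally show ?thesis .
qed

lemma adj_bracket: "adj g (br v w) = br (adj g v) (adj g w)"
  using lie_bracket_related[OF atlas atlas smooth_conj smooth_E smooth_E conj_E smooth_E smooth_E conj_E, of g "\<one>" v w]
  by (simp add: la_bracket_def Ad_def)

lemma adj_mult: "adj (g \<otimes> h) v = adj g (adj h v)"
  unfolding Ad_def using tangent_compose[OF smooth_conj[of h] smooth_conj[of g], of "\<one>" v]
  by (simp add: m_assoc inv_mult_group)

lemma adj_one [simp]: "adj \<one> v = v"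
  unfolding Ad_def using tangent_map_id[OF atlas] by simp

lemma adj_inv [simp]: "adj g (adj (inv g) v) = v" "adj (inv g) (adj g v) = v"
  using adj_mult[of g "inv g" v] adj_mult[of "inv g" g v] by simp_all

lemma right_mult_adj: "tangent_map A A (\<lambda>x. x \<otimes> g) \<one> (adj g v) = E v g"
  unfolding Ad_def left_inv_vf_def
  using tangent_compose[OF smooth_conj[of g] smooth_right_mult[of g], of "\<one>" v]
  by (simp add: m_assoc)

text \<open>Let \<open>J\<close> be the multiplication in a chart around the identity and \<open>H\<close> its second derivative at the
  identity.  Left-invariant fields are derivatives of \<open>J\<close> in the second variable, so
  \<open>[x, v] = H((0, v), (x, 0)) - H((0, x), (v, 0))\<close>.  On the other hand \<open>dR\<^sub>g (Ad g v) = dL\<^sub>g v\<close> is an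
  equation between first derivatives of \<open>J\<close>, at \<open>(e, g)\<close> and \<open>(g, e)\<close>; differentiating it at \<open>g = e\<close>
  gives \<open>H((v, 0), (0, x)) + d(Ad v) x = H((0, v), (x, 0))\<close>, and \<open>H\<close> is symmetric.\<close>

theorem dir_deriv_adj: "dir_deriv A (\<lambda>g. adj g v) \<one> x = br x v"
proof -
  obtain V \<psi> where c: "chart_at A \<one> = (V, \<psi>)" by fastforce
  note V = chart_at_mem[OF atlas c]
  define J where "J = joint_in_charts (V, \<psi>) (V, \<psi>) (V, \<psi>) (\<otimes>)"
  define T where "T = joint_domain (V, \<psi>) (V, \<psi>) (V, \<psi>) (\<otimes>)"
  define u where "u = \<psi> \<one>"
  have oV: "open (\<psi> ` V)" using smooth_atlasD[OF atlas V(1)] by blast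
  have uV: "u \<in> \<psi> ` V" using V(2) by (simp add: u_def)
  have oT: "open T" unfolding T_def using open_joint_domain[OF atlas atlas atlas smooth_joint_mult V(1) V(1) V(1)] .
  have J: "smooth_on T J" unfolding T_def J_def
    using smooth_joint_in_charts[OF atlas atlas atlas smooth_joint_mult V(1) V(1) V(1)] .
  have inT: "(a, u) \<in> T" "(u, a) \<in> T" if "a \<in> \<psi> ` V" for a
    using that V(2) by (force simp: T_def joint_domain_def u_def)+
  define H where "H = (\<lambda>s t. fderiv (\<lambda>z. fderiv J z s) (u, u) t)"
  have Hsym: "H s t = H t s" for s t
    unfolding H_def using second_derivative_symmetric[OF oT J inT(1)[OF uV]] .
  have DJ: "linear (fderiv J (a, b))" if "(a, b) \<in> T" for a b
    using smooth_on_linear_derivative[OF J that] .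
  have left: "dir_deriv A \<psi> p (E w p) = fderiv J (\<psi> p, u) (0, w)" if "p \<in> V" for p w
    using tangent_map_section[OF atlas atlas atlas smooth_joint_mult V(1) V(1) V(1) that V(2), of w] that
    by (simp add: J_def u_def left_inv_vf_def dir_deriv_chart_at[OF atlas c])
  have right: "dir_deriv A \<psi> p (tangent_map A A (\<lambda>x. x \<otimes> p) \<one> w) = fderiv J (u, \<psi> p) (w, 0)" if p: "p \<in> V" for p w
  proof -
    let ?J = "joint_in_charts (V, \<psi>) (V, \<psi>) (V, \<psi>) (\<lambda>p q. q \<otimes> p)"
    have "?J = (\<lambda>z. J (snd z, fst z))" by (auto simp: J_def joint_in_charts_def)
    moreover have "((\<lambda>z. J (snd z, fst z)) has_derivative (\<lambda>h. fderiv J (u, \<psi> p) (snd h, fst h))) (at (\<psi> p, u))"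
    proof -
      have "((\<lambda>z. (snd z, fst z)) has_derivative (\<lambda>h. (snd h, fst h))) (at (\<psi> p, u))"
        by (intro has_derivative_Pair has_derivative_fst has_derivative_snd has_derivative_ident)
      moreover have "(J has_derivative fderiv J (u, \<psi> p)) (at ((\<lambda>z. (snd z, fst z)) (\<psi> p, u)))"
        using smooth_on_has_derivative[OF J inT(2)] p by simp
      ultimately show ?thesis by (rule has_derivative_compose)
    qed
    ultimately have "fderiv ?J (\<psi> p, u) = (\<lambda>h. fderiv J (u, \<psi> p) (snd h, fst h))"
      using frechet_derivative_at by (metis (no_types, lifting))
    then have "fderiv ?J (\<psi> p, u) (0, w) = fderiv J (u, \<psi> p) (w, 0)" by simp
    then show ?thesis
      using tangent_map_section[OF atlas atlas atlas smooth_joint_swap_mult V(1) V(1) V(1) p V(2), of w] p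
      by (simp add: u_def dir_deriv_chart_at[OF atlas c])
  qed
  define \<alpha> where "\<alpha> = (\<lambda>a. adj (inv_into V \<psi> a) v)"
  have \<alpha>: "(\<alpha> has_derivative dir_deriv A (\<lambda>g. adj g v) \<one>) (at u)"
    unfolding \<alpha>_def u_def by (rule dir_deriv_has_derivative[OF atlas open_UNIV UNIV_I smooth_adj c])
  have \<alpha>u: "\<alpha> u = v" using chart_inverse[OF atlas V] by (simp add: \<alpha>_def u_def)
  have eq: "fderiv J (u, a) (\<alpha> a, 0) = fderiv J (a, u) (0, v)" if a: "a \<in> \<psi> ` V" for a
  proof -
    obtain p where p: "p \<in> V" "a = \<psi> p" using a by blast
    show ?thesis using left[OF p(1), of v] right[OF p(1), of "adj p v"] right_mult_adj[of p v] p
      by (simp add: \<alpha>_def chart_inverse[OF atlas V(1)])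
  qed
  have c1: "((\<lambda>a. (u, a)) has_derivative (\<lambda>h. (0, h))) (at u)" and c2: "((\<lambda>a. (a, u)) has_derivative (\<lambda>h. (h, 0))) (at u)"
    by (intro has_derivative_Pair has_derivative_const has_derivative_ident)+
  let ?d = "dir_deriv A (\<lambda>g. adj g v) \<one>"
  have "((\<lambda>a. (\<alpha> a, 0::'e)) has_derivative (\<lambda>h. (?d h, 0))) (at u)"
    by (intro has_derivative_Pair has_derivative_const \<alpha>)
  from has_derivative_derivative_along[OF oT J c1 inT(1)[OF uV] this]
  have d1: "((\<lambda>a. fderiv J (u, a) (\<alpha> a, 0)) has_derivative
     (\<lambda>h. H (v, 0) (0, h) + fderiv J (u, u) (?d h, 0))) (at u)"
    by (simp add: \<alpha>u H_def)
  have d2: "((\<lambda>a. fderiv J (a, u) (0, w)) has_derivative (\<lambda>h. H (0, w) (h, 0))) (at u)" for w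
    using has_derivative_derivative_along[OF oT J c2 inT(1)[OF uV] has_derivative_const[of "(0::'e, w)"]]
    by (simp add: H_def linear_0[OF DJ[OF inT(1)[OF uV]]])
  have "((\<lambda>a. fderiv J (a, u) (0, v)) has_derivative
     (\<lambda>h. H (v, 0) (0, h) + fderiv J (u, u) (?d h, 0))) (at u)"
    by (rule has_derivative_transform_within_open[OF d1 oV uV eq])
  from has_derivative_unique[OF this d2]
  have key: "H (v, 0) (0, x) + fderiv J (u, u) (?d x, 0) = H (0, v) (x, 0)"
    by meson
  have idJ: "fderiv J (u, u) (w, 0) = w" for w
    using right[OF V(2), of w] tangent_map_id[OF atlas] by (simp add: u_def[symmetric] dir_deriv_chart_at[OF atlas c])
  have vf: "fderiv (vf_in_chart A (V, \<psi>) (E w)) u h = H (0, w) (h, 0)" for w h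
  proof -
    have "(vf_in_chart A (V, \<psi>) (E w) has_derivative (\<lambda>h. H (0, w) (h, 0))) (at u)"
      by (rule has_derivative_transform_within_open[OF d2 oV uV])
        (auto simp: vf_in_chart_def Let_def left chart_inverse[OF atlas V(1)])
    then show ?thesis using frechet_derivative_at by metis
  qed
  have "br x v = H (0, v) (x, 0) - H (0, x) (v, 0)"
    unfolding la_bracket_def lie_bracket_def c Let_def snd_conv u_def[symmetric] vf by simp
  also have "H (0, x) (v, 0) = H (v, 0) (0, x)" by (rule Hsym)
  also have "H (0, v) (x, 0) - H (v, 0) (0, x) = ?d x"
    using key unfolding idJ by (metis add_diff_cancel_left')
  finally show ?thesis by simp
qed

lemma br_antisym: "br v w = - br w v"
  by (simp add: la_bracket_def lie_bracket_def Let_def)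

lemma linear_br_left: "linear (\<lambda>x. br x v)"
  using dir_deriv_linear[OF atlas open_UNIV UNIV_I smooth_adj, of v "\<one>"] unfolding dir_deriv_adj[abs_def] by simp

lemma linear_br_right: "linear (br v)"
proof -
  have "br v = (\<lambda>w. - br w v)" using br_antisym by blast
  then show ?thesis using linear_compose_neg[OF linear_br_left] by simp
qed

lemma bilinear_br: "bilinear br" using linear_br_left linear_br_right by (simp add: bilinear_def)

lemma bounded_bilinear_br: "bounded_bilinear br" using bilinear_br by (simp add: bilinear_conv_bounded_bilinear)

lemma adj_derivative_bilinear:
  fixes q :: "'e \<Rightarrow> 'e \<Rightarrow> 'c::euclidean_space"
  assumes q: "bilinear q"
  shows "dir_deriv A (\<lambda>g. q (adj g v) (adj g w)) \<one> x = q (br x v) w + q v (br x w)"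
  using dir_deriv_bilinear[OF atlas open_UNIV UNIV_I q[unfolded bilinear_conv_bounded_bilinear] smooth_adj smooth_adj, of v w "\<one>" x]
  by (simp add: dir_deriv_adj add.commute)

text \<open>The derivative at the identity of \<open>Ad g [v, w] = [Ad g v, Ad g w]\<close>.\<close>

lemma jacobi: "br x (br v w) = br (br x v) w + br v (br x w)"
  using adj_derivative_bilinear[OF bilinear_br, of v w x] dir_deriv_adj[of "br v w" x]
  by (simp add: adj_bracket)

lemma adj_invariant_bilinear:
  fixes q :: "'e \<Rightarrow> 'e \<Rightarrow> real"
  assumes "bilinear q" "\<And>g v w. q (adj g v) (adj g w) = q v w"
  shows "q (br x v) w + q v (br x w) = 0"
  using adj_derivative_bilinear[OF assms(1), of v w x] by (simp add: assms(2) dir_deriv_const)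

section \<open>The bracket of fields in the left trivialisation\<close>

text \<open>The product rule for \<open>q \<mapsto> df\<^sub>q (dL\<^sub>q (y q))\<close>, which is linear in \<open>y q\<close>: one term with \<open>y\<close> frozen at
  its value at \<open>p\<close>, so that only left-invariant fields remain, and one with \<open>y\<close> differentiated.\<close>

lemma dir_deriv_along_E:
  fixes f :: "'a \<Rightarrow> 'b::euclidean_space"
  assumes S: "open S" "p \<in> S" and f: "smooth_map_on A std_atlas S f" and y: "smooth_map_on A std_atlas UNIV y"
  shows "dir_deriv A (\<lambda>q. dir_deriv A f q (E (y q) q)) p h
    = dir_deriv A (\<lambda>q. dir_deriv A f q (E (y p) q)) p h + dir_deriv A f p (E (dir_deriv A y p h) p)"
proof -
  let ?e = "\<lambda>b q. dir_deriv A f q (E b q)"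
  have e: "smooth_map_on A std_atlas S (?e b)" for b by (rule smooth_dir_deriv[OF atlas smooth_E S(1) f])
  have lin: "linear (\<lambda>v. ?e v q)" if "q \<in> S" for q
    using linear_compose[OF linear_E dir_deriv_linear[OF atlas S(1) that f]] by (simp add: comp_def)
  have ex: "?e v q = (\<Sum>b\<in>Basis. (v \<bullet> b) *\<^sub>R ?e b q)" if "q \<in> S" for v q
    by (rule linear_expand_Basis[OF lin[OF that]])
  have yS: "smooth_map_on A std_atlas S (\<lambda>q. z q \<bullet> b)" if "smooth_map_on A std_atlas UNIV z" for z and b :: 'e
    by (rule smooth_map_on_std_bounded_linear[OF atlas S(1) bounded_linear_inner_left smooth_map_on_subset[OF that]]) simp
  have main: "dir_deriv A (\<lambda>q. ?e (z q) q) p h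
     = (\<Sum>b\<in>Basis. (z p \<bullet> b) *\<^sub>R dir_deriv A (?e b) p h + (dir_deriv A z p h \<bullet> b) *\<^sub>R ?e b p)"
    if z: "smooth_map_on A std_atlas UNIV z" for z
  proof -
    have sm: "smooth_map_on A std_atlas S (\<lambda>q. (z q \<bullet> b) *\<^sub>R ?e b q)" for b
      by (rule smooth_map_on_std_bilinear[OF atlas S(1) bounded_bilinear_scaleR yS[OF z] e])
    have "dir_deriv A (\<lambda>q. ?e (z q) q) p = dir_deriv A (\<lambda>q. \<Sum>b\<in>Basis. (z q \<bullet> b) *\<^sub>R ?e b q) p"
      by (rule tangent_map_cong[OF atlas smooth_atlas_std S smooth_map_on_std_sum[OF atlas S(1) sm], symmetric])
        (rule ex[symmetric])
    then have "dir_deriv A (\<lambda>q. ?e (z q) q) p h = dir_deriv A (\<lambda>q. \<Sum>b\<in>Basis. (z q \<bullet> b) *\<^sub>R ?e b q) p h"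
      by simp
    also have "\<dots> = (\<Sum>b\<in>Basis. dir_deriv A (\<lambda>q. (z q \<bullet> b) *\<^sub>R ?e b q) p h)"
      by (rule dir_deriv_sum[OF atlas S sm])
    also have "\<dots> = (\<Sum>b\<in>Basis. (z p \<bullet> b) *\<^sub>R dir_deriv A (?e b) p h + (dir_deriv A z p h \<bullet> b) *\<^sub>R ?e b p)"
      using dir_deriv_bilinear[OF atlas S bounded_bilinear_scaleR yS[OF z] e]
        dir_deriv_bounded_linear[OF atlas open_UNIV UNIV_I bounded_linear_inner_left z] by simp
    finally show ?thesis .
  qed
  have frozen: "dir_deriv A (\<lambda>q. ?e (y p) q) p h = (\<Sum>b\<in>Basis. (y p \<bullet> b) *\<^sub>R dir_deriv A (?e b) p h)"
    using main[OF smooth_map_on_const[of A std_atlas UNIV "y p"]] by (simp add: dir_deriv_const)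
  have moving: "dir_deriv A f p (E (dir_deriv A y p h) p) = (\<Sum>b\<in>Basis. (dir_deriv A y p h \<bullet> b) *\<^sub>R ?e b p)"
    by (rule ex[OF S(2)])
  show ?thesis unfolding frozen moving main[OF y] by (rule sum.distrib)
qed

text \<open>Evaluated on a chart, the commutator of the derivations splits into the terms where \<open>x\<close> or \<open>y\<close> is
  differentiated and the bracket of the left-invariant fields with the values \<open>x p\<close> and \<open>y p\<close>.\<close>

theorem lie_bracket_triv:
  assumes x: "smooth_map_on A std_atlas UNIV x" and y: "smooth_map_on A std_atlas UNIV y"
  defines "X \<equiv> \<lambda>p. E (x p) p" and "Y \<equiv> \<lambda>p. E (y p) p"
  shows "lie_bracket A X Y p = E (dir_deriv A y p (X p) - dir_deriv A x p (Y p) + br (x p) (y p)) p"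
proof -
  obtain W \<eta> where c: "chart_at A p = (W, \<eta>)" by fastforce
  note W = chart_at_mem[OF atlas c]
  have oW: "open W" using smooth_atlasD[OF atlas W(1)] by blast
  have \<eta>: "smooth_map_on A std_atlas W \<eta>" using smooth_chart[OF atlas W(1)] .
  have d\<eta>: "dir_deriv A \<eta> p v = v" for v using dir_deriv_chart_at[OF atlas c] by simp
  have X: "smooth_vf A X" "smooth_vf A Y" unfolding X_def Y_def by (intro smooth_vf_of_triv x y)+
  have along: "dir_deriv A (\<lambda>q. dir_deriv A \<eta> q (Y q)) p h
      = dir_deriv A (\<lambda>q. dir_deriv A \<eta> q (E (y p) q)) p h + E (dir_deriv A y p h) p"
    "dir_deriv A (\<lambda>q. dir_deriv A \<eta> q (X q)) p h
      = dir_deriv A (\<lambda>q. dir_deriv A \<eta> q (E (x p) q)) p h + E (dir_deriv A x p h) p" for h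
    using dir_deriv_along_E[OF oW W(2) \<eta> y, of h] dir_deriv_along_E[OF oW W(2) \<eta> x, of h]
    by (simp_all only: X_def Y_def d\<eta>)
  have "lie_bracket A X Y p
     = dir_deriv A (\<lambda>q. dir_deriv A \<eta> q (Y q)) p (X p) - dir_deriv A (\<lambda>q. dir_deriv A \<eta> q (X q)) p (Y p)"
    using dir_deriv_lie_bracket[OF atlas X oW W(2) \<eta>] by (simp add: d\<eta>)
  also have "\<dots> = (dir_deriv A (\<lambda>q. dir_deriv A \<eta> q (E (y p) q)) p (E (x p) p) - dir_deriv A (\<lambda>q. dir_deriv A \<eta> q (E (x p) q)) p (E (y p) p))
     + (E (dir_deriv A y p (X p)) p - E (dir_deriv A x p (Y p)) p)"
    unfolding along by (simp add: X_def Y_def)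
  also have "\<dots> = E (br (x p) (y p)) p + (E (dir_deriv A y p (X p)) p - E (dir_deriv A x p (Y p)) p)"
    using dir_deriv_lie_bracket[OF atlas smooth_E[of "x p"] smooth_E[of "y p"] oW W(2) \<eta>]
    by (simp add: lie_bracket_left_inv d\<eta>)
  also have "\<dots> = E (dir_deriv A y p (X p) - dir_deriv A x p (Y p) + br (x p) (y p)) p"
    by (simp add: linear_add[OF linear_E] linear_diff[OF linear_E])
  finally show ?thesis .
qed

section \<open>The Killing form\<close>

abbreviation hk :: "'e \<Rightarrow> 'e \<Rightarrow> real" where "hk \<equiv> neg_killing G A"

lemma linear_br_br: "linear (\<lambda>x. br v (br w x))"
  using linear_compose[OF linear_br_right linear_br_right] by (simp add: comp_def)

text \<open>\<open>Ad g\<close> is an automorphism, so it conjugates \<open>ad v \<circ> ad w\<close> and leaves the trace unchanged.\<close>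

lemma killing_adj: "killing_form G A (adj g v) (adj g w) = killing_form G A v w"
proof -
  have "killing_form G A (adj g v) (adj g w) = linear_trace (\<lambda>x. adj g (br v (br w (adj (inv g) x))))"
    unfolding killing_form_def adj_bracket by simp
  also have "\<dots> = linear_trace (\<lambda>x. br v (br w (adj (inv g) (adj g x))))"
    by (rule linear_trace_commute[OF linear_adj linear_compose[OF linear_adj linear_br_br, unfolded comp_def]])
  finally show ?thesis by (simp add: killing_form_def)
qed

lemma hk_bilinear: "bilinear hk"
proof -
  have "killing_form G A (v + v') w = killing_form G A v w + killing_form G A v' w"
    "killing_form G A (c *\<^sub>R v) w = c * killing_form G A v w"
    "killing_form G A w (v + v') = killing_form G A w v + killing_form G A w v'"
    "killing_form G A w (c *\<^sub>R v) = c * killing_form G A w v" for v v' w c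
    by (simp_all add: killing_form_def linear_trace_def bilinear_ladd[OF bilinear_br] bilinear_lmul[OF bilinear_br]
        bilinear_radd[OF bilinear_br] bilinear_rmul[OF bilinear_br]
        inner_add_left sum.distrib sum_distrib_left)
  then show ?thesis unfolding bilinear_def neg_killing_def[abs_def] by (auto intro!: linearI)
qed

lemma hk_sym: "hk v w = hk w v"
  unfolding neg_killing_def killing_form_def using linear_trace_commute[OF linear_br_right linear_br_right] by simp

lemma hk_adj: "hk (adj g v) (adj g w) = hk v w" by (simp add: neg_killing_def killing_adj)

lemma hk_invariant: "hk (br x v) w + hk v (br x w) = 0"
  by (rule adj_invariant_bilinear[OF hk_bilinear hk_adj])

text \<open>For each basis vector \<open>b\<close> the orbit map \<open>g \<mapsto> Ad g b\<close> is continuous, so its image is compact.\<close>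

lemma adj_bounded:
  assumes "compact (UNIV :: 'a set)"
  shows "\<exists>C. \<forall>g v. norm (adj g v) \<le> C * norm v"
proof -
  have "\<exists>M. \<forall>g. norm (adj g b) \<le> M" for b
  proof -
    have "continuous_on UNIV (\<lambda>g. adj g b)" using smooth_map_onD(1)[OF smooth_adj] .
    then have "bounded (range (\<lambda>g. adj g b))" using compact_continuous_image assms compact_imp_bounded by blast
    then show ?thesis unfolding bounded_iff by blast
  qed
  then obtain M where M: "\<And>b g. norm (adj g b) \<le> M b" by metis
  have "norm (adj g v) \<le> (\<Sum>b\<in>Basis. M b) * norm v" for g v
  proof -
    have "norm (adj g v) = norm (\<Sum>b\<in>Basis. (v \<bullet> b) *\<^sub>R adj g b)"
      using linear_expand_Basis[OF linear_adj, of g v] by simp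
    also have "\<dots> \<le> (\<Sum>b\<in>Basis. \<bar>v \<bullet> b\<bar> * norm (adj g b))" by (rule order_trans[OF norm_sum]) simp
    also have "\<dots> \<le> (\<Sum>b\<in>Basis. norm v * M b)"
      using M by (intro sum_mono mult_mono Basis_le_norm) auto
    finally show ?thesis by (simp add: sum_distrib_left mult.commute)
  qed
  then show ?thesis by blast
qed

text \<open>For an \<open>Ad\<close>-invariant inner product \<open>q\<close> the operators \<open>ad v\<close> are \<open>q\<close>-skew, hence
  \<open>- tr (ad v)\<^sup>2\<close> is the \<open>q\<close>-trace of \<open>q(ad v x, ad v y)\<close>: it is nonnegative, and zero only if \<open>v\<close> is
  central.\<close>

theorem neg_killing_inner_form:
  assumes comp: "compact (UNIV :: 'a set)" and simple: "simple_lie_algebra br"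
  shows "inner_form hk"
proof -
  obtain C where C: "\<And>g v. norm (adj g v) \<le> C * norm v" using adj_bounded[OF comp] by blast
  have "\<exists>q. inner_form q \<and> (\<forall>f\<in>range adj. \<forall>v w. q (f v) (f w) = q v w)"
  proof (rule bounded_group_invariant_inner_form[where C = C])
    show "linear f" if "f \<in> range adj" for f using that linear_adj by auto
    show "(\<lambda>v. v) \<in> range adj" by (rule range_eqI[of _ _ "\<one>"]) auto
    show "(\<lambda>v. f (f' v)) \<in> range adj" if "f \<in> range adj" "f' \<in> range adj" for f f'
    proof -
      obtain g g' where "f = adj g" "f' = adj g'" using \<open>f \<in> range adj\<close> \<open>f' \<in> range adj\<close> by blast
      then show ?thesis by (intro range_eqI[of _ _ "g \<otimes> g'"]) (auto simp: adj_mult)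
    qed
    show "\<exists>f'\<in>range adj. (\<forall>v. f (f' v) = v) \<and> (\<forall>v. f' (f v) = v)" if "f \<in> range adj" for f
      using that adj_inv by blast
    show "norm (f v) \<le> C * norm v" if "f \<in> range adj" for f v using that C by auto
  qed
  then obtain q where q: "inner_form q" "\<And>g v w. q (adj g v) (adj g w) = q v w" by blast
  note qinv = adj_invariant_bilinear[OF inner_formD(1)[OF q(1)] q(2)]
  have tr: "hk v v = metric_trace q (\<lambda>x y. q (br v x) (br v y))" for v
  proof -
    have "killing_form G A v v = metric_trace q (\<lambda>x y. q (br v (br v x)) y)"
      unfolding killing_form_def by (rule metric_trace_endomorphism[OF q(1), symmetric])
    also have "(\<lambda>x y. q (br v (br v x)) y) = (\<lambda>x y. - 1 * q (br v x) (br v y))"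
      using qinv by (intro ext) (simp add: eq_neg_iff_add_eq_0)
    also have "metric_trace q \<dots> = - 1 * metric_trace q (\<lambda>x y. q (br v x) (br v y))" by (rule metric_trace_scale)
    finally show ?thesis by (simp add: neg_killing_def)
  qed
  have "hk v v > 0" if "v \<noteq> 0" for v
  proof -
    have "hk v v \<ge> 0" unfolding tr by (rule metric_trace_pullback_form_nonneg(1)[OF q(1) linear_br_right])
    moreover have "hk v v \<noteq> 0"
    proof
      assume "hk v v = 0"
      then have "br v w = 0" for w
        unfolding tr by (rule metric_trace_pullback_form_nonneg(2)[OF q(1) linear_br_right])
      then have "v = 0"
        by (rule simple_lie_algebra_center[OF simple linear_br_right linear_br_left jacobi])
      then show False using that by simp
    qed
    ultimately show ?thesis by simp
  qed
  then show ?thesis using hk_bilinear hk_sym by (simp add: inner_form_def)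
qed

end

section \<open>Harmonic polynomials and trace-free forms\<close>

lemma multilinear_form_slot_linear:
  assumes "multilinear_form k T" "length vs = k" "i < k"
  shows "linear (\<lambda>v. T (vs[i := v]))"
  using assms(1)[unfolded multilinear_form_def, rule_format, of "take i vs" "drop (Suc i) vs"] assms(2,3)
  by (simp add: upd_conv_take_nth_drop)

lemma multilinear_form_pullback:
  assumes "multilinear_form k T" "linear L"
  shows "multilinear_form k (\<lambda>vs. T (map L vs))"
  unfolding multilinear_form_def
proof (intro allI impI)
  fix xs ys :: "'b list" assume "length xs + length ys + 1 = k"
  then have "linear (\<lambda>v. T (map L xs @ v # map L ys))"
    using assms(1) unfolding multilinear_form_def by simp
  from linear_compose[OF assms(2) this] show "linear (\<lambda>v. T (map L (xs @ v # ys)))" by (simp add: comp_def)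
qed

lemma symmetric_form_pullback: "symmetric_form k T \<Longrightarrow> symmetric_form k (\<lambda>vs. T (map L vs))"
  unfolding symmetric_form_def by (metis length_map mset_map)

lemma multilinear_form_diff:
  "multilinear_form k S \<Longrightarrow> multilinear_form k T \<Longrightarrow> multilinear_form k (\<lambda>vs. S vs - T vs)"
  unfolding multilinear_form_def by (auto intro: linear_compose_sub)

lemma multilinear_form_sum:
  "(\<And>i. i \<in> I \<Longrightarrow> multilinear_form k (T i)) \<Longrightarrow> multilinear_form k (\<lambda>vs. \<Sum>i\<in>I. T i vs)"
  unfolding multilinear_form_def by (auto intro: linear_compose_sum)

lemma polarization_unique:
  fixes S T :: "'e::euclidean_space list \<Rightarrow> real"
  assumes "multilinear_form k S" "symmetric_form k S" "multilinear_form k T" "symmetric_form k T"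
    and "\<And>v. S (replicate k v) = T (replicate k v)" "length vs = k"
  shows "S vs = T vs"
proof -
  have "symmetric_form k (\<lambda>vs. S vs - T vs)" using assms(2,4) unfolding symmetric_form_def by metis
  from polarization_zero[OF multilinear_form_diff[OF assms(1,3)] this _ assms(6)] assms(5) show ?thesis by simp
qed

text \<open>\<open>diagonal_has_derivative\<close> for \<open>T\<close> and then for \<open>T(w, \<dots>)\<close>.\<close>

lemma diagonal_second_derivative:
  fixes T :: "'e::euclidean_space list \<Rightarrow> real"
  assumes T: "multilinear_form (Suc (Suc m)) T" "symmetric_form (Suc (Suc m)) T"
  shows "fderiv (\<lambda>y. fderiv (\<lambda>y. T (replicate (Suc (Suc m)) y)) y w) x v
    = real (Suc (Suc m)) * real (Suc m) * T (v # w # replicate m x)"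
proof -
  have "fderiv (\<lambda>y. T (replicate (Suc (Suc m)) y)) y w = real (Suc (Suc m)) * T (w # replicate (Suc m) y)" for y
    using fun_cong[OF frechet_derivative_at[OF diagonal_has_derivative[OF T, of y]], of w] by simp
  then have "fderiv (\<lambda>y. fderiv (\<lambda>y. T (replicate (Suc (Suc m)) y)) y w) x
     = fderiv (\<lambda>y. real (Suc (Suc m)) * T (w # replicate (Suc m) y)) x" by presburger
  also have "\<dots> = (\<lambda>v. real (Suc (Suc m)) * (real (Suc m) * T (w # v # replicate m x)))"
    using diagonal_has_derivative[OF multilinear_form_Cons[OF T(1)] symmetric_form_Cons[OF T(2)], of w x]
    by (intro frechet_derivative_at[symmetric] has_derivative_mult_right) simp
  finally have "fderiv (\<lambda>y. fderiv (\<lambda>y. T (replicate (Suc (Suc m)) y)) y w) x v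
     = real (Suc (Suc m)) * (real (Suc m) * T (w # v # replicate m x))" by meson
  moreover have "T (w # v # replicate m x) = T (v # w # replicate m x)"
    using T(2) unfolding symmetric_form_def by simp
  ultimately show ?thesis by simp
qed

text \<open>The Laplacian of \<open>P\<close> is, up to the factor \<open>k (k - 1)\<close>, the restriction to the diagonal of the trace of
  \<open>T\<close>, and a symmetric form vanishing on the diagonal is zero.\<close>

theorem harmonic_polarization_trace_free:
  fixes T :: "'e::euclidean_space list \<Rightarrow> real"
  assumes k: "k \<ge> 2" and P: "complete_polarization k P T" and harm: "\<And>x. flat_laplacian g P x = 0"
  shows "trace_free_form k g T"
  unfolding trace_free_form_def
proof (intro allI impI)
  fix vs :: "'e list" assume vs: "length vs + 2 = k"
  obtain m where m: "k = Suc (Suc m)" using k by (metis add_2_eq_Suc le_Suc_ex)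
  have T: "multilinear_form (Suc (Suc m)) T" "symmetric_form (Suc (Suc m)) T"
    and PT: "P = (\<lambda>v. T (replicate (Suc (Suc m)) v))"
    using P m unfolding complete_polarization_def by auto
  let ?S = "\<lambda>vs. metric_trace g (\<lambda>v w. T (v # w # vs))"
  have S: "multilinear_form m ?S"
  proof -
    have "multilinear_form m (\<lambda>vs. T (v # w # vs))" for v w
      using multilinear_form_Cons[OF multilinear_form_Cons[OF T(1), of v], of w] .
    then show ?thesis unfolding metric_trace_def
      by (rule multilinear_form_sum[of Basis m "\<lambda>b vs. T (b # raise g b # vs)"])
  qed
  have sym: "symmetric_form m ?S"
    using symmetric_form_Cons[OF symmetric_form_Cons[OF T(2)]] unfolding symmetric_form_def metric_trace_def
    by (auto intro!: sum.cong)
  have diag: "?S (replicate m x) = 0" for x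
  proof -
    have "flat_laplacian g P x = real (Suc (Suc m)) * real (Suc m) * ?S (replicate m x)"
      unfolding flat_laplacian_def PT diagonal_second_derivative[OF T] by (rule metric_trace_scale)
    then show ?thesis using harm[of x] by simp
  qed
  show "?S vs = 0" using vs m by (intro polarization_zero[OF S sym diag]) auto
qed

section \<open>The Levi-Civita connection of the Killing metric\<close>

context lie_group
begin

lemma killing_metric_triv: "killing_metric G A p v w = hk (triv p v) (triv p w)"
  by (simp add: killing_metric_def triv_def Let_def)

lemma left_inv_tensor_triv: "left_inv_tensor G A T p vs = T (map (triv p) vs)"
  by (simp add: left_inv_tensor_def triv_def)

text \<open>The Levi-Civita connection: \<open>X y + 1/2 [x, y]\<close> in the left trivialisation.\<close>

definition LC :: "('a \<Rightarrow> 'e) \<Rightarrow> ('a \<Rightarrow> 'e) \<Rightarrow> 'a \<Rightarrow> 'e" where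
  "LC X Y p = E (dir_deriv A (\<lambda>q. triv q (Y q)) p (X p) + (1/2) *\<^sub>R br (triv p (X p)) (triv p (Y p))) p"

lemma triv_LC: "triv p (LC X Y p) = dir_deriv A (\<lambda>q. triv q (Y q)) p (X p) + (1/2) *\<^sub>R br (triv p (X p)) (triv p (Y p))"
  by (simp add: LC_def)

lemma smooth_half_br:
  assumes "smooth_map_on A std_atlas UNIV x" "smooth_map_on A std_atlas UNIV y"
  shows "smooth_map_on A std_atlas UNIV (\<lambda>q. (1/2) *\<^sub>R br (x q) (y q))"
  by (rule smooth_map_on_std_bounded_linear[OF atlas open_UNIV bounded_linear_scaleR_right
        smooth_map_on_std_bilinear[OF atlas open_UNIV bounded_bilinear_br assms]])

lemma smooth_LC:
  assumes X: "smooth_vf A X" and Y: "smooth_vf A Y" shows "smooth_vf A (LC X Y)"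
  unfolding LC_def[abs_def]
  by (intro smooth_vf_of_triv smooth_map_on_std_add[OF atlas open_UNIV] smooth_half_br
      smooth_dir_deriv[OF atlas X open_UNIV] smooth_triv X Y)

lemma dd_linear: "smooth_vf A Y \<Longrightarrow> linear (dir_deriv A (\<lambda>q. triv q (Y q)) p)"
  by (rule dir_deriv_linear[OF atlas open_UNIV UNIV_I smooth_triv])

lemma affine_connection_LC: "affine_connection A LC"
  unfolding affine_connection_def
proof (intro conjI allI impI; (elim conjE)?)
  fix X Y assume "smooth_vf A X" "smooth_vf A Y"
  then show "smooth_vf A (LC X Y)" by (rule smooth_LC)
next
  fix X X' Y p assume Y: "smooth_vf A Y"
  show "LC (\<lambda>q. X q + X' q) Y p = LC X Y p + LC X' Y p"
    unfolding LC_def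
    by (simp add: linear_add[OF dd_linear[OF Y]] linear_add[OF linear_triv] linear_add[OF linear_br_left]
        linear_add[OF linear_E] scaleR_add_right)
next
  fix f X Y p assume Y: "smooth_vf A Y"
  show "LC (\<lambda>q. f q *\<^sub>R X q) Y p = f p *\<^sub>R LC X Y p"
    unfolding LC_def
    by (simp add: linear_scale[OF dd_linear[OF Y]] linear_scale[OF linear_triv] linear_scale[OF linear_br_left]
        linear_add[OF linear_E] linear_scale[OF linear_E] scaleR_add_right)
next
  fix X Y Y' p assume Y: "smooth_vf A Y" "smooth_vf A Y'"
  show "LC X (\<lambda>q. Y q + Y' q) p = LC X Y p + LC X Y' p"
    unfolding LC_def linear_add[OF linear_triv] dir_deriv_add[OF atlas open_UNIV UNIV_I smooth_triv[OF Y(1)] smooth_triv[OF Y(2)]]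
    by (simp add: linear_add[OF linear_br_right] linear_add[OF linear_E] scaleR_add_right)
next
  fix f X Y p assume f: "smooth_fun A f" and Y: "smooth_vf A Y"
  have f: "smooth_map_on A std_atlas UNIV f" using f by (simp add: smooth_map_iff_on_UNIV)
  show "LC X (\<lambda>q. f q *\<^sub>R Y q) p = f p *\<^sub>R LC X Y p + dir_deriv A f p (X p) *\<^sub>R Y p"
    unfolding LC_def linear_scale[OF linear_triv]
      dir_deriv_bilinear[OF atlas open_UNIV UNIV_I bounded_bilinear_scaleR f smooth_triv[OF Y]]
    by (simp add: linear_scale[OF linear_br_right] linear_add[OF linear_E] linear_scale[OF linear_E] scaleR_add_right)
qed

text \<open>Half the bracket is what makes the connection torsion-free, by \<open>lie_bracket_triv\<close>; it does not
  disturb compatibility with the metric, because \<open>ad x\<close> is skew for the Killing form.\<close>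

lemma levi_civita_LC: "levi_civita A (killing_metric G A) LC"
  unfolding levi_civita_def
proof (intro conjI allI impI affine_connection_LC; elim conjE)
  fix X Y p assume X: "smooth_vf A X" and Y: "smooth_vf A Y"
  let ?b = "br (triv p (X p)) (triv p (Y p))"
  have half: "(1/2) *\<^sub>R ?b + (1/2) *\<^sub>R ?b = ?b" by (simp add: scaleR_left_distrib[symmetric])
  have "LC X Y p - LC Y X p = E (dir_deriv A (\<lambda>q. triv q (Y q)) p (X p) + (1/2) *\<^sub>R ?b
      - (dir_deriv A (\<lambda>q. triv q (X q)) p (Y p) + (1/2) *\<^sub>R br (triv p (Y p)) (triv p (X p)))) p"
    unfolding LC_def by (simp only: linear_diff[OF linear_E])
  also have "dir_deriv A (\<lambda>q. triv q (Y q)) p (X p) + (1/2) *\<^sub>R ?b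
      - (dir_deriv A (\<lambda>q. triv q (X q)) p (Y p) + (1/2) *\<^sub>R br (triv p (Y p)) (triv p (X p)))
      = dir_deriv A (\<lambda>q. triv q (Y q)) p (X p) - dir_deriv A (\<lambda>q. triv q (X q)) p (Y p) + ((1/2) *\<^sub>R ?b + (1/2) *\<^sub>R ?b)"
    by (simp add: br_antisym[of "triv p (Y p)" "triv p (X p)"])
  finally show "LC X Y p - LC Y X p = lie_bracket A X Y p"
    using lie_bracket_triv[OF smooth_triv[OF X] smooth_triv[OF Y], of p] unfolding half by simp
next
  fix X Y Z p assume X: "smooth_vf A X" and Y: "smooth_vf A Y" and Z: "smooth_vf A Z"
  show "dir_deriv A (\<lambda>q. killing_metric G A q (Y q) (Z q)) p (X p)
      = killing_metric G A p (LC X Y p) (Z p) + killing_metric G A p (Y p) (LC X Z p)"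
    unfolding killing_metric_triv triv_LC
      dir_deriv_bilinear[OF atlas open_UNIV UNIV_I hk_bilinear[unfolded bilinear_conv_bounded_bilinear] smooth_triv[OF Y] smooth_triv[OF Z]]
    using hk_invariant[of "triv p (X p)" "triv p (Y p)" "triv p (Z p)"]
    by (simp add: bilinear_ladd[OF hk_bilinear] bilinear_radd[OF hk_bilinear] bilinear_lmul[OF hk_bilinear] bilinear_rmul[OF hk_bilinear])
qed

text \<open>The second derivatives of \<open>z\<close> cancel since \<open>X (Y z) - Y (X z) = [X, Y] z\<close>, and so do the terms with
  first derivatives of \<open>x\<close>, \<open>y\<close> and \<open>z\<close>.  What remains is
  \<open>1/4 [x, [y, z]] - 1/4 [y, [x, z]] - 1/2 [[x, y], z]\<close>, which the Jacobi identity simplifies.\<close>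

lemma curvature_fields:
  assumes X: "smooth_vf A X" and Y: "smooth_vf A Y" and Z: "smooth_vf A Z"
  shows "LC X (LC Y Z) p - LC Y (LC X Z) p - LC (lie_bracket A X Y) Z p
    = E ((- 1/4) *\<^sub>R br (br (triv p (X p)) (triv p (Y p))) (triv p (Z p))) p"
proof -
  define x where "x = (\<lambda>q. triv q (X q))"
  define y where "y = (\<lambda>q. triv q (Y q))"
  define z where "z = (\<lambda>q. triv q (Z q))"
  have s: "smooth_map_on A std_atlas UNIV x" "smooth_map_on A std_atlas UNIV y" "smooth_map_on A std_atlas UNIV z"
    unfolding x_def y_def z_def by (intro smooth_triv X Y Z)+
  have second: "LC V (LC W Z) p = E (dir_deriv A (\<lambda>q. dir_deriv A z q (W q)) p (V p)
      + (1/2) *\<^sub>R (br (triv p (W p)) (dir_deriv A z p (V p)) + br (dir_deriv A (\<lambda>q. triv q (W q)) p (V p)) (z p))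
      + (1/2) *\<^sub>R br (triv p (V p)) (dir_deriv A z p (W p) + (1/2) *\<^sub>R br (triv p (W p)) (z p))) p"
    if W: "smooth_vf A W" for V W
  proof -
    have "dir_deriv A (\<lambda>q. triv q (LC W Z q)) p (V p)
       = dir_deriv A (\<lambda>q. dir_deriv A z q (W q) + (1/2) *\<^sub>R br (triv q (W q)) (z q)) p (V p)"
      unfolding triv_LC z_def ..
    also have "\<dots> = dir_deriv A (\<lambda>q. dir_deriv A z q (W q)) p (V p) + dir_deriv A (\<lambda>q. (1/2) *\<^sub>R br (triv q (W q)) (z q)) p (V p)"
      by (rule dir_deriv_add[OF atlas open_UNIV UNIV_I smooth_dir_deriv[OF atlas W open_UNIV s(3)] smooth_half_br[OF smooth_triv[OF W] s(3)]])
    also have "dir_deriv A (\<lambda>q. (1/2) *\<^sub>R br (triv q (W q)) (z q)) p (V p) = (1/2) *\<^sub>R dir_deriv A (\<lambda>q. br (triv q (W q)) (z q)) p (V p)"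
      by (rule dir_deriv_bounded_linear[OF atlas open_UNIV UNIV_I bounded_linear_scaleR_right
          smooth_map_on_std_bilinear[OF atlas open_UNIV bounded_bilinear_br smooth_triv[OF W] s(3)]])
    also have "dir_deriv A (\<lambda>q. br (triv q (W q)) (z q)) p (V p)
       = br (triv p (W p)) (dir_deriv A z p (V p)) + br (dir_deriv A (\<lambda>q. triv q (W q)) p (V p)) (z p)"
      by (rule dir_deriv_bilinear[OF atlas open_UNIV UNIV_I bounded_bilinear_br smooth_triv[OF W] s(3)])
    finally have 1: "dir_deriv A (\<lambda>q. triv q (LC W Z q)) p (V p) = dir_deriv A (\<lambda>q. dir_deriv A z q (W q)) p (V p)
      + (1/2) *\<^sub>R (br (triv p (W p)) (dir_deriv A z p (V p)) + br (dir_deriv A (\<lambda>q. triv q (W q)) p (V p)) (z p))" .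
    have 2: "triv p (LC W Z p) = dir_deriv A z p (W p) + (1/2) *\<^sub>R br (triv p (W p)) (z p)"
      unfolding triv_LC z_def ..
    show ?thesis unfolding LC_def[of V "LC W Z"] 1 2 ..
  qed
  let ?l = "lie_bracket A X Y p"
  have l: "triv p ?l = dir_deriv A y p (X p) - dir_deriv A x p (Y p) + br (x p) (y p)"
    using lie_bracket_triv[OF s(1,2), of p] by (simp add: x_def y_def)
  have third: "LC (lie_bracket A X Y) Z p = E (dir_deriv A (\<lambda>q. dir_deriv A z q (Y q)) p (X p)
      - dir_deriv A (\<lambda>q. dir_deriv A z q (X q)) p (Y p)
      + (1/2) *\<^sub>R br (dir_deriv A y p (X p) - dir_deriv A x p (Y p) + br (x p) (y p)) (z p)) p"
    unfolding LC_def[of "lie_bracket A X Y"] l z_def[symmetric] fun_cong[OF z_def, symmetric]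
      dir_deriv_lie_bracket[OF atlas X Y open_UNIV UNIV_I s(3)] ..
  have quarter: "(1/4) *\<^sub>R br (x p) (br (y p) (z p)) - (1/4) *\<^sub>R br (y p) (br (x p) (z p)) - (1/2) *\<^sub>R br (br (x p) (y p)) (z p)
     = (- 1/4) *\<^sub>R br (br (x p) (y p)) (z p)"
    unfolding jacobi[of "x p" "y p" "z p"] scaleR_add_right
    by (simp add: scaleR_left_diff_distrib[symmetric])
  show ?thesis
    unfolding second[OF X] second[OF Y] third linear_diff[OF linear_E, symmetric]
      fun_cong[OF x_def, symmetric] fun_cong[OF y_def, symmetric] fun_cong[OF z_def, symmetric]
      x_def[symmetric] y_def[symmetric] quarter[symmetric]
    by (rule arg_cong[of _ _ "\<lambda>v. E v p"])
      (simp add: linear_add[OF linear_br_left] linear_diff[OF linear_br_left] linear_add[OF linear_br_right]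
        linear_scale[OF linear_br_right] algebra_simps)
qed

text \<open>Left-invariant fields extend arbitrary tangent vectors at \<open>p\<close>, so the value described in \<open>curvature\<close>
  is unique.\<close>

lemma curvature_LC:
  "curvature A LC p u v w = E ((- 1/4) *\<^sub>R br (br (triv p u) (triv p v)) (triv p w)) p"
  unfolding curvature_def
proof (rule the_equality)
  show "\<forall>X Y Z. smooth_vf A X \<and> smooth_vf A Y \<and> smooth_vf A Z \<and> X p = u \<and> Y p = v \<and> Z p = w \<longrightarrow>
      E ((- 1/4) *\<^sub>R br (br (triv p u) (triv p v)) (triv p w)) p
       = LC X (LC Y Z) p - LC Y (LC X Z) p - LC (lie_bracket A X Y) Z p"
    using curvature_fields by metis
next
  fix c assume c: "\<forall>X Y Z. smooth_vf A X \<and> smooth_vf A Y \<and> smooth_vf A Z \<and> X p = u \<and> Y p = v \<and> Z p = w \<longrightarrow>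
      c = LC X (LC Y Z) p - LC Y (LC X Z) p - LC (lie_bracket A X Y) Z p"
  let ?F = "\<lambda>v. E (triv p v)"
  have "c = LC (?F u) (LC (?F v) (?F w)) p - LC (?F v) (LC (?F u) (?F w)) p - LC (lie_bracket A (?F u) (?F v)) (?F w) p"
    using c smooth_E by simp
  then show "c = E ((- 1/4) *\<^sub>R br (br (triv p u) (triv p v)) (triv p w)) p"
    using curvature_fields[OF smooth_E smooth_E smooth_E, of "triv p u" "triv p v" "triv p w" p] by simp
qed

text \<open>Up to the factor \<open>- 1/4\<close>, \<open>u \<mapsto> [[u, v], w] = [w, [v, u]]\<close> is the operator whose trace is the Killing
  form; the trivialisation drops out of the trace by conjugation.\<close>

theorem ricci_LC: "ricci A LC p v w = 1/4 * killing_metric G A p v w"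
proof -
  let ?g = "\<lambda>u. (- 1/4) *\<^sub>R br (triv p w) (br (triv p v) u)"
  have g: "linear ?g" by (rule linear_compose_scale_right[OF linear_br_br])
  have eq: "br (br a (triv p v)) (triv p w) = br (triv p w) (br (triv p v) a)" for a
    using br_antisym[of "br a (triv p v)" "triv p w"] br_antisym[of a "triv p v"] by (simp add: linear_neg[OF linear_br_right])
  have "ricci A LC p v w = linear_trace (\<lambda>u. E (?g (triv p u)) p)"
    unfolding ricci_def curvature_LC eq ..
  also have "\<dots> = linear_trace (\<lambda>u. ?g (triv p (E u p)))"
    by (rule linear_trace_commute[OF linear_E linear_compose[OF linear_triv g, unfolded comp_def]])
  also have "\<dots> = (- 1/4) * killing_form G A (triv p w) (triv p v)"
    by (simp add: linear_trace_def killing_form_def sum_negf sum_distrib_left sum_divide_distrib)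
  also have "\<dots> = 1/4 * killing_metric G A p v w"
    using hk_sym[of "triv p w" "triv p v"] by (simp add: killing_metric_triv neg_killing_def)
  finally show ?thesis .
qed

section \<open>Left-invariant tensors of invariant forms\<close>

text \<open>A symmetric form is determined by its restriction to the diagonal, which is the invariant \<open>P\<close>.\<close>

lemma polarization_adj:
  assumes T: "complete_polarization k P T" and P: "\<And>g v. P (adj g v) = P v" and "length vs = k"
  shows "T (map (adj g) vs) = T vs"
proof -
  have T': "multilinear_form k T" "symmetric_form k T" "\<And>v. T (replicate k v) = P v"
    using T by (auto simp: complete_polarization_def)
  show ?thesis
    by (rule polarization_unique[OF multilinear_form_pullback[OF T'(1) linear_adj] symmetric_form_pullback[OF T'(2)] T'(1,2) _ assms(3)])
      (simp add: T'(3) P)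
qed

lemma invariant_form_derivation:
  assumes T: "multilinear_form (length vs) T" and inv: "\<And>g. T (map (adj g) vs) = T vs"
  shows "(\<Sum>i<length vs. T (vs[i := br x (vs ! i)])) = 0"
proof -
  let ?fs = "map (\<lambda>v g. adj g v) vs"
  have "dir_deriv A (\<lambda>g. T (map (\<lambda>f. f g) ?fs)) \<one> x
     = (\<Sum>i<length ?fs. T ((map (\<lambda>f. f \<one>) ?fs)[i := dir_deriv A (?fs ! i) \<one> x]))"
    by (rule dir_deriv_multilinear[OF atlas open_UNIV UNIV_I]) (use T in \<open>auto intro: smooth_adj\<close>)
  also have "\<dots> = (\<Sum>i<length vs. T (vs[i := br x (vs ! i)]))"
    by (intro sum.cong) (simp_all add: comp_def dir_deriv_adj)
  also have "(\<lambda>g. T (map (\<lambda>f. f g) ?fs)) = (\<lambda>g. T vs)" using inv by (simp add: comp_def)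
  finally show ?thesis by (simp add: dir_deriv_const)
qed

text \<open>In the trivialisation the derivatives of the fields cancel between the two parts of the covariant
  derivative.  What is left is \<open>- 1/2 \<Sum>\<^sub>i T(\<dots>, [x, y\<^sub>i], \<dots>)\<close>, which vanishes by invariance.\<close>

lemma parallel_left_inv_tensor:
  assumes T: "multilinear_form k T" and inv: "\<And>g vs. length vs = k \<Longrightarrow> T (map (adj g) vs) = T vs"
    and X: "smooth_vf A X" and Ys: "\<And>Y. Y \<in> set Ys \<Longrightarrow> smooth_vf A Y" "length Ys = k"
  shows "cov_deriv A LC (left_inv_tensor G A T) X Ys p = 0"
proof -
  let ?fs = "map (\<lambda>Y q. triv q (Y q)) Ys" and ?vs = "map (\<lambda>Y. triv p (Y p)) Ys" and ?x = "triv p (X p)"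
  have "dir_deriv A (\<lambda>q. left_inv_tensor G A T q (map (\<lambda>Y. Y q) Ys)) p (X p)
     = dir_deriv A (\<lambda>q. T (map (\<lambda>f. f q) ?fs)) p (X p)"
    by (simp add: left_inv_tensor_triv comp_def)
  also have "\<dots> = (\<Sum>i<length ?fs. T ((map (\<lambda>f. f p) ?fs)[i := dir_deriv A (?fs ! i) p (X p)]))"
    by (rule dir_deriv_multilinear[OF atlas open_UNIV UNIV_I]) (use T Ys in \<open>auto intro: smooth_triv\<close>)
  also have "\<dots> = (\<Sum>i<k. T (?vs[i := dir_deriv A (\<lambda>q. triv q ((Ys ! i) q)) p (X p)]))"
    using Ys(2) by (intro sum.cong) (auto simp: comp_def)
  finally have 1: "dir_deriv A (\<lambda>q. left_inv_tensor G A T q (map (\<lambda>Y. Y q) Ys)) p (X p)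
     = (\<Sum>i<k. T (?vs[i := dir_deriv A (\<lambda>q. triv q ((Ys ! i) q)) p (X p)]))" .
  have 2: "left_inv_tensor G A T p (map (\<lambda>Y. Y p) (Ys[i := LC X (Ys ! i)]))
     = T (?vs[i := dir_deriv A (\<lambda>q. triv q ((Ys ! i) q)) p (X p)]) + (1/2) * T (?vs[i := br ?x (?vs ! i)])" if i: "i < k" for i
  proof -
    have lin: "linear (\<lambda>v. T (?vs[i := v]))" using T Ys(2) i by (intro multilinear_form_slot_linear) auto
    have "left_inv_tensor G A T p (map (\<lambda>Y. Y p) (Ys[i := LC X (Ys ! i)])) = T (?vs[i := triv p (LC X (Ys ! i) p)])"
      by (simp add: left_inv_tensor_triv map_update comp_def)
    then show ?thesis using i Ys(2) by (simp add: triv_LC linear_add[OF lin] linear_scale[OF lin])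
  qed
  have "(\<Sum>i<k. T (?vs[i := br ?x (?vs ! i)])) = 0"
    using invariant_form_derivation[of ?vs T ?x] T inv[of ?vs] Ys(2) by simp
  moreover have "(\<Sum>i<k. left_inv_tensor G A T p (map (\<lambda>Y. Y p) (Ys[i := LC X (Ys ! i)])))
     = (\<Sum>i<k. T (?vs[i := dir_deriv A (\<lambda>q. triv q ((Ys ! i) q)) p (X p)])) + (1/2) * (\<Sum>i<k. T (?vs[i := br ?x (?vs ! i)]))"
    unfolding sum_distrib_left sum.distrib[symmetric] by (rule sum.cong[OF refl]) (simp only: 2 lessThan_iff)
  ultimately show ?thesis unfolding cov_deriv_def 1 Ys(2) by simp
qed

lemma rho_form_adj:
  assumes h: "inner_form hk" and T: "multilinear_form (Suc m) T"
    and inv: "\<And>g vs. length vs = Suc m \<Longrightarrow> T (map (adj g) vs) = T vs"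
  shows "rho_form (Suc m) hk T (adj g v) (adj g w) = rho_form (Suc m) hk T v w"
proof -
  have inj: "inj (adj g)" by (metis adj_inv(2) injI)
  have "rho_form (Suc m) hk T (adj g v) (adj g w) = rho_form (Suc m) (\<lambda>v w. hk (adj g v) (adj g w)) (\<lambda>bs. T (map (adj g) bs)) v w"
    by (rule rho_form_pullback[OF h linear_adj inj T, symmetric])
  also have "\<dots> = rho_form (Suc m) hk (\<lambda>bs. T (map (adj g) bs)) v w" by (simp add: hk_adj)
  also have "\<dots> = rho_form (Suc m) hk T v w"
  proof -
    have "T (adj g u # map (adj g) bs) = T (u # bs)" if "length bs = m" for u bs
      using inv[of "u # bs" g] that by simp
    then show ?thesis unfolding rho_form_def by (intro sum.cong refl) (simp del: map_map)
  qed
  finally show ?thesis .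
qed

theorem rho_form_proportional:
  assumes simple: "simple_lie_algebra br" and h: "inner_form hk" and T: "multilinear_form (Suc m) T"
    and inv: "\<And>g vs. length vs = Suc m \<Longrightarrow> T (map (adj g) vs) = T vs"
  shows "\<exists>c. \<forall>v w. rho_form (Suc m) hk T v w = c * hk v w"
proof (rule simple_lie_algebra_invariant_form[of br hk "rho_form (Suc m) hk T", OF simple h hk_invariant])
  show bil: "bilinear (rho_form (Suc m) hk T)" by (rule rho_form_bilinear[OF T])
  show "rho_form (Suc m) hk T v w = rho_form (Suc m) hk T w v" for v w by (rule rho_form_commute[OF h T])
  show "rho_form (Suc m) hk T (br x v) w + rho_form (Suc m) hk T v (br x w) = 0" for x v w
    by (rule adj_invariant_bilinear[OF bil rho_form_adj[OF h T inv]])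
qed

end

theorem theorem4p12:
  fixes G :: "'a::{t2_space, second_countable_topology} monoid"
    and A :: "('a, 'e::euclidean_space) chart set"
    and k :: nat and P :: "'e \<Rightarrow> real" and T :: "'e list \<Rightarrow> real"
  assumes "lie_group G A"
    and "connected (UNIV :: 'a set)"
    and "compact (UNIV :: 'a set)"
    and "simple_lie_algebra (la_bracket G A)"
    and "DIM('e) > 3"
    and "k \<ge> 3"
    and "homogeneous_polynomial k P"
    and "\<And>g v. P (Ad G A g v) = P v"
    and "\<And>x. flat_laplacian (neg_killing G A) P x = 0"
    and "complete_polarization k P T"
  shows "\<forall>c::real. \<exists>\<kappa>::real.
           coupled_einstein A k (killing_metric G A) (left_inv_tensor G A T) c \<kappa>"
proof
  fix c :: real
  interpret lie_group G A by fact
  let ?h = "killing_metric G A" and ?\<omega> = "left_inv_tensor G A T"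
  obtain m where m: "k = Suc m" using assms(6) by (cases k) auto
  have T: "multilinear_form k T" "symmetric_form k T" using assms(10) by (auto simp: complete_polarization_def)
  have inv: "T (map (adj g) vs) = T vs" if "length vs = k" for g vs
    using polarization_adj[OF assms(10) assms(8) that] .
  have h: "inner_form hk" using neg_killing_inner_form[OF assms(3,4)] .
  have km: "?h p = (\<lambda>v w. hk (triv p v) (triv p w))" for p
    by (intro ext) (rule killing_metric_triv)
  have kmi: "inner_form (?h p)" for p
    unfolding km by (rule inner_form_pullback[OF h linear_triv inj_triv])
  have \<omega>: "?\<omega> p = (\<lambda>vs. T (map (triv p) vs))" for p
    by (rule ext) (rule left_inv_tensor_triv)
  obtain l where l: "\<And>v w. rho_form (Suc m) hk T v w = l * hk v w"
    using rho_form_proportional[OF assms(4) h T(1)[unfolded m]] inv m by blast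
  have rho: "rho_form k (?h p) (?\<omega> p) = (\<lambda>v w. l * ?h p v w)" for p
    using rho_form_pullback[OF h linear_triv inj_triv T(1)[unfolded m], of p] l unfolding km \<omega> m by (intro ext) simp
  define n where "n = real DIM('e)"
  have n: "n > 3" using assms(5) by (simp add: n_def)
  have norm: "norm_sq_form k (?h p) (?\<omega> p) = l * n" for p
    using rho[of p] metric_trace_self[OF kmi[of p]] unfolding m norm_sq_form_trace by (simp add: metric_trace_scale n_def)
  have scal: "scalar_curvature A (?h) LC p = 1/4 * n" for p
  proof -
    have "ricci A LC p = (\<lambda>v w. 1/4 * ?h p v w)" by (intro ext) (rule ricci_LC)
    then show ?thesis
      unfolding scalar_curvature_def using metric_trace_self[OF kmi[of p]] by (simp only: metric_trace_scale n_def)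
  qed
  \<comment> \<open>with \<open>Ric = h/4\<close>, \<open>scal = n/4\<close>, \<open>\<rho> = l h\<close> and \<open>|\<omega>|\<^sup>2 = l n\<close>, the equation is linear in \<open>\<kappa>\<close>, with coefficient \<open>(n - 2) / (2 n) > 0\<close>\<close>
  define \<kappa> where "\<kappa> = 2 * n / (n - 2) * (c * (l - 1/2 * (l * n)) - 1/4 + 1/2 * (1/4 * n))"
  have "coupled_einstein A k (?h) (?\<omega>) c \<kappa>"
    unfolding coupled_einstein_def
  proof (intro conjI exI[of _ LC] allI)
    show "smooth_atlas A" by (rule atlas)
    show "k \<ge> 2" using assms(6) by simp
    show "levi_civita A (?h) LC" by (rule levi_civita_LC)
    show "riemannian_metric A (?h)"
      unfolding riemannian_metric_def
    proof (intro conjI allI impI; (elim conjE)?)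
      fix X Y assume X: "smooth_vf A X" and Y: "smooth_vf A Y"
      show "smooth_fun A (\<lambda>p. ?h p (X p) (Y p))"
        unfolding smooth_map_iff_on_UNIV killing_metric_triv
        by (rule smooth_map_on_std_bilinear[OF atlas open_UNIV inner_formD(1)[OF h, unfolded bilinear_conv_bounded_bilinear]
            smooth_triv[OF X] smooth_triv[OF Y]])
    qed (use inner_formD[OF kmi] in auto)
    show "symmetric_tensor_field A k (?\<omega>)"
      unfolding symmetric_tensor_field_def
    proof (intro conjI allI impI; (elim conjE)?)
      show "multilinear_form k (?\<omega> p)" for p
        unfolding \<omega> by (rule multilinear_form_pullback[OF T(1) linear_triv])
      show "symmetric_form k (?\<omega> p)" for p
        unfolding \<omega> by (rule symmetric_form_pullback[OF T(2)])
      fix Xs assume Xs: "length Xs = k" "\<forall>X\<in>set Xs. smooth_vf A X"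
      have "smooth_map_on A std_atlas UNIV (\<lambda>p. T (map (\<lambda>f. f p) (map (\<lambda>X p. triv p (X p)) Xs)))"
        using Xs T(1) by (intro smooth_map_on_std_multilinear[OF atlas open_UNIV]) (auto intro: smooth_triv)
      then show "smooth_fun A (\<lambda>p. ?\<omega> p (map (\<lambda>X. X p) Xs))"
        by (simp add: smooth_map_iff_on_UNIV \<omega> comp_def)
    qed
    show "trace_free_form k (?h p) (?\<omega> p)" for p
      unfolding trace_free_form_def
    proof (intro allI impI)
      fix vs :: "'e list" assume vs: "length vs + 2 = k"
      have "bilinear (\<lambda>v w. T (v # w # map (triv p) vs))"
        using T(1)[unfolded multilinear_form_def, rule_format, of "[]"] T(1)[unfolded multilinear_form_def, rule_format, of "[x]" for x] vs
        by (auto simp: bilinear_def)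
      from metric_trace_pullback[OF h linear_triv inj_triv this, of p]
      show "metric_trace (?h p) (\<lambda>v w. ?\<omega> p (v # w # vs)) = 0"
        using harmonic_polarization_trace_free[OF _ assms(10,9)] assms(6) vs
        unfolding km \<omega> trace_free_form_def by simp
    qed
    show "codazzi A LC k (?\<omega>)"
      unfolding codazzi_def
    proof (intro allI impI; elim conjE)
      fix X Y Zs p assume X: "smooth_vf A X" and Y: "smooth_vf A Y" and Zs: "\<forall>Z\<in>set Zs. smooth_vf A Z" "length Zs + 1 = k"
      have "cov_deriv A LC (?\<omega>) X (Y # Zs) p = 0"
        "cov_deriv A LC (?\<omega>) Y (X # Zs) p = 0"
        using X Y Zs by (intro parallel_left_inv_tensor[OF T(1) inv]; auto)+
      then show "cov_deriv A LC (?\<omega>) X (Y # Zs) p = cov_deriv A LC (?\<omega>) Y (X # Zs) p" by simp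
    qed
    have "1/4 - 1/2 * (1/4 * n) + (n - 2) / (2 * n) * \<kappa> = c * (l - 1/2 * (l * n))"
      using n by (simp add: \<kappa>_def)
    then have eq: "1/4 * t - 1/2 * (1/4 * n) * t + (n - 2) / (2 * n) * \<kappa> * t = c * (l * t - 1/2 * (l * n) * t)" for t
      by (metis (no_types, opaque_lifting) left_diff_distrib mult.assoc ring_class.ring_distribs(2))
    show "let n = real DIM('e) in \<forall>p v w.
           ricci A LC p v w - 1/2 * scalar_curvature A (?h) LC p * ?h p v w
             + (n - 2) / (2 * n) * \<kappa> * ?h p v w
           = c * (rho_form k (?h p) (?\<omega> p) v w
             - 1/2 * norm_sq_form k (?h p) (?\<omega> p) * ?h p v w)"
      unfolding Let_def ricci_LC scal rho norm n_def[symmetric] using eq by blast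
  qed
  then show "\<exists>\<kappa>. coupled_einstein A k (?h) (?\<omega>) c \<kappa>" ..
qed

end
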